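(* Let $\mathcal{K}$ be a FUR-class with monster model $\mathbb{M}$. Let $a\in\mathbb{M}$, $A\subset\mathbb{M}$, and let $\alpha=\mathrm{Cb}(a/A)$. Then $t(a/\alpha)$ is stationary.
   Context: SETTING. $(\mathcal{K},\preccurlyeq)$ is an abstract elementary class (AEC) with monster model $\mathbb{M}$: a $\delta$-model homogeneous and $\delta$-universal member of $\mathcal{K}$, $\delta$ a large cardinal. "Bounded" means of size $<\delta$. "Model" means $\mathcal{A}\in\mathcal{K}$, $\mathcal{A}\preccurlyeq\mathbb{M}$; models and parameter sets are bounded unless $\mathbb{M}$ itself is mentioned. $a\in X$ may be a finite tuple; juxtaposition denotes union or concatenation. TYPES. $\mathrm{Aut}(\mathbb{M}/A)$ is the group of automorphisms of $\mathbb{M}$ fixing $A$ pointwise. $a,b$ have the same Galois type over $A$, $t^g(a/A)=t^g(b/A)$, if $f(a)=b$ for some $f\in\mathrm{Aut}(\mathbb{M}/A)$; they have the same weak type, $t(a/A)=t(b/A)$, if $t^g(a/B)=t^g(b/B)$ for all finite $B\subseteq A$ (types of models are types of enumerations). For $A\subseteq B$ with $A$ finite, $t(a/B)$ splits over $A$ if there are $b,c\in B$ with $t(b/A)=t(c/A)$ but $t(ab/A)\ne t(ac/A)$. $a\downarrow^{ns}_B C$ means that $t(a/B\cup C)$ does not split over some finite $A\subseteq B$; $A\downarrow^{ns}_B C$ means $a\downarrow^{ns}_BC$ for each $a\in A$. FUR-CLASS. $\mathcal{K}$ is a FUR-class if it has AP and JEP, $LS(\mathcal{K})=\omega$, has arbitrarily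 large structures, contains no finite models, and satisfies: (AI) Every countable model $\mathcal{A}$ is s-saturated: for any $b\in\mathbb{M}$ and finite $A\subseteq\mathcal{A}$ there is $a\in\mathcal{A}$ with $t(a/A)=t(b/A)$. (AII) For all $a$ and countable $\mathcal{A}$ there is an s-primary model $\mathcal{B}=\mathcal{A}a\cup\bigcup_{i<\omega}a_i$ over $\mathcal{A}a$. [s-primary: the $a_i$ are singletons and for all $n<\omega$ there is a finite $A_n\subset\mathcal{A}$ such that for all $(a',a_0',\dots,a_n')$ with $t(a'/\mathcal{A})=t(a/\mathcal{A})$: $t(a',a_0',\dots,a_n'/A_n)=t(a,a_0,\dots,a_n/A_n)$ implies $t(a',a_0',\dots,a_n'/\mathcal{A})=t(a,a_0,\dots,a_n/\mathcal{A})$.] (AIII) Let $\mathcal{A},\mathcal{B},\mathcal{C}$ be models with $\mathcal{A}\downarrow^{ns}_{\mathcal{B}}\mathcal{C}$ and $\mathcal{B}=\mathcal{A}\cap\mathcal{C}$. Then there is a unique (not only up to isomorphism) s-prime model $\mathcal{D}$ over $\mathcal{A}\cup\mathcal{C}$; furthermore, if $\mathcal{C}\subseteq\mathcal{C}'$ and $\mathcal{A}\downarrow^{ns}_{\mathcal{B}}\mathcal{C}'$, then $\mathcal{D}\downarrow^{ns}_{\mathcal{C}}\mathcal{C}'$. [For models $\mathcal{A}_i$, $i<\alpha$, and $A=\bigcup_{i<\alpha}\mathcal{A}_i$, a map $f:A\to\mathbb{M}$ is weakly elementary w.r.t. $(\mathcal{A}_i)_{i<\alpha}$ if $t(a/\emptyset)=t(f(a)/\emptyset)$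 for all $a\in A$ and $f(\mathcal{A}_i)\preccurlyeq\mathbb{M}$ for all $i$. A model $\mathcal{D}$ is s-prime over $A$ if for every model $\mathcal{B}$ and every $f:A\to\mathcal{B}$ weakly elementary w.r.t. $(\mathcal{A}_i)_{i<\alpha}$ there is an elementary embedding $g:\mathcal{D}\to\mathcal{B}$ with $f\subseteq g$.] (AIV) For each $a\in\mathbb{M}$ there is $n<\omega$ such that for every countable model $\mathcal{A}$ and finite $A\subset\mathcal{A}$, player II has a winning strategy in $GI(a,A,\mathcal{A})$ in $n$ moves. [$GI(a,A,\mathcal{A})$: start with $a_0=a$, $A_0=A$. At move $n$, player I chooses $a_{n+1}\in\mathbb{M}$ and a finite $A_{n+1}'\subseteq\mathcal{A}$ with $t(a_{n+1}/A_n)=t(a_n/A_n)$, $A_n\subseteq A'_{n+1}$ and $t(a_{n+1}/A'_{n+1})\ne t(a_n/A'_{n+1})$; then player II chooses a finite $A_{n+1}\subseteq\mathcal{A}$ with $A'_{n+1}\subseteq A_{n+1}$. Player II wins if player I can no longer move.] (AV) If $\mathcal{A}\subseteq\mathcal{B}$ are countable models, $a\in\mathbb{M}$ and $\mathcal{B}\downarrow^{ns}_{\mathcal{A}}a$, then $a\downarrow^{ns}_{\mathcal{A}}\mathcal{B}$. (AVI) For all models $\mathcal{A},\mathcal{B},\mathcal{D}$ with $\mathcal{A}\subseteq\mathcal{B}\cap\mathcal{D}$ there is a model $\mathcal{C}$ with $t(\mathcal{C}/\mathcal{A})=t(\mathcal{B}/\mathcal{A})$ and $\mathcal{C}\downarrow^{ns}_{\mathcal{A}}\mathcal{D}$.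 INDEPENDENCE. For finite $A$, $E(A)$ is the set of $\mathrm{Aut}(\mathbb{M}/A)$-invariant equivalence relations on powers $\mathbb{M}^n$ with boundedly many classes; $Lt(a/B)=Lt(b/B)$ means $(a,b)\in E$ for all finite $A\subseteq B$ and $E\in E(A)$. For $A\subseteq B$, $A$ finite, $t(a/B)$ Lascar splits over $A$ if there are $b,c\in B$ with $Lt(b/A)=Lt(c/A)$ and $t(ab/A)\neq t(ac/A)$. $a\downarrow_B C$ means: there is a finite $A\subseteq B$ such that for all $D\supseteq B\cup C$ there is $b$ with $t(b/B\cup C)=t(a/B\cup C)$ and $t(b/D)$ not Lascar splitting over $A$. For $B\subset C$, $t(d'/C)$ is a free extension of $t(d/B)$ into $C$ if $t(d/B)=t(d'/B)$ and $d'\downarrow_B C$; a type is stationary if it has a unique free extension to any set. IMAGINARIES. $\mathcal{E}$ is a countable collection of $\emptyset$-invariant equivalence relations $E\subseteq\mathbb{M}^n\times\mathbb{M}^n$ (various $n$), containing equality, each given by a countable collection $G_E$ of Galois types via $(a,b)\in E$ iff $t^g(ab/\emptyset)\in G_E$. $\mathbb{M}^{eq}=\{a/E:a\in\mathbb{M},E\in\mathcal{E}\}$, with $a$ identified with $a/{=}$, the structure of $\mathbb{M}$ on $P_=$, and predicates $P_E$ for $\{a/E:a\in\mathbb{M}\}$ and functions $F_E(a)=a/E$. All notions above also apply in $\mathbb{M}^{eq}$, with models $\mathcal{A}^{eq}=\{a/E:a\in\mathcal{A},E\in\mathcal{E}\}$; stationarity of $t(a/\alpha)$ is understood in $\mathbb{M}^{eq}$.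 GLOBAL TYPES. The supermonster $\mathbb{M}'\in\mathcal{K}$ is a $|\mathbb{M}'|$-model homogeneous and universal structure with $\mathbb{M}\preccurlyeq\mathbb{M}'$ and $|\mathbb{M}'|>|\mathbb{M}|$. Types, Lascar types and independence for elements of $\mathbb{M}'$ are computed in $\mathbb{M}'$. A global type $p$ is a maximal collection $\{p_A:A\subset\mathbb{M}\text{ finite}\}$ such that $p_A$ is a Galois type over $A$, whenever $A\subseteq B$ and $b\in\mathbb{M}$ realizes $p_B$ then $b$ realizes $p_A$, and some single $b\in\mathbb{M}'$ realizes $p_A$ for every finite $A\subset\mathbb{M}$. For $f\in\mathrm{Aut}(\mathbb{M}^{eq})$, $f(p)=p$ means: for all finite $A,B\subset\mathbb{M}$ with $f(B)=A$ and all $b$ realizing $p_B$, $f(b)$ realizes $p_A$. $\alpha\in\mathbb{M}^{eq}$ is a canonical base for $p$ if for every $f\in\mathrm{Aut}(\mathbb{M}^{eq})$: $f(p)=p$ iff $f(\alpha)=\alpha$. For $a\in\mathbb{M}$ and $A\subset\mathbb{M}$, there is $b\in\mathbb{M}'$ with $Lt(b/A)=Lt(a/A)$ and $b\downarrow_A\mathbb{M}$; a canonical base for $a$ over $A$, written $\alpha=\mathrm{Cb}(a/A)$, is a canonical base of $t(b/\mathbb{M})$. STANDING CHOICE OF $\mathcal{E}$ (ensuring canonical bases exist in $\mathbb{M}^{eq}$). For a global type $p$ realized by $b\in\mathbb{M}'$ with $t(b/\mathbb{M})$ not splitting over a finite tuple $a\in\mathbb{M}$: for $c\in\mathbb{M}$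 let $q_c=t(bc/\emptyset)$ and let $q_i^c$, $i<\omega$, be types over $\emptyset$ such that for all $d\in\mathbb{M}$, $bd$ realizes $q_c$ iff $ad$ realizes some $q_i^c$. Let $(a_0,a_1)\in E$ iff for all $c,d\in\mathbb{M}$: $a_0d$ realizes some $q_i^c$ iff $a_1d$ realizes some $q_i^c$. These $E$ depend only on $t(ba/\emptyset)$; $\mathcal{E}$ contains all of them. *)

theory Defs
  imports "HOL-Library.Countable_Set"
begin

unbundle cardinal_syntax

section \<open>Structures\<close>

text \<open>
  All structures live on subsets of one type \<^typ>\<open>'a\<close>, which plays the role of the set-theoretic
  universe: a class of structures is a set of structures carried by subsets of \<^typ>\<open>'a\<close>.
\<close>

record ('r, 'f) language =
  rel_syms :: "'r set"
  fun_syms :: "'f set"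
  rel_arity :: "'r \<Rightarrow> nat"
  fun_arity :: "'f \<Rightarrow> nat"

record ('a, 'r, 'f) fo_struct =
  car :: "'a set"
  rel_of :: "'r \<Rightarrow> 'a list set"
  fun_of :: "'f \<Rightarrow> 'a list \<Rightarrow> 'a"

definition tuples :: "nat \<Rightarrow> 'a set \<Rightarrow> 'a list set" where
  "tuples n X = {xs \<in> lists X. length xs = n}"

text \<open>Interpretations carry no junk, so a structure is determined by its restriction to its carrier.\<close>

definition is_struct :: "('r, 'f) language \<Rightarrow> ('a, 'r, 'f) fo_struct \<Rightarrow> bool" where
  "is_struct L A \<longleftrightarrow>
     (\<forall>R\<in>rel_syms L. rel_of A R \<subseteq> tuples (rel_arity L R) (car A)) \<and>
     (\<forall>R. R \<notin> rel_syms L \<longrightarrow> rel_of A R = {}) \<and>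
     (\<forall>F\<in>fun_syms L. \<forall>xs\<in>tuples (fun_arity L F) (car A). fun_of A F xs \<in> car A) \<and>
     (\<forall>F xs. \<not> (F \<in> fun_syms L \<and> xs \<in> tuples (fun_arity L F) (car A)) \<longrightarrow> fun_of A F xs = undefined)"

definition substruct ::
    "('r, 'f) language \<Rightarrow> ('a, 'r, 'f) fo_struct \<Rightarrow> ('a, 'r, 'f) fo_struct \<Rightarrow> bool" where
  "substruct L A B \<longleftrightarrow> is_struct L A \<and> is_struct L B \<and> car A \<subseteq> car B \<and>
     (\<forall>R\<in>rel_syms L. rel_of A R = rel_of B R \<inter> lists (car A)) \<and>
     (\<forall>F\<in>fun_syms L. \<forall>xs\<in>tuples (fun_arity L F) (car A). fun_of A F xs = fun_of B F xs)"

definition induced ::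
    "('r, 'f) language \<Rightarrow> ('a, 'r, 'f) fo_struct \<Rightarrow> 'a set \<Rightarrow> ('a, 'r, 'f) fo_struct" where
  "induced L M S =
     \<lparr> car = S,
       rel_of = (\<lambda>R. rel_of M R \<inter> lists S),
       fun_of = (\<lambda>F xs. if F \<in> fun_syms L \<and> xs \<in> tuples (fun_arity L F) S
                        then fun_of M F xs else undefined) \<rparr>"

definition iso_struct ::
    "('r, 'f) language \<Rightarrow> ('a, 'r, 'f) fo_struct \<Rightarrow> ('a, 'r, 'f) fo_struct \<Rightarrow> ('a \<Rightarrow> 'a) \<Rightarrow> bool" where
  "iso_struct L A B f \<longleftrightarrow> bij_betw f (car A) (car B) \<and>
     (\<forall>R\<in>rel_syms L. \<forall>xs\<in>tuples (rel_arity L R) (car A).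
        xs \<in> rel_of A R \<longleftrightarrow> map f xs \<in> rel_of B R) \<and>
     (\<forall>F\<in>fun_syms L. \<forall>xs\<in>tuples (fun_arity L F) (car A).
        f (fun_of A F xs) = fun_of B F (map f xs))"

definition union_struct ::
    "('r, 'f) language \<Rightarrow> ('a, 'r, 'f) fo_struct set \<Rightarrow> ('a, 'r, 'f) fo_struct" where
  "union_struct L \<C> =
     \<lparr> car = (\<Union>A\<in>\<C>. car A),
       rel_of = (\<lambda>R. \<Union>A\<in>\<C>. rel_of A R),
       fun_of = (\<lambda>F xs. if F \<in> fun_syms L \<and> xs \<in> tuples (fun_arity L F) (\<Union>A\<in>\<C>. car A)
                        then THE y. \<exists>A\<in>\<C>. xs \<in> lists (car A) \<and> y = fun_of A F xs
                        else undefined) \<rparr>"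


section \<open>Abstract elementary classes\<close>

record ('a, 'r, 'f) aec_data =
  lang :: "('r, 'f) language"
  members :: "('a, 'r, 'f) fo_struct set"
  strong :: "('a, 'r, 'f) fo_struct \<Rightarrow> ('a, 'r, 'f) fo_struct \<Rightarrow> bool"

text \<open>
  In the chain axioms an ordinal-indexed increasing chain is given by the set of its members, on
  which \<^term>\<open>strong K\<close> is a well-order.
\<close>

definition aec_axioms :: "('a, 'r, 'f) aec_data \<Rightarrow> bool" where
  "aec_axioms K \<longleftrightarrow>
     (\<forall>A\<in>members K. is_struct (lang K) A) \<and>
     (\<forall>A B. strong K A B \<longrightarrow> A \<in> members K \<and> B \<in> members K \<and> substruct (lang K) A B) \<and>
     \<comment> \<open>closure under isomorphism\<close>
     (\<forall>A B f. A \<in> members K \<and> is_struct (lang K) B \<and> iso_struct (lang K) A B f \<longrightarrow> B \<in> members K) \<and>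
     (\<forall>A B A' B' f. strong K A B \<and> is_struct (lang K) A' \<and> is_struct (lang K) B' \<and>
        iso_struct (lang K) A A' f \<and> iso_struct (lang K) B B' f \<longrightarrow> strong K A' B') \<and>
     \<comment> \<open>partial order (antisymmetry follows from \<^const>\<open>substruct\<close>)\<close>
     (\<forall>A\<in>members K. strong K A A) \<and>
     (\<forall>A B C. strong K A B \<and> strong K B C \<longrightarrow> strong K A C) \<and>
     \<comment> \<open>unions of chains\<close>
     (\<forall>\<C>. \<C> \<noteq> {} \<and> \<C> \<subseteq> members K \<and>
        (\<forall>S\<subseteq>\<C>. S \<noteq> {} \<longrightarrow> (\<exists>A\<in>S. \<forall>B\<in>S. strong K A B)) \<longrightarrow>
        union_struct (lang K) \<C> \<in> members K \<and>
        (\<forall>A\<in>\<C>. strong K A (union_struct (lang K) \<C>)) \<and>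
        (\<forall>B\<in>members K. (\<forall>A\<in>\<C>. strong K A B) \<longrightarrow> strong K (union_struct (lang K) \<C>) B)) \<and>
     \<comment> \<open>coherence\<close>
     (\<forall>A B C. strong K A C \<and> strong K B C \<and> car A \<subseteq> car B \<longrightarrow> strong K A B)"

text \<open>
  The Loewenheim-Skolem number is by convention at least \<open>|L| + \<omega>\<close>.  As \<open>\<omega>\<close> is the least infinite
  cardinal, \<open>LS(K) = \<omega>\<close> says exactly that \<open>\<omega>\<close> has the Loewenheim-Skolem property.
\<close>

definition LS_property :: "('a, 'r, 'f) aec_data \<Rightarrow> 'k rel \<Rightarrow> bool" where
  "LS_property K \<kappa> \<longleftrightarrow> |rel_syms (lang K) <+> fun_syms (lang K)| \<le>o \<kappa> \<and>
     (\<forall>A\<in>members K. \<forall>X\<subseteq>car A. \<exists>B. strong K B A \<and> X \<subseteq> car B \<and> |car B| \<le>o |X| +c \<kappa>)"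

definition elem_embedding ::
    "('a, 'r, 'f) aec_data \<Rightarrow> ('a, 'r, 'f) fo_struct \<Rightarrow> ('a, 'r, 'f) fo_struct \<Rightarrow> ('a \<Rightarrow> 'a) \<Rightarrow> bool" where
  "elem_embedding K A B g \<longleftrightarrow> (\<exists>C. iso_struct (lang K) A C g \<and> strong K C B)"

definition AP :: "('a, 'r, 'f) aec_data \<Rightarrow> bool" where
  "AP K \<longleftrightarrow> (\<forall>A\<in>members K. \<forall>B\<in>members K. \<forall>C\<in>members K. \<forall>f g.
     elem_embedding K A B f \<and> elem_embedding K A C g \<longrightarrow>
     (\<exists>D\<in>members K. \<exists>f' g'. elem_embedding K B D f' \<and> elem_embedding K C D g' \<and>
        (\<forall>x\<in>car A. f' (f x) = g' (g x))))"

definition JEP :: "('a, 'r, 'f) aec_data \<Rightarrow> bool" where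
  "JEP K \<longleftrightarrow> (\<forall>A\<in>members K. \<forall>B\<in>members K. \<exists>D\<in>members K. \<exists>f g.
     elem_embedding K A D f \<and> elem_embedding K B D g)"

definition arbitrarily_large :: "('a, 'r, 'f) aec_data \<Rightarrow> bool" where
  "arbitrarily_large K \<longleftrightarrow> (\<forall>X :: 'a set. \<exists>A\<in>members K. |X| \<le>o |car A| )"

text \<open>Models are identified with their carriers, as subsets of the monster model.\<close>

definition model ::
    "('a, 'r, 'f) aec_data \<Rightarrow> ('a, 'r, 'f) fo_struct \<Rightarrow> 'd rel \<Rightarrow> 'a set \<Rightarrow> bool" where
  "model K M \<delta> S \<longleftrightarrow> S \<subseteq> car M \<and> strong K (induced (lang K) M S) M \<and> |S| <o \<delta>"

definition universal :: "('a, 'r, 'f) aec_data \<Rightarrow> ('a, 'r, 'f) fo_struct \<Rightarrow> 'd rel \<Rightarrow> bool" where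
  "universal K M \<delta> \<longleftrightarrow> (\<forall>A\<in>members K. |car A| <o \<delta> \<longrightarrow> (\<exists>g. elem_embedding K A M g))"

definition model_homogeneous :: "('a, 'r, 'f) aec_data \<Rightarrow> ('a, 'r, 'f) fo_struct \<Rightarrow> 'd rel \<Rightarrow> bool" where
  "model_homogeneous K M \<delta> \<longleftrightarrow> (\<forall>S T f. model K M \<delta> S \<and> model K M \<delta> T \<and>
     iso_struct (lang K) (induced (lang K) M S) (induced (lang K) M T) f \<longrightarrow>
     (\<exists>g. iso_struct (lang K) M M g \<and> (\<forall>x\<in>S. g x = f x)))"

definition inaccessible :: "'a rel \<Rightarrow> bool" where
  "inaccessible \<delta> \<longleftrightarrow> Card_order \<delta> \<and> natLeq <o \<delta> \<and> regularCard \<delta> \<and>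
     (\<forall>X :: 'a set. |X| <o \<delta> \<longrightarrow> |Pow X| <o \<delta>)"

definition monster :: "('a, 'r, 'f) aec_data \<Rightarrow> ('a, 'r, 'f) fo_struct \<Rightarrow> 'a rel \<Rightarrow> bool" where
  "monster K M \<delta> \<longleftrightarrow> M \<in> members K \<and> inaccessible \<delta> \<and> universal K M \<delta> \<and> model_homogeneous K M \<delta>"

definition supermonster ::
    "('a, 'r, 'f) aec_data \<Rightarrow> ('a, 'r, 'f) fo_struct \<Rightarrow> ('a, 'r, 'f) fo_struct \<Rightarrow> bool" where
  "supermonster K M M' \<longleftrightarrow> M' \<in> members K \<and> strong K M M' \<and> |car M| <o |car M'| \<and>
     universal K M' |car M'| \<and> model_homogeneous K M' |car M'|"


section \<open>Types and independence\<close>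

text \<open>
  Types, splitting, Lascar types and independence depend only on a set of points, a group of
  automorphisms acting on it (maps that may be arbitrary off the points) and the cardinal below
  which sets are called bounded.  They are needed in three instances: for \<open>M\<close>, for the supermonster
  and for \<open>M\<close> with imaginaries.  Finite tuples are lists.
\<close>

record ('u, 'd) ambient =
  pts :: "'u set"
  auts :: "('u \<Rightarrow> 'u) set"
  bd :: "'d rel"

definition aut_over :: "('u, 'd) ambient \<Rightarrow> 'u set \<Rightarrow> ('u \<Rightarrow> 'u) set" where
  "aut_over U A = {f \<in> auts U. \<forall>x\<in>A. f x = x}"

definition gtp_eq :: "('u, 'd) ambient \<Rightarrow> 'u set \<Rightarrow> 'u list \<Rightarrow> 'u list \<Rightarrow> bool" where
  "gtp_eq U A a b \<longleftrightarrow> (\<exists>f\<in>aut_over U A. map f a = b)"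

text \<open>A Galois type over \<open>A\<close> as the set of its realizations.\<close>

definition gtp :: "('u, 'd) ambient \<Rightarrow> 'u set \<Rightarrow> 'u list \<Rightarrow> 'u list set" where
  "gtp U A a = {b \<in> lists (pts U). gtp_eq U A a b}"

definition wtp_eq :: "('u, 'd) ambient \<Rightarrow> 'u set \<Rightarrow> 'u list \<Rightarrow> 'u list \<Rightarrow> bool" where
  "wtp_eq U A a b \<longleftrightarrow> (\<forall>B. finite B \<and> B \<subseteq> A \<longrightarrow> gtp_eq U B a b)"

text \<open>
  The weak type of the enumeration of \<open>X\<close> by itself equals the one of the enumeration
  \<open>(g x)\<^sub>x\<close> of \<open>g ` X\<close>.
\<close>

definition wtp_eq_enum :: "('u, 'd) ambient \<Rightarrow> 'u set \<Rightarrow> 'u set \<Rightarrow> ('u \<Rightarrow> 'u) \<Rightarrow> bool" where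
  "wtp_eq_enum U A X g \<longleftrightarrow>
     (\<forall>B. finite B \<and> B \<subseteq> A \<longrightarrow> (\<exists>f\<in>aut_over U B. \<forall>x\<in>X. f x = g x))"

definition splits :: "('u, 'd) ambient \<Rightarrow> 'u list \<Rightarrow> 'u set \<Rightarrow> 'u set \<Rightarrow> bool" where
  "splits U a B A \<longleftrightarrow> (\<exists>b\<in>lists B. \<exists>c\<in>lists B. wtp_eq U A b c \<and> \<not> wtp_eq U A (a @ b) (a @ c))"

definition ns_indep :: "('u, 'd) ambient \<Rightarrow> 'u list \<Rightarrow> 'u set \<Rightarrow> 'u set \<Rightarrow> bool" where
  "ns_indep U a B C \<longleftrightarrow> (\<exists>A. finite A \<and> A \<subseteq> B \<and> \<not> splits U a (B \<union> C) A)"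

definition ns_indep_set :: "('u, 'd) ambient \<Rightarrow> 'u set \<Rightarrow> 'u set \<Rightarrow> 'u set \<Rightarrow> bool" where
  "ns_indep_set U X B C \<longleftrightarrow> (\<forall>a\<in>lists X. ns_indep U a B C)"

definition bounded_equivs :: "('u, 'd) ambient \<Rightarrow> 'u set \<Rightarrow> nat \<Rightarrow> 'u list rel set" where
  "bounded_equivs U A n = {E. equiv (tuples n (pts U)) E \<and>
     (\<forall>f\<in>aut_over U A. \<forall>x\<in>tuples n (pts U). \<forall>y\<in>tuples n (pts U).
        (x, y) \<in> E \<longleftrightarrow> (map f x, map f y) \<in> E) \<and>
     |tuples n (pts U) // E| <o bd U}"

definition Lt_eq :: "('u, 'd) ambient \<Rightarrow> 'u set \<Rightarrow> 'u list \<Rightarrow> 'u list \<Rightarrow> bool" where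
  "Lt_eq U B a b \<longleftrightarrow> length a = length b \<and>
     (\<forall>A E. finite A \<and> A \<subseteq> B \<and> E \<in> bounded_equivs U A (length a) \<longrightarrow> (a, b) \<in> E)"

definition Lascar_splits :: "('u, 'd) ambient \<Rightarrow> 'u list \<Rightarrow> 'u set \<Rightarrow> 'u set \<Rightarrow> bool" where
  "Lascar_splits U a B A \<longleftrightarrow>
     (\<exists>b\<in>lists B. \<exists>c\<in>lists B. Lt_eq U A b c \<and> \<not> wtp_eq U A (a @ b) (a @ c))"

definition indep :: "('u, 'd) ambient \<Rightarrow> 'u list \<Rightarrow> 'u set \<Rightarrow> 'u set \<Rightarrow> bool" where
  "indep U a B C \<longleftrightarrow> (\<exists>A. finite A \<and> A \<subseteq> B \<and>
     (\<forall>D. B \<union> C \<subseteq> D \<and> D \<subseteq> pts U \<and> |D| <o bd U \<longrightarrow>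
        (\<exists>b\<in>lists (pts U). wtp_eq U (B \<union> C) b a \<and> \<not> Lascar_splits U b D A)))"

text \<open>\<open>t(d'/C)\<close> is a free extension of \<open>t(d/B)\<close>.\<close>

definition free_extension ::
    "('u, 'd) ambient \<Rightarrow> 'u list \<Rightarrow> 'u set \<Rightarrow> 'u list \<Rightarrow> 'u set \<Rightarrow> bool" where
  "free_extension U d B d' C \<longleftrightarrow> d' \<in> lists (pts U) \<and> wtp_eq U B d d' \<and> indep U d' B C"

definition stationary :: "('u, 'd) ambient \<Rightarrow> 'u list \<Rightarrow> 'u set \<Rightarrow> bool" where
  "stationary U d B \<longleftrightarrow> (\<forall>C. B \<subseteq> C \<and> C \<subseteq> pts U \<and> |C| <o bd U \<longrightarrow>
     (\<exists>d'. free_extension U d B d' C) \<and>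
     (\<forall>d' d''. free_extension U d B d' C \<and> free_extension U d B d'' C \<longrightarrow> wtp_eq U C d' d''))"

definition ambient_of ::
    "('a, 'r, 'f) aec_data \<Rightarrow> ('a, 'r, 'f) fo_struct \<Rightarrow> 'd rel \<Rightarrow> ('a, 'd) ambient" where
  "ambient_of K M \<delta> = \<lparr> pts = car M, auts = {f. iso_struct (lang K) M M f}, bd = \<delta> \<rparr>"


section \<open>FUR-classes\<close>

definition weakly_elementary ::
    "('a, 'r, 'f) aec_data \<Rightarrow> ('a, 'r, 'f) fo_struct \<Rightarrow> 'd rel \<Rightarrow> 'a set set \<Rightarrow> ('a \<Rightarrow> 'a) \<Rightarrow> bool" where
  "weakly_elementary K M \<delta> \<A> f \<longleftrightarrow>
     (\<forall>a\<in>lists (\<Union>\<A>). wtp_eq (ambient_of K M \<delta>) {} a (map f a)) \<and>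
     (\<forall>S\<in>\<A>. f ` S \<subseteq> car M \<and> strong K (induced (lang K) M (f ` S)) M)"

definition s_prime ::
    "('a, 'r, 'f) aec_data \<Rightarrow> ('a, 'r, 'f) fo_struct \<Rightarrow> 'd rel \<Rightarrow> 'a set set \<Rightarrow> 'a set \<Rightarrow> bool" where
  "s_prime K M \<delta> \<A> D \<longleftrightarrow> model K M \<delta> D \<and> \<Union>\<A> \<subseteq> D \<and>
     (\<forall>B f. model K M \<delta> B \<and> f ` \<Union>\<A> \<subseteq> B \<and> weakly_elementary K M \<delta> \<A> f \<longrightarrow>
        (\<exists>g. elem_embedding K (induced (lang K) M D) (induced (lang K) M B) g \<and>
             (\<forall>x\<in>\<Union>\<A>. g x = f x)))"

definition s_saturated :: "('a, 'd) ambient \<Rightarrow> 'a set \<Rightarrow> bool" where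
  "s_saturated U \<A> \<longleftrightarrow> (\<forall>b\<in>lists (pts U). \<forall>A. finite A \<and> A \<subseteq> \<A> \<longrightarrow> (\<exists>a\<in>lists \<A>. wtp_eq U A a b))"

text \<open>
  \<open>\<B>\<close> is s-primary over \<open>\<A>a\<close>; the list \<open>e\<close> below is the tuple \<open>(a\<^sub>0', \<dots>, a\<^sub>n')\<close>, its length being
  forced by the equality of types.
\<close>

definition s_primary ::
    "('a, 'r, 'f) aec_data \<Rightarrow> ('a, 'r, 'f) fo_struct \<Rightarrow> 'd rel \<Rightarrow> 'a set \<Rightarrow> 'a list \<Rightarrow> 'a set \<Rightarrow> bool" where
  "s_primary K M \<delta> \<A> a \<B> \<longleftrightarrow> model K M \<delta> \<B> \<and>
     (\<exists>as :: nat \<Rightarrow> 'a. \<B> = \<A> \<union> set a \<union> range as \<and>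
        (\<forall>n. \<exists>An. finite An \<and> An \<subseteq> \<A> \<and>
          (\<forall>a'\<in>lists (car M). \<forall>e\<in>lists (car M).
             wtp_eq (ambient_of K M \<delta>) \<A> a' a \<and>
             wtp_eq (ambient_of K M \<delta>) An (a' @ e) (a @ map as [0..<Suc n]) \<longrightarrow>
             wtp_eq (ambient_of K M \<delta>) \<A> (a' @ e) (a @ map as [0..<Suc n]))))"

text \<open>
  The game \<open>GI\<close>.  A position is a pair \<open>(x, X)\<close>; a strategy of player II maps the nonempty list of the
  moves made so far by player I to a finite set.
\<close>

definition GI_move :: "('u, 'd) ambient \<Rightarrow> 'u set \<Rightarrow> 'u list \<times> 'u set \<Rightarrow> 'u list \<times> 'u set \<Rightarrow> bool" where
  "GI_move U \<A> pos mv \<longleftrightarrow> (case pos of (x, X) \<Rightarrow> case mv of (y, Y) \<Rightarrow>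
     y \<in> lists (pts U) \<and> finite Y \<and> Y \<subseteq> \<A> \<and> X \<subseteq> Y \<and> wtp_eq U X y x \<and> \<not> wtp_eq U Y y x)"

definition GI_pos :: "'u list \<Rightarrow> 'u set \<Rightarrow> (('u list \<times> 'u set) list \<Rightarrow> 'u set) \<Rightarrow>
    ('u list \<times> 'u set) list \<Rightarrow> 'u list \<times> 'u set" where
  "GI_pos a A \<sigma> ms = (if ms = [] then (a, A) else (fst (last ms), \<sigma> ms))"

definition GI_play :: "('u, 'd) ambient \<Rightarrow> 'u list \<Rightarrow> 'u set \<Rightarrow> 'u set \<Rightarrow>
    (('u list \<times> 'u set) list \<Rightarrow> 'u set) \<Rightarrow> ('u list \<times> 'u set) list \<Rightarrow> bool" where
  "GI_play U a A \<A> \<sigma> ms \<longleftrightarrow>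
     (\<forall>i<length ms. GI_move U \<A> (GI_pos a A \<sigma> (take i ms)) (ms ! i))"

definition GI_win :: "('u, 'd) ambient \<Rightarrow> nat \<Rightarrow> 'u list \<Rightarrow> 'u set \<Rightarrow> 'u set \<Rightarrow> bool" where
  "GI_win U n a A \<A> \<longleftrightarrow> (\<exists>\<sigma>. \<forall>ms. GI_play U a A \<A> \<sigma> ms \<longrightarrow>
     length ms \<le> n \<and>
     (ms \<noteq> [] \<longrightarrow> finite (\<sigma> ms) \<and> \<sigma> ms \<subseteq> \<A> \<and> snd (last ms) \<subseteq> \<sigma> ms))"

definition AI :: "('a, 'r, 'f) aec_data \<Rightarrow> ('a, 'r, 'f) fo_struct \<Rightarrow> 'd rel \<Rightarrow> bool" where
  "AI K M \<delta> \<longleftrightarrow> (\<forall>\<A>. model K M \<delta> \<A> \<and> countable \<A> \<longrightarrow> s_saturated (ambient_of K M \<delta>) \<A>)"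

definition AII :: "('a, 'r, 'f) aec_data \<Rightarrow> ('a, 'r, 'f) fo_struct \<Rightarrow> 'd rel \<Rightarrow> bool" where
  "AII K M \<delta> \<longleftrightarrow> (\<forall>a\<in>lists (car M). \<forall>\<A>. model K M \<delta> \<A> \<and> countable \<A> \<longrightarrow> (\<exists>\<B>. s_primary K M \<delta> \<A> a \<B>))"

definition AIII :: "('a, 'r, 'f) aec_data \<Rightarrow> ('a, 'r, 'f) fo_struct \<Rightarrow> 'd rel \<Rightarrow> bool" where
  "AIII K M \<delta> \<longleftrightarrow> (\<forall>\<A> \<B> \<C>. model K M \<delta> \<A> \<and> model K M \<delta> \<B> \<and> model K M \<delta> \<C> \<and>
     ns_indep_set (ambient_of K M \<delta>) \<A> \<B> \<C> \<and> \<B> = \<A> \<inter> \<C> \<longrightarrow>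
     (\<exists>!\<D>. s_prime K M \<delta> {\<A>, \<C>} \<D>) \<and>
     (\<forall>\<D> \<C>'. s_prime K M \<delta> {\<A>, \<C>} \<D> \<and> model K M \<delta> \<C>' \<and> \<C> \<subseteq> \<C>' \<and>
        ns_indep_set (ambient_of K M \<delta>) \<A> \<B> \<C>' \<longrightarrow>
        ns_indep_set (ambient_of K M \<delta>) \<D> \<C> \<C>'))"

definition AIV :: "('a, 'r, 'f) aec_data \<Rightarrow> ('a, 'r, 'f) fo_struct \<Rightarrow> 'd rel \<Rightarrow> bool" where
  "AIV K M \<delta> \<longleftrightarrow> (\<forall>a\<in>lists (car M). \<exists>n. \<forall>\<A> A.
     model K M \<delta> \<A> \<and> countable \<A> \<and> finite A \<and> A \<subseteq> \<A> \<longrightarrow> GI_win (ambient_of K M \<delta>) n a A \<A>)"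

definition AV :: "('a, 'r, 'f) aec_data \<Rightarrow> ('a, 'r, 'f) fo_struct \<Rightarrow> 'd rel \<Rightarrow> bool" where
  "AV K M \<delta> \<longleftrightarrow> (\<forall>\<A> \<B>. \<forall>a\<in>lists (car M).
     model K M \<delta> \<A> \<and> model K M \<delta> \<B> \<and> countable \<A> \<and> countable \<B> \<and> \<A> \<subseteq> \<B> \<and>
     ns_indep_set (ambient_of K M \<delta>) \<B> \<A> (set a) \<longrightarrow> ns_indep (ambient_of K M \<delta>) a \<A> \<B>)"

definition AVI :: "('a, 'r, 'f) aec_data \<Rightarrow> ('a, 'r, 'f) fo_struct \<Rightarrow> 'd rel \<Rightarrow> bool" where
  "AVI K M \<delta> \<longleftrightarrow> (\<forall>\<A> \<B> \<D>.
     model K M \<delta> \<A> \<and> model K M \<delta> \<B> \<and> model K M \<delta> \<D> \<and> \<A> \<subseteq> \<B> \<inter> \<D> \<longrightarrow>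
     (\<exists>\<C> g. model K M \<delta> \<C> \<and> \<C> = g ` \<B> \<and> wtp_eq_enum (ambient_of K M \<delta>) \<A> \<B> g \<and>
        ns_indep_set (ambient_of K M \<delta>) \<C> \<A> \<D>))"

definition FUR_class :: "('a, 'r, 'f) aec_data \<Rightarrow> ('a, 'r, 'f) fo_struct \<Rightarrow> 'a rel \<Rightarrow> bool" where
  "FUR_class K M \<delta> \<longleftrightarrow> aec_axioms K \<and> monster K M \<delta> \<and> AP K \<and> JEP K \<and> LS_property K natLeq \<and>
     arbitrarily_large K \<and> (\<forall>A\<in>members K. infinite (car A)) \<and>
     AI K M \<delta> \<and> AII K M \<delta> \<and> AIII K M \<delta> \<and> AIV K M \<delta> \<and> AV K M \<delta> \<and> AVI K M \<delta>"


section \<open>Imaginaries\<close>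

text \<open>
  An element \<open>a/E\<close> is the pair of \<open>E\<close> and the class of \<open>a\<close>, so that the sorts \<open>P\<^sub>E\<close> are disjoint.
\<close>

type_synonym 'a imag = "'a list rel \<times> 'a list set"

definition eq_rel :: "('a, 'r, 'f) fo_struct \<Rightarrow> 'a list rel" where
  "eq_rel M = Id_on (tuples 1 (car M))"

definition quot :: "'a list rel \<Rightarrow> 'a list \<Rightarrow> 'a imag" where
  "quot E a = (E, E `` {a})"

definition real_elt :: "('a, 'r, 'f) fo_struct \<Rightarrow> 'a \<Rightarrow> 'a imag" where
  "real_elt M x = quot (eq_rel M) [x]"

definition imaginary_family ::
    "('a, 'r, 'f) aec_data \<Rightarrow> ('a, 'r, 'f) fo_struct \<Rightarrow> 'd rel \<Rightarrow> 'a list rel set \<Rightarrow> bool" where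
  "imaginary_family K M \<delta> \<E> \<longleftrightarrow> countable \<E> \<and> eq_rel M \<in> \<E> \<and>
     (\<forall>E\<in>\<E>. \<exists>n. equiv (tuples n (car M)) E \<and>
        (\<forall>f\<in>auts (ambient_of K M \<delta>). \<forall>a\<in>tuples n (car M). \<forall>b\<in>tuples n (car M).
           (a, b) \<in> E \<longleftrightarrow> (map f a, map f b) \<in> E) \<and>
        (\<exists>G. countable G \<and> G \<subseteq> gtp (ambient_of K M \<delta>) {} ` lists (car M) \<and>
           (\<forall>a\<in>tuples n (car M). \<forall>b\<in>tuples n (car M).
              (a, b) \<in> E \<longleftrightarrow> gtp (ambient_of K M \<delta>) {} (a @ b) \<in> G)))"

definition sort_of :: "'a list rel \<Rightarrow> 'a imag set" where
  "sort_of E = quot E ` Field E"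

definition Meq :: "'a list rel set \<Rightarrow> 'a imag set" where
  "Meq \<E> = (\<Union>E\<in>\<E>. sort_of E)"

text \<open>The action of a sort-preserving map on the home sort, read as a map of \<open>M\<close>.\<close>

definition on_reals :: "('a, 'r, 'f) fo_struct \<Rightarrow> ('a imag \<Rightarrow> 'a imag) \<Rightarrow> 'a \<Rightarrow> 'a" where
  "on_reals M f x = (THE y. y \<in> car M \<and> f (real_elt M x) = real_elt M y)"

text \<open>
  Automorphisms of \<open>M\<close> with imaginaries: they preserve the predicates \<open>P\<^sub>E\<close>, the structure of \<open>M\<close> on
  the home sort and the functions \<open>F\<^sub>E\<close>.
\<close>

definition aut_eq ::
    "('a, 'r, 'f) aec_data \<Rightarrow> ('a, 'r, 'f) fo_struct \<Rightarrow> 'a list rel set \<Rightarrow> ('a imag \<Rightarrow> 'a imag) set" where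
  "aut_eq K M \<E> = {f. bij_betw f (Meq \<E>) (Meq \<E>) \<and>
     (\<forall>E\<in>\<E>. \<forall>x\<in>Meq \<E>. x \<in> sort_of E \<longleftrightarrow> f x \<in> sort_of E) \<and>
     iso_struct (lang K) M M (on_reals M f) \<and>
     (\<forall>E\<in>\<E>. \<forall>a\<in>Field E. f (quot E a) = quot E (map (on_reals M f) a))}"

definition ambient_eq ::
    "('a, 'r, 'f) aec_data \<Rightarrow> ('a, 'r, 'f) fo_struct \<Rightarrow> 'd rel \<Rightarrow> 'a list rel set \<Rightarrow> ('a imag, 'd) ambient" where
  "ambient_eq K M \<delta> \<E> = \<lparr> pts = Meq \<E>, auts = aut_eq K M \<E>, bd = \<delta> \<rparr>"


section \<open>Global types and canonical bases\<close>

abbreviation super :: "('a, 'r, 'f) aec_data \<Rightarrow> ('a, 'r, 'f) fo_struct \<Rightarrow> ('a, 'a) ambient" where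
  "super K M' \<equiv> ambient_of K M' |car M'|"

text \<open>
  A global type is a family indexed by all finite subsets of \<open>M\<close> (this is maximality), padded with the
  empty set at the other arguments.
\<close>

definition global_type :: "('a, 'r, 'f) aec_data \<Rightarrow> ('a, 'r, 'f) fo_struct \<Rightarrow>
    ('a, 'r, 'f) fo_struct \<Rightarrow> ('a set \<Rightarrow> 'a list set) \<Rightarrow> bool" where
  "global_type K M M' p \<longleftrightarrow>
     (\<forall>A. finite A \<and> A \<subseteq> car M \<longrightarrow> p A \<in> gtp (super K M') A ` lists (car M')) \<and>
     (\<forall>A. \<not> (finite A \<and> A \<subseteq> car M) \<longrightarrow> p A = {}) \<and>
     (\<forall>A B. finite B \<and> B \<subseteq> car M \<and> A \<subseteq> B \<longrightarrow> p B \<inter> lists (car M) \<subseteq> p A) \<and>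
     (\<exists>b\<in>lists (car M'). \<forall>A. finite A \<and> A \<subseteq> car M \<longrightarrow> b \<in> p A)"

definition global_type_of :: "('a, 'r, 'f) aec_data \<Rightarrow> ('a, 'r, 'f) fo_struct \<Rightarrow>
    ('a, 'r, 'f) fo_struct \<Rightarrow> 'a list \<Rightarrow> 'a set \<Rightarrow> 'a list set" where
  "global_type_of K M M' b = (\<lambda>A. if finite A \<and> A \<subseteq> car M then gtp (super K M') A b else {})"

definition fixes_global_type :: "('a, 'r, 'f) fo_struct \<Rightarrow> ('a imag \<Rightarrow> 'a imag) \<Rightarrow>
    ('a set \<Rightarrow> 'a list set) \<Rightarrow> bool" where
  "fixes_global_type M f p \<longleftrightarrow>
     (\<forall>A B. finite A \<and> A \<subseteq> car M \<and> finite B \<and> B \<subseteq> car M \<and> on_reals M f ` B = A \<longrightarrow>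
        (\<forall>b\<in>lists (car M). b \<in> p B \<longrightarrow> map (on_reals M f) b \<in> p A))"

definition canonical_base_of_type :: "('a, 'r, 'f) aec_data \<Rightarrow> ('a, 'r, 'f) fo_struct \<Rightarrow>
    ('a, 'r, 'f) fo_struct \<Rightarrow> 'a list rel set \<Rightarrow> 'a imag list \<Rightarrow> ('a set \<Rightarrow> 'a list set) \<Rightarrow> bool" where
  "canonical_base_of_type K M M' \<E> \<alpha> p \<longleftrightarrow> global_type K M M' p \<and> \<alpha> \<in> lists (Meq \<E>) \<and>
     (\<forall>f\<in>aut_eq K M \<E>. fixes_global_type M f p \<longleftrightarrow> map f \<alpha> = \<alpha>)"

text \<open>\<open>\<alpha> = Cb(a/A)\<close>.\<close>

definition canonical_base :: "('a, 'r, 'f) aec_data \<Rightarrow> ('a, 'r, 'f) fo_struct \<Rightarrow>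
    ('a, 'r, 'f) fo_struct \<Rightarrow> 'a list rel set \<Rightarrow> 'a imag list \<Rightarrow> 'a list \<Rightarrow> 'a set \<Rightarrow> bool" where
  "canonical_base K M M' \<E> \<alpha> a A \<longleftrightarrow> (\<exists>b\<in>lists (car M').
     Lt_eq (super K M') A b a \<and> indep (super K M') b A (car M) \<and>
     canonical_base_of_type K M M' \<E> \<alpha> (global_type_of K M M' b))"

text \<open>
  \<open>E\<close> is the relation attached to \<open>b\<close> and \<open>a\<close>, where \<open>t(b/M)\<close> does not split over \<open>a\<close>, by way of some
  choice of types \<open>q c i\<close> with: \<open>bd\<close> realizes \<open>t(bc)\<close> iff \<open>ad\<close> realizes some \<open>q c i\<close>.  The condition
  leaves types not realized by any \<open>ad\<close> free, so \<open>E\<close> is only determined up to this choice; the family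
  of imaginary sorts is closed if it contains one such \<open>E\<close> for every \<open>b\<close> and \<open>a\<close> (all choices at once
  could be uncountably many).
\<close>

definition base_relation :: "('a, 'r, 'f) aec_data \<Rightarrow> ('a, 'r, 'f) fo_struct \<Rightarrow>
    ('a, 'r, 'f) fo_struct \<Rightarrow> 'a list \<Rightarrow> 'a list \<Rightarrow> 'a list rel \<Rightarrow> bool" where
  "base_relation K M M' b a E \<longleftrightarrow> (\<exists>q :: 'a list \<Rightarrow> nat \<Rightarrow> 'a list set.
     (\<forall>c\<in>lists (car M). (\<forall>i. q c i \<in> gtp (super K M') {} ` lists (car M')) \<and>
        (\<forall>d\<in>lists (car M). wtp_eq (super K M') {} (b @ c) (b @ d) \<longleftrightarrow> (\<exists>i. a @ d \<in> q c i))) \<and>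
     E = {(a0, a1). a0 \<in> tuples (length a) (car M) \<and> a1 \<in> tuples (length a) (car M) \<and>
            (\<forall>c\<in>lists (car M). \<forall>d\<in>lists (car M).
               (\<exists>i. a0 @ d \<in> q c i) \<longleftrightarrow> (\<exists>i. a1 @ d \<in> q c i))})"

definition closed_under_base_relations :: "('a, 'r, 'f) aec_data \<Rightarrow> ('a, 'r, 'f) fo_struct \<Rightarrow>
    ('a, 'r, 'f) fo_struct \<Rightarrow> 'a list rel set \<Rightarrow> bool" where
  "closed_under_base_relations K M M' \<E> \<longleftrightarrow>
     (\<forall>b\<in>lists (car M'). \<forall>a\<in>lists (car M).
        \<not> splits (super K M') b (car M) (set a) \<longrightarrow> (\<exists>E\<in>\<E>. base_relation K M M' b a E))"

end

theory Submission
  imports Defs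
begin

text \<open>
  Let \<open>p = t(b/M)\<close> be the global type with canonical base \<open>\<alpha>\<close>.  Since \<open>p\<close> is invariant under
  \<open>Aut(M/\<alpha>)\<close>, its realizations do not Lascar split over \<open>\<alpha>\<close>, which gives free extensions.  They are
  unique because a type \<open>t(e/N)\<close> that extends \<open>p\<close> restricted to \<open>\<alpha>\<close> and does not Lascar split over \<open>\<alpha>\<close>
  is a restriction of \<open>p\<close>: by symmetry of nonsplitting over countable models, \<open>N\<close> contains arbitrarily
  long \<open>Aut(M/\<alpha>)\<close>-conjugates of Morley sequences of \<open>p\<close> whose members have the type of \<open>e\<close> over a given
  tuple \<open>x\<close>, while by (AIV) a long enough Morley sequence has a member that realizes \<open>p\<close> over \<open>x\<close>.

  It remains to see that \<open>a\<close> is \<open>Aut(M/\<alpha>)\<close>-conjugate to realizations of \<open>p\<close>.  As \<open>a\<close> and \<open>b\<close> have the same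
  Lascar type over the finite set \<open>A0\<close> over which \<open>p\<close> does not Lascar split, it is enough that being
  conjugate over all the \<open>Aut(M/A0)\<close>-conjugates of \<open>\<alpha>\<close> is a bounded equivalence relation, hence that \<open>\<alpha>\<close>
  has fewer than \<open>\<delta>\<close> such conjugates.  A conjugate is determined by the types of \<open>b\<close> with the images of
  representatives of the Lascar types over \<open>A0\<close> in \<open>M'\<close>, and there are fewer than \<open>\<delta>\<close> Lascar types by a
  Hanf number argument: an invariant equivalence relation on \<open>M'\<close> with fewer than \<open>|M'|\<close> classes has
  fewer than \<open>\<delta>\<close> classes.
\<close>

section \<open>Cardinals below an inaccessible\<close>

text \<open>Two sizes of boundedness meet. Lascar types of \<open>b\<close> are computed in
  \<open>M'\<close>, where bounded means fewer than \<open>|M'|\<close> classes, and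
  \<open>|M'|\<close> is not assumed inaccessible; coding by power sets needs fewer than
  \<open>\<delta>\<close>. This gap forces the Hanf number argument. An AEC has no Skolem functions,
  so the indiscernibles used there are systems of countable strong substructures indexed by
  increasing lists and glued by model homogeneity. (AI), (AIV) and (AV) speak of countable models
  only. Hence a claim about a small set is checked on finite tuples, inside a countable model that
  contains the tuple and a finite set of reals determining \<open>\<alpha>\<close>; weak types are
  exactly what such finite checks control. The hypothesis on \<open>e\<close> moves a tuple
  \<open>u\<close> to \<open>v\<close> only if both have the same Lascar type over
  \<open>\<alpha>\<close>, which equality of types does not give in general. For Morley sequences of
  \<open>p\<close> it does, and this makes them usable against \<open>e\<close>.\<close>

lemma countable_ordLeq_natLeq: "countable X \<Longrightarrow> |X| \<le>o natLeq"
  by (meson card_of_nat card_of_ordLeqI countableE ordLeq_ordIso_trans UNIV_I)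

lemma card_of_lists_ordLess:
  fixes r :: "'c rel"
  assumes r: "Card_order r" and nat: "natLeq <o r" and X: "|X| <o r"
  shows "|lists X| <o r"
proof (cases "finite X")
  case True
  then have "countable (lists X)" by (simp add: countable_finite)
  then have "|lists X| \<le>o natLeq" by (rule countable_ordLeq_natLeq)
  then show ?thesis using nat by (rule ordLeq_ordLess_trans)
next
  case inf: False
  have *: "|{xs \<in> lists X. length xs = n}| \<le>o |X|" for n
  proof (induction n)
    case 0
    have "{xs \<in> lists X. length xs = 0} = {[]}" by auto
    then show ?case using inf by (metis card_of_singl_ordLeq finite.emptyI)
  next
    case (Suc n)
    have "{xs \<in> lists X. length xs = Suc n} = (\<lambda>(x, xs). x # xs) ` (X \<times> {xs \<in> lists X. length xs = n})"
      by (auto simp: length_Suc_conv image_iff)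
    then have "|{xs \<in> lists X. length xs = Suc n}| \<le>o |X \<times> {xs \<in> lists X. length xs = n}|"
      by (simp add: card_of_image)
    also have "|X \<times> {xs \<in> lists X. length xs = n}| \<le>o |X \<times> X|"
      by (rule card_of_Times_mono2[OF Suc])
    also have "|X \<times> X| =o |X|" using inf by (rule card_of_Times_same_infinite)
    finally show ?case .
  qed
  have "lists X = (\<Union>n. {xs \<in> lists X. length xs = n})" by auto
  moreover have "|\<Union>n. {xs \<in> lists X. length xs = n}| \<le>o |X|"
    by (rule card_of_UNION_ordLeq_infinite[OF inf]) (use inf infinite_iff_card_of_nat * in auto)
  ultimately show ?thesis using X by (metis ordLeq_ordLess_trans)
qed

lemma infinite_Field_of_natLeq_ordLess:
  assumes "Card_order r" and "natLeq <o r"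
  shows "Cinfinite r"
  using assms by (metis Field_natLeq Cinfinite_cong card_of_Field_ordIso cinfinite_def cinfinite_mono
      infinite_UNIV_nat ordLess_imp_ordLeq)

lemma ordLess_countable:
  assumes "natLeq <o r" and "countable X"
  shows "|X| <o r"
  using assms by (meson countable_ordLeq_natLeq ordLeq_ordLess_trans)

lemma ordLess_inj:
  assumes "|Y| <o r" and "inj_on f X" and "f ` X \<subseteq> Y"
  shows "|X| <o r"
  using assms by (meson card_of_ordLeqI image_subset_iff ordLeq_ordLess_trans)

lemma ordLess_image: "|X| <o r \<Longrightarrow> |f ` X| <o r"
  by (meson card_of_image ordLeq_ordLess_trans)

lemma ordLess_subset: "|Y| <o r \<Longrightarrow> X \<subseteq> Y \<Longrightarrow> |X| <o r"
  by (meson card_of_mono1 ordLeq_ordLess_trans)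

text \<open>Bounded relations are used through this: few values of \<open>f\<close> leave a small
  set of representatives, over which a realization of a type can then be chosen.\<close>

lemma card_reps:
  assumes "|f ` S| <o r"
  obtains R where "R \<subseteq> S" "|R| <o r" "\<And>x. x \<in> S \<Longrightarrow> \<exists>y\<in>R. f y = f x"
proof
  let ?R = "inv_into S f ` (f ` S)"
  show "?R \<subseteq> S" by (auto intro: inv_into_into)
  show "|?R| <o r" using assms by (rule ordLess_image)
  fix x assume "x \<in> S"
  then have "f (inv_into S f (f x)) = f x" by (simp add: f_inv_into_f)
  then show "\<exists>y\<in>?R. f y = f x" using \<open>x \<in> S\<close> by blast
qed

locale inaccessible_cardinal =
  fixes \<delta> :: "'a rel"
  assumes inacc: "inaccessible \<delta>"
begin

lemma card_order: "Card_order \<delta>" and nat_less: "natLeq <o \<delta>"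
  using inacc by (auto simp: inaccessible_def)

lemma Cinf: "Cinfinite \<delta>"
  using card_order nat_less by (rule infinite_Field_of_natLeq_ordLess)

lemma inf_Field: "infinite (Field \<delta>)"
  using Cinf by (simp add: cinfinite_def)

lemma small_countable: "countable X \<Longrightarrow> |X| <o \<delta>"
  using nat_less by (rule ordLess_countable)

lemma small_UN: "|I| <o \<delta> \<Longrightarrow> (\<And>i. i \<in> I \<Longrightarrow> |A i| <o \<delta>) \<Longrightarrow> |\<Union>i\<in>I. A i| <o \<delta>"
  using card_of_UNION_ordLess_infinite_Field_regularCard[of \<delta> I A] Cinf inacc
  by (auto simp: inaccessible_def)

lemma small_Sigma:
  assumes "|I| <o \<delta>" and "\<And>i. i \<in> I \<Longrightarrow> |A i| <o \<delta>"
  shows "|Sigma I A| <o \<delta>"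
proof -
  have "Sigma I A = (\<Union>i\<in>I. Pair i ` A i)" by auto
  then show ?thesis using assms by (auto intro!: small_UN ordLess_image)
qed

text \<open>\<open>inaccessible\<close> bounds power sets only for sets over the type of
  \<open>\<delta>\<close>, and a statement proved by induction can only quantify over sets of a
  fixed type; both need this copy.\<close>

lemma small_copy:
  assumes "|X| <o \<delta>"
  obtains X' :: "'a set" where "|X'| =o |X|"
  using internalize_card_of_ordLess[of X \<delta>] assms ordIso_symmetric by metis

lemma small_Pow:
  assumes "|X| <o \<delta>"
  shows "|Pow X| <o \<delta>"
proof -
  obtain X' :: "'a set" where X': "|X'| =o |X|" using small_copy[OF assms] .
  then obtain f where "bij_betw f X X'" using card_of_ordIso ordIso_symmetric by blast
  then have "bij_betw (image f) (Pow X) (Pow X')" by (rule bij_betw_Pow)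
  moreover have "|Pow X'| <o \<delta>"
    using inacc X' assms ordIso_ordLess_trans unfolding inaccessible_def by blast
  ultimately show ?thesis
    by (metis bij_betw_def ordLess_inj order_refl)
qed

end

section \<open>The Erdos-Rado theorem below an inaccessible\<close>

definition homog :: "'b set \<Rightarrow> nat \<Rightarrow> ('b set \<Rightarrow> 'c) \<Rightarrow> 'c \<Rightarrow> bool" where
  "homog H n f c \<longleftrightarrow> (\<forall>s\<subseteq>H. finite s \<and> card s = n \<longrightarrow> f s = c)"


lemma finite_has_top:
  assumes "finite T" and "T \<noteq> {}" and "T \<subseteq> Field r" and wo: "Well_order r"
  shows "\<exists>i\<in>T. \<forall>j\<in>T. j \<noteq> i \<longrightarrow> j \<in> underS r i"
  using assms(1-3)
proof (induction rule: finite_ne_induct)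
  case (singleton x)
  then show ?case by simp
next
  case (insert x F)
  then obtain i where i: "i \<in> F" "\<forall>j\<in>F. j \<noteq> i \<longrightarrow> j \<in> underS r i" by auto
  have tot: "(x, i) \<in> r \<or> (i, x) \<in> r"
    using wo insert.prems i(1) insert.hyps(3)
    by (metis insert_subset order_on_defs(1,2,3,4) subsetD total_on_def well_order_on_def linear_order_on_def)
  have tr: "trans r" using wo by (simp add: order_on_defs)
  show ?case
  proof (cases "(i, x) \<in> r")
    case True
    have "j \<in> underS r x" if "j \<in> insert x F" "j \<noteq> x" for j
    proof -
      have "(j, i) \<in> r \<or> j = i" using that i(2) by (auto simp: underS_def)
      then show ?thesis using True that tr by (auto simp: underS_def trans_def)
    qed
    then show ?thesis by blast
  next
    case False
    then show ?thesis using tot i insert.hyps(3) by (auto simp: underS_def)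
  qed
qed

context inaccessible_cardinal
begin

text \<open>
  The Erdos-Rado tree: \<^term>\<open>a y\<close> is the branch of \<^term>\<open>y\<close>, at each stage picking a point with the same colours
  over the earlier points as \<^term>\<open>y\<close>.  A long branch is end-homogeneous; if all branches are
  short, then \<^term>\<open>y\<close> is determined by the length and the colours of its branch.
\<close>

lemma erdos_rado:
  assumes C: "|C :: 'c set| <o \<delta>" and X: "|X :: 'a set| <o \<delta>"
  shows "\<exists>X' :: 'a set. |X'| <o \<delta> \<and> (\<forall>(Y :: 'b set) f. |X'| \<le>o |Y| \<and>
     (\<forall>s\<subseteq>Y. finite s \<and> card s = n \<longrightarrow> f s \<in> C) \<longrightarrow> (\<exists>H\<subseteq>Y. \<exists>c. |X| \<le>o |H| \<and> homog H n f c))"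
proof (induction n)
  case 0
  have "homog Y 0 f (f {})" for Y :: "'b set" and f :: "'b set \<Rightarrow> 'c" by (auto simp: homog_def)
  then show ?case using X by blast
next
  case (Suc n)
  then obtain X1 :: "'a set" where X1: "|X1| <o \<delta>" and IH: "\<And>(Y :: 'b set) f. |X1| \<le>o |Y| \<Longrightarrow>
      (\<And>s. s \<subseteq> Y \<Longrightarrow> finite s \<Longrightarrow> card s = n \<Longrightarrow> f s \<in> C) \<Longrightarrow> \<exists>H\<subseteq>Y. \<exists>c. |X| \<le>o |H| \<and> homog H n f c"
    by meson
  \<comment> \<open>Room for the codes of points with a short branch: the stage at which the branch
    stops, and the colour at each finite set of earlier stages. The bound for \<open>Suc n\<close>
    is a copy of \<open>Pow \<Theta>\<close>, which cannot be injected into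
    \<open>\<Theta>\<close>.\<close>
  define \<Theta> where "\<Theta> = X1 \<times> Pow (Pow X1 \<times> C)"
  have "|\<Theta>| <o \<delta>"
    unfolding \<Theta>_def using X1 C by (intro small_Sigma small_Pow)
  then obtain X2 :: "'a set" where X2: "|X2| =o |Pow \<Theta>|" using small_copy[OF small_Pow] by blast
  have "|X2| <o \<delta>" using X2 \<open>|\<Theta>| <o \<delta>\<close> small_Pow ordIso_ordLess_trans by blast
  moreover have "\<exists>H\<subseteq>Y. \<exists>c. |X| \<le>o |H| \<and> homog H (Suc n) f c"
    if Y: "|X2| \<le>o |Y|" and f: "\<forall>s\<subseteq>Y. finite s \<and> card s = Suc n \<longrightarrow> f s \<in> C" for Y :: "'b set" and f
  proof -
    define r where "r = |X1|"
    have wo: "Well_order r" and Fr: "Field r = X1" by (auto simp: r_def Field_card_of card_of_well_order_on)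
    define W where "W = r - Id"
    have wfW: "wf W" using wo unfolding W_def well_order_on_def by blast
    have W: "(j, i) \<in> W \<longleftrightarrow> j \<in> underS r i" for i j by (auto simp: W_def underS_def)
    \<comment> \<open>\<open>z\<close> may continue the branch at stage \<open>i\<close>: it is new,
      and no \<open>n\<close> earlier points distinguish it from \<open>y\<close>.\<close>
    define P where "P g i y z \<longleftrightarrow> z \<in> Y \<and> z \<notin> g ` underS r i \<and>
      (\<forall>s\<subseteq>g ` underS r i. finite s \<and> card s = n \<longrightarrow> f (insert z s) = f (insert y s))" for g :: "'a \<Rightarrow> 'b" and i y z
    \<comment> \<open>The choice depends on \<open>y\<close> only through the predicate
      \<open>P\<close>, so points with equal colours over the branch choose the same continuation;
      this is what makes \<open>code\<close> injective below.\<close>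
    define a where "a y = wfrec W (\<lambda>g i. SOME z. P g i y z)" for y
    have a: "a y i = (SOME z. P (a y) i y z)" for y i
    proof -
      have "cut (a y) W i ` underS r i = a y ` underS r i"
        by (rule image_cong) (auto simp: cut_apply W)
      then have "P (cut (a y) W i) i y = P (a y) i y" by (simp add: P_def fun_eq_iff)
      then show ?thesis unfolding a_def by (subst wfrec[OF wfW]) simp
    qed
    have Pa: "P (a y) i y (a y i)" if "y \<in> Y" "y \<notin> a y ` underS r i" for y i
    proof -
      have "P (a y) i y y" using that by (auto simp: P_def)
      then have "P (a y) i y (SOME z. P (a y) i y z)" by (rule someI)
      then show ?thesis by (simp only: a[symmetric])
    qed
    have under: "underS r i \<subseteq> X1" for i using Fr by (auto simp: underS_def Field_def)
    have under_sub: "underS r i \<subseteq> underS r j" if "i \<in> underS r j" for i j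
    proof -
      have "trans r" "antisym r" using wo by (auto simp: order_on_defs)
      then show ?thesis using that unfolding underS_def trans_def antisym_def by blast
    qed
    have tot: "i \<in> underS r j \<or> j \<in> underS r i" if "i \<in> X1" "j \<in> X1" "i \<noteq> j" for i j
      using wo that Fr by (auto simp: order_on_defs total_on_def underS_def)
    have ne: "a y i \<noteq> a y j" if "y \<in> Y" "y \<notin> a y ` underS r j" "i \<in> underS r j" for y i j
      using Pa[OF that(1,2)] imageI[OF that(3), of "a y"] unfolding P_def by metis
    show ?thesis
    proof (cases "\<exists>y\<in>Y. \<forall>i\<in>X1. a y i \<noteq> y")
      case True
      \<comment> \<open>A branch that never meets its own \<open>y\<close> runs injectively through
        all of \<open>X1\<close>. On it the colour of a set of size \<open>Suc n\<close> does not
        change when the latest point is replaced by \<open>y\<close>, so the induction hypothesis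
        applies to \<open>\<lambda>s. f (insert y s)\<close>.\<close>
      then obtain y where y: "y \<in> Y" "\<And>i. i \<in> X1 \<Longrightarrow> a y i \<noteq> y" by blast
      have yn: "y \<notin> a y ` underS r i" for i using y(2) under[of i] by (metis imageE subsetD)
      have inj: "inj_on (a y) X1"
        by (rule inj_onI) (metis ne[OF y(1) yn] tot)
      have "|X1| \<le>o |a y ` X1|" using inj card_of_ordLeq by blast
      moreover have "f (insert y s) \<in> C" if "s \<subseteq> a y ` X1" "finite s" "card s = n" for s
      proof -
        have "y \<notin> s" using that(1) y(2) by (metis imageE subsetD)
        moreover have "s \<subseteq> Y" using that Pa[OF y(1) yn] by (auto simp: P_def)
        ultimately show ?thesis using f y(1) that by auto
      qed
      ultimately obtain H c where H: "H \<subseteq> a y ` X1" "|X| \<le>o |H|" "homog H n (\<lambda>s. f (insert y s)) c"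
        using IH[of "a y ` X1" "\<lambda>s. f (insert y s)"] by blast
      have "f t = c" if t: "t \<subseteq> H" "finite t" "card t = Suc n" for t
      proof -
        define T where "T = {i \<in> X1. a y i \<in> t}"
        have T: "a y ` T = t" using t H by (auto simp: T_def)
        have TX: "T \<subseteq> X1" by (auto simp: T_def)
        then have finT: "finite T" using t(2) finite_imageD[of "a y" T] inj_on_subset[OF inj TX] T by simp
        have "T \<noteq> {}" using T t by auto
        then obtain i where i: "i \<in> T" "\<forall>j\<in>T. j \<noteq> i \<longrightarrow> j \<in> underS r i"
          using finite_has_top[OF finT _ _ wo] Fr TX by blast
        define s where "s = t - {a y i}"
        have ait: "a y i \<in> t" using i(1) by (simp add: T_def)
        then have ts: "t = insert (a y i) s" by (auto simp: s_def)
        have s: "s \<subseteq> a y ` underS r i"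
        proof
          fix u assume "u \<in> s"
          then have u: "u \<in> t" "u \<noteq> a y i" by (auto simp: s_def)
          then obtain j where "j \<in> T" "u = a y j" unfolding T[symmetric] by blast
          then have "j \<in> underS r i" using i(2) u(2) by metis
          then show "u \<in> a y ` underS r i" using \<open>u = a y j\<close> by (metis imageI)
        qed
        have cs: "finite s" "card s = n" using t ait by (simp_all add: s_def card_Diff_singleton)
        have "f t = f (insert y s)" using Pa[OF y(1) yn] s cs unfolding P_def ts by blast
        also have "s \<subseteq> H" using t(1) by (auto simp: s_def)
        then have "f (insert y s) = c" using H(3) cs unfolding homog_def by blast
        finally show ?thesis .
      qed
      then have "homog H (Suc n) f c" by (simp add: homog_def)
      moreover have "a y ` X1 \<subseteq> Y" using Pa[OF y(1) yn] unfolding P_def by blast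
      ultimately show ?thesis using H(1,2) by (meson order_trans)
    next
      case False
      \<comment> \<open>Every branch meets its point. \<open>I y\<close> is the first stage where
        this happens, and \<open>y\<close> can be recovered from \<open>I y\<close> and the colours
        before it.\<close>
      then have ex: "\<exists>i. i \<in> X1 \<and> a y i = y" if "y \<in> Y" for y using that by blast
      have "\<exists>i. i \<in> X1 \<and> a y i = y \<and> y \<notin> a y ` underS r i" if "y \<in> Y" for y
      proof -
        let ?Q = "{i. i \<in> X1 \<and> a y i = y}"
        have "?Q \<noteq> {}" using ex that by simp
        then obtain i where "i \<in> ?Q" "\<And>j. (j, i) \<in> W \<Longrightarrow> j \<notin> ?Q"
          using wfE_min'[OF wfW, of ?Q] by metis
        moreover have "y \<notin> a y ` underS r i"
        proof
          assume "y \<in> a y ` underS r i"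
          then obtain j where "j \<in> underS r i" "a y j = y" by (metis imageE)
          then show False using calculation(2)[of j] under[of i] W by auto
        qed
        ultimately show ?thesis by auto
      qed
      then obtain I where I: "\<And>y. y \<in> Y \<Longrightarrow> I y \<in> X1 \<and> a y (I y) = y \<and> y \<notin> a y ` underS r (I y)" by metis
      have nI: "y \<notin> a y ` underS r i" if "y \<in> Y" "i = I y \<or> i \<in> underS r (I y)" for y i
        using I[OF that(1)] that(2) under_sub[of i "I y"] by blast
      define code where "code y = (I y, {(J, f (insert y (a y ` J))) |J. J \<subseteq> underS r (I y) \<and> finite J \<and> card J = n})" for y
      have injI: "inj_on (a y) (underS r (I y))" if "y \<in> Y" for y
      proof (rule inj_onI, rule ccontr)
        fix i j assume ij: "i \<in> underS r (I y)" "j \<in> underS r (I y)" "a y i = a y j" "i \<noteq> j"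
        then have "i \<in> underS r j \<or> j \<in> underS r i" using tot under by blast
        then show False using ne nI ij that by metis
      qed
      have inY: "a y i \<in> Y" if "y \<in> Y" "i \<in> underS r (I y)" for y i
        using Pa nI that by (auto simp: P_def)
      have "code y \<in> \<Theta>" if y: "y \<in> Y" for y
      proof -
        have "f (insert y (a y ` J)) \<in> C" if J: "J \<subseteq> underS r (I y)" "finite J" "card J = n" for J
        proof -
          have "card (a y ` J) = n" using injI[OF y] J by (metis card_image inj_on_subset)
          moreover have "y \<notin> a y ` J" using I[OF y] J by auto
          moreover have "a y ` J \<subseteq> Y" using inY y J by auto
          ultimately show ?thesis using f J y by auto
        qed
        then show ?thesis using I[OF y] under by (auto simp: code_def \<Theta>_def) blast
      qed
      moreover have "inj_on code Y"
      proof (rule inj_onI)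
        fix y z assume y: "y \<in> Y" and z: "z \<in> Y" and yz: "code y = code z"
        have Iyz: "I y = I z" using yz by (simp add: code_def)
        have col: "f (insert y (a y ` J)) = f (insert z (a z ` J))"
          if "J \<subseteq> underS r (I y)" "finite J" "card J = n" for J
        proof -
          have "(J, f (insert y (a y ` J))) \<in> snd (code y)" using that by (auto simp: code_def)
          then show ?thesis unfolding yz by (auto simp: code_def)
        qed
        have "j = I y \<or> j \<in> underS r (I y) \<Longrightarrow> a y j = a z j" for j
        proof (induction j rule: wf_induct_rule[OF wfW])
          case (1 j)
          have sub: "underS r j \<subseteq> underS r (I y)"
            using 1(2) under_sub[of j "I y"] by blast
          then have eq: "a y i = a z i" if "i \<in> underS r j" for i using 1(1) that W by blast
          then have img: "a y ` underS r j = a z ` underS r j" by auto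
          have "f (insert y s) = f (insert z s)" if s: "s \<subseteq> a y ` underS r j" "finite s" "card s = n" for s
          proof -
            obtain J where J: "J \<subseteq> underS r j" "s = a y ` J" using s(1) by (auto simp: subset_image_iff)
            have injJ: "inj_on (a y) J" using injI[OF y] J sub by (meson inj_on_subset order_trans)
            have "finite J" "card J = n" using s J injJ by (auto simp: finite_image_iff card_image)
            moreover have "a y ` J = a z ` J" using eq J by (intro image_cong) auto
            ultimately show ?thesis using col[of J] J sub by auto
          qed
          then have "P (a y) j y = P (a z) j z" unfolding P_def img[symmetric] fun_eq_iff by auto
          then show ?case using a[of y j] a[of z j] by simp
        qed
        from this[of "I y"] show "y = z" using I[OF y] I[OF z] Iyz by metis
      qed
      ultimately have "|Y| \<le>o |\<Theta>|" using card_of_ordLeq by blast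
      then have "|Pow \<Theta>| \<le>o |\<Theta>|"
        using ordIso_ordLeq_trans[OF ordIso_symmetric[OF X2] ordLeq_transitive[OF Y]] by blast
      then show ?thesis using card_of_Pow[of \<Theta>] not_ordLess_ordLeq by metis
    qed
  qed
  ultimately show ?case by blast
qed

end

section \<open>Isomorphisms and induced structures\<close>

lemma tuples_iff: "xs \<in> tuples n X \<longleftrightarrow> set xs \<subseteq> X \<and> length xs = n"
  by (auto simp: tuples_def)

lemma iso_struct_cong:
  assumes "iso_struct L A B f" and "is_struct L A" and eq: "\<And>x. x \<in> car A \<Longrightarrow> f x = g x"
  shows "iso_struct L A B g"
proof -
  have m: "map f xs = map g xs" if "xs \<in> tuples n (car A)" for n xs
    using that eq by (auto simp: tuples_iff)
  have b: "bij_betw g (car A) (car B)"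
    using assms(1) eq bij_betw_cong[of "car A" f g] by (simp add: iso_struct_def)
  have "fun_of A F xs \<in> car A" if "F \<in> fun_syms L" "xs \<in> tuples (fun_arity L F) (car A)" for F xs
    using assms(2) that by (auto simp: is_struct_def)
  then show ?thesis using assms(1) b m eq unfolding iso_struct_def by metis
qed

lemma iso_struct_comp:
  assumes "iso_struct L A B f" and "iso_struct L B C g"
  shows "iso_struct L A C (g \<circ> f)"
proof -
  have "map f xs \<in> tuples n (car B)" if "xs \<in> tuples n (car A)" for n xs
    using that assms(1) by (auto simp: tuples_iff iso_struct_def bij_betw_def)
  then show ?thesis
    using assms bij_betw_trans[of f "car A" "car B" g "car C"] unfolding iso_struct_def
    by (simp flip: map_map)
qed

lemma iso_struct_inv:
  assumes "iso_struct L A B f" and "is_struct L A"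
  shows "iso_struct L B A (inv_into (car A) f)"
proof -
  let ?g = "inv_into (car A) f"
  have b: "bij_betw f (car A) (car B)" using assms(1) by (simp add: iso_struct_def)
  have bg: "bij_betw ?g (car B) (car A)" using b by (rule bij_betw_inv_into)
  have t: "map ?g xs \<in> tuples n (car A) \<and> map f (map ?g xs) = xs" if "xs \<in> tuples n (car B)" for n xs
    using that b bg by (auto simp: tuples_iff bij_betw_def f_inv_into_f intro!: map_idI)
  have "?g (fun_of B F xs) = fun_of A F (map ?g xs)"
    if "F \<in> fun_syms L" "xs \<in> tuples (fun_arity L F) (car B)" for F xs
  proof -
    have "fun_of A F (map ?g xs) \<in> car A" using assms(2) that t by (auto simp: is_struct_def)
    moreover have "f (fun_of A F (map ?g xs)) = fun_of B F xs"
      using assms(1) that t unfolding iso_struct_def by metis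
    ultimately show ?thesis using b by (metis bij_betw_inv_into_left)
  qed
  moreover have "xs \<in> rel_of B R \<longleftrightarrow> map ?g xs \<in> rel_of A R"
    if "R \<in> rel_syms L" "xs \<in> tuples (rel_arity L R) (car B)" for R xs
    using assms(1) that t unfolding iso_struct_def by metis
  ultimately show ?thesis using bg by (simp add: iso_struct_def)
qed

lemma iso_struct_id: "iso_struct L A A (\<lambda>x. x)"
  by (simp add: iso_struct_def bij_betw_def)

definition Aut :: "('a, 'r, 'f) aec_data \<Rightarrow> ('a, 'r, 'f) fo_struct \<Rightarrow> ('a \<Rightarrow> 'a) set" where
  "Aut K M = {f. iso_struct (lang K) M M f}"

lemma ambient_of_simps [simp]:
  "pts (ambient_of K M \<delta>) = car M" "auts (ambient_of K M \<delta>) = Aut K M" "bd (ambient_of K M \<delta>) = \<delta>"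
  by (simp_all add: ambient_of_def Aut_def)

lemma car_induced [simp]: "car (induced L M S) = S"
  by (simp add: induced_def)

text \<open>Choices of upper bounds are made monotone by recursion on rank:
  \<open>A (Suc n) F\<close> bounds all \<open>A n F'\<close> with \<open>F' \<subseteq> F\<close>.
  Since a proper subset has smaller cardinality, evaluating at rank \<open>card F\<close> gives a
  monotone map. Such a map plays the role of a Skolem hull of a finite set.\<close>

lemma directed_monotone_family:
  fixes \<S> :: "'b set set" and b :: "'i \<Rightarrow> 'b set"
  assumes ne: "\<S> \<noteq> {}" and dir: "\<And>S T. S \<in> \<S> \<Longrightarrow> T \<in> \<S> \<Longrightarrow> \<exists>V\<in>\<S>. S \<union> T \<subseteq> V"
  shows "\<exists>N. \<forall>F. finite F \<longrightarrow> N F \<in> \<S> \<and> (\<forall>y\<in>F. b y \<in> \<S> \<longrightarrow> b y \<subseteq> N F) \<and> (\<forall>F'\<subseteq>F. N F' \<subseteq> N F)"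
proof -
  have "\<exists>V\<in>\<S>. \<Union>X \<subseteq> V" if "finite X" "X \<subseteq> \<S>" for X
    using that
  proof (induction X rule: finite_induct)
    case empty
    then show ?case using ne by auto
  next
    case (insert S X)
    then obtain V where "V \<in> \<S>" "\<Union>X \<subseteq> V" by auto
    moreover obtain V' where "V' \<in> \<S>" "S \<union> V \<subseteq> V'" using dir insert.prems \<open>V \<in> \<S>\<close> by (metis insert_subset)
    ultimately show ?case by (intro bexI[of _ V']) auto
  qed
  then obtain U where U: "\<And>X. finite X \<Longrightarrow> X \<subseteq> \<S> \<Longrightarrow> U X \<in> \<S> \<and> \<Union>X \<subseteq> U X" by metis
  define A where "A = rec_nat (\<lambda>F. U (b ` F \<inter> \<S>)) (\<lambda>n A F. U (b ` F \<inter> \<S> \<union> A ` Pow F))"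
  have A0: "A 0 F = U (b ` F \<inter> \<S>)" and AS: "A (Suc n) F = U (b ` F \<inter> \<S> \<union> A n ` Pow F)" for n F
    by (simp_all add: A_def)
  have A: "A n F \<in> \<S> \<and> (\<forall>y\<in>F. b y \<in> \<S> \<longrightarrow> b y \<subseteq> A n F)" if "finite F" for n F
    using that
  proof (induction n arbitrary: F)
    case 0
    then show ?case using U[of "b ` F \<inter> \<S>"] by (auto simp: A0)
  next
    case (Suc n)
    have "A n ` Pow F \<subseteq> \<S>" using Suc by (auto simp: finite_subset)
    then show ?case using U[of "b ` F \<inter> \<S> \<union> A n ` Pow F"] Suc.prems by (auto simp: AS)
  qed
  have step: "A n F' \<subseteq> A (Suc n) F" if "finite F" "F' \<subseteq> F" for n F F'
  proof -
    have "A n ` Pow F \<subseteq> \<S>" using A that by (auto simp: finite_subset)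
    then have "\<Union>(b ` F \<inter> \<S> \<union> A n ` Pow F) \<subseteq> A (Suc n) F"
      using U[of "b ` F \<inter> \<S> \<union> A n ` Pow F"] that by (auto simp: AS)
    then show ?thesis using that by blast
  qed
  have mono: "A m F' \<subseteq> A n F" if "finite F" "F' \<subseteq> F" "m < n" for m n F F'
    using that(3)
  proof (induction n)
    case (Suc n)
    show ?case
    proof (cases "m = n")
      case True
      then show ?thesis using step that by blast
    next
      case False
      then have "A m F' \<subseteq> A n F" using Suc by simp
      then show ?thesis using step[OF that(1) subset_refl] by blast
    qed
  qed simp
  have "A (card F') F' \<subseteq> A (card F) F" if "finite F" "F' \<subseteq> F" for F F'
  proof (cases "F' = F")
    case False
    then have "card F' < card F" using that by (simp add: psubset_card_mono psubset_eq)
    then show ?thesis using mono that by blast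
  qed simp
  moreover have "A (card F) F \<in> \<S>" "\<And>y. y \<in> F \<Longrightarrow> b y \<in> \<S> \<Longrightarrow> b y \<subseteq> A (card F) F" if "finite F" for F
    using A[OF that, of "card F"] by auto
  ultimately show ?thesis by (intro exI[of _ "\<lambda>F. A (card F) F"]) simp
qed

section \<open>Homogeneous structures in an abstract elementary class\<close>

locale homogeneous_structure =
  fixes K :: "('a, 'r, 'f) aec_data" and M :: "('a, 'r, 'f) fo_struct" and \<delta> :: "'a rel"
  assumes aec: "aec_axioms K" and mem: "M \<in> members K" and LS: "LS_property K natLeq"
    and univ: "universal K M \<delta>" and homo: "model_homogeneous K M \<delta>"
    and card_order: "Card_order \<delta>" and nat_less: "natLeq <o \<delta>"
begin

abbreviation ind :: "'a set \<Rightarrow> ('a, 'r, 'f) fo_struct" where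
  "ind \<equiv> induced (lang K) M"

abbreviation G :: "('a \<Rightarrow> 'a) set" where
  "G \<equiv> Aut K M"

text \<open>\<open>model\<close> without the size bound, so that unions and the ambient structure
  itself are covered.\<close>

definition str :: "'a set \<Rightarrow> bool" where
  "str S \<longleftrightarrow> S \<subseteq> car M \<and> strong K (ind S) M"

lemma model_iff: "model K M \<delta> S \<longleftrightarrow> str S \<and> |S| <o \<delta>"
  by (simp add: model_def str_def conj_assoc)

lemma str_car: "str S \<Longrightarrow> S \<subseteq> car M"
  by (simp add: str_def)

lemma aec_facts:
  shows members_struct: "A \<in> members K \<Longrightarrow> is_struct (lang K) A"
    and strongD: "strong K A B \<Longrightarrow> A \<in> members K \<and> B \<in> members K \<and> substruct (lang K) A B"
    and strong_iso: "strong K A B \<Longrightarrow> is_struct (lang K) A' \<Longrightarrow> is_struct (lang K) B' \<Longrightarrow>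
      iso_struct (lang K) A A' f \<Longrightarrow> iso_struct (lang K) B B' f \<Longrightarrow> strong K A' B'"
    and strong_refl: "A \<in> members K \<Longrightarrow> strong K A A"
    and strong_trans: "strong K A B \<Longrightarrow> strong K B C \<Longrightarrow> strong K A C"
    and strong_coherent: "strong K A C \<Longrightarrow> strong K B C \<Longrightarrow> car A \<subseteq> car B \<Longrightarrow> strong K A B"
    and strong_union: "\<C> \<noteq> {} \<Longrightarrow> \<C> \<subseteq> members K \<Longrightarrow>
      (\<And>S. S \<subseteq> \<C> \<Longrightarrow> S \<noteq> {} \<Longrightarrow> \<exists>A\<in>S. \<forall>B\<in>S. strong K A B) \<Longrightarrow> B \<in> members K \<Longrightarrow>
      (\<And>A. A \<in> \<C> \<Longrightarrow> strong K A B) \<Longrightarrow> strong K (union_struct (lang K) \<C>) B"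
proof -
  note ax = aec[unfolded aec_axioms_def]
  show "A \<in> members K \<Longrightarrow> is_struct (lang K) A" using ax[THEN conjunct1] by blast
  show "strong K A B \<Longrightarrow> A \<in> members K \<and> B \<in> members K \<and> substruct (lang K) A B"
    using ax[THEN conjunct2, THEN conjunct1] by blast
  show "strong K A B \<Longrightarrow> is_struct (lang K) A' \<Longrightarrow> is_struct (lang K) B' \<Longrightarrow>
      iso_struct (lang K) A A' f \<Longrightarrow> iso_struct (lang K) B B' f \<Longrightarrow> strong K A' B'"
    using ax[THEN conjunct2, THEN conjunct2, THEN conjunct2, THEN conjunct1] by blast
  note ax = ax[THEN conjunct2, THEN conjunct2, THEN conjunct2, THEN conjunct2]
  show "A \<in> members K \<Longrightarrow> strong K A A" using ax[THEN conjunct1] by blast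
  show "strong K A B \<Longrightarrow> strong K B C \<Longrightarrow> strong K A C"
    using ax[THEN conjunct2, THEN conjunct1] by blast
  note ax = ax[THEN conjunct2, THEN conjunct2]
  show "strong K A C \<Longrightarrow> strong K B C \<Longrightarrow> car A \<subseteq> car B \<Longrightarrow> strong K A B"
    using ax[THEN conjunct2] by blast
  assume a: "\<C> \<noteq> {}" "\<C> \<subseteq> members K" "\<And>S. S \<subseteq> \<C> \<Longrightarrow> S \<noteq> {} \<Longrightarrow> \<exists>A\<in>S. \<forall>B\<in>S. strong K A B"
    and b: "B \<in> members K" "\<And>A. A \<in> \<C> \<Longrightarrow> strong K A B"
  show "strong K (union_struct (lang K) \<C>) B"
    using spec[OF ax[THEN conjunct1], of \<C>] a b by simp
qed

lemma struct_M: "is_struct (lang K) M"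
  using mem by (rule members_struct)

lemma strong_eq_ind:
  assumes "strong K B M"
  shows "B = ind (car B)"
proof -
  have s: "substruct (lang K) B M" and B: "is_struct (lang K) B"
    using strongD[OF assms] members_struct by auto
  have "rel_of B = (\<lambda>R. rel_of M R \<inter> lists (car B))"
  proof
    fix R
    show "rel_of B R = rel_of M R \<inter> lists (car B)"
      using s B struct_M by (cases "R \<in> rel_syms (lang K)") (auto simp: substruct_def is_struct_def)
  qed
  moreover have "fun_of B = (\<lambda>F xs.
      if F \<in> fun_syms (lang K) \<and> xs \<in> tuples (fun_arity (lang K) F) (car B) then fun_of M F xs else undefined)"
    using s B by (intro ext) (auto simp: substruct_def is_struct_def)
  ultimately show ?thesis by (simp add: induced_def)
qed

lemma str_strong: "strong K B M \<Longrightarrow> str (car B)"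
  using strong_eq_ind[of B] strongD[of B M] by (auto simp: str_def substruct_def)

lemma str_M: "str (car M)"
  using strong_refl[OF mem] by (rule str_strong)

lemma str_mem: "str S \<Longrightarrow> ind S \<in> members K"
  by (auto simp: str_def dest: strongD)

lemma str_strong_ind: "str S \<Longrightarrow> str T \<Longrightarrow> S \<subseteq> T \<Longrightarrow> strong K (ind S) (ind T)"
  using strong_coherent[of "ind S" M "ind T"] by (simp add: str_def)

lemma strong_ind_str: "str T \<Longrightarrow> strong K B (ind T) \<Longrightarrow> str (car B) \<and> car B \<subseteq> T \<and> B = ind (car B)"
  using strong_trans[of B "ind T" M] str_strong[of B] strong_eq_ind[of B] strongD[of B "ind T"]
  by (auto simp: str_def substruct_def)

lemma LS_str:
  assumes "str T" and "X \<subseteq> T"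
  obtains S where "str S" "X \<subseteq> S" "S \<subseteq> T" "|S| \<le>o |X| +c natLeq"
proof -
  obtain B where "strong K B (ind T)" "X \<subseteq> car B" "|car B| \<le>o |X| +c natLeq"
    using LS str_mem[OF assms(1)] assms(2) unfolding LS_property_def by (metis car_induced)
  then show thesis using that strong_ind_str[OF assms(1)] by blast
qed

lemma LS_countable:
  assumes "str T" and "X \<subseteq> T" and "countable X"
  obtains S where "str S" "X \<subseteq> S" "S \<subseteq> T" "countable S"
proof -
  obtain S where S: "str S" "X \<subseteq> S" "S \<subseteq> T" "|S| \<le>o |X| +c natLeq" using LS_str assms by blast
  have "|X| +c natLeq \<le>o natLeq"
    using countable_ordLeq_natLeq[OF assms(3)]
    by (rule csum_cinfinite_bound[OF _ ordLeq_refl[OF natLeq_Card_order] card_of_Card_order natLeq_Card_order natLeq_Cinfinite])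
  then have "|S| \<le>o |UNIV :: nat set|"
    using S(4) by (meson card_of_nat ordIso_symmetric ordLeq_ordIso_trans ordLeq_transitive)
  then show thesis using S that by (metis card_of_ordLeq countable_def subset_UNIV)
qed

lemma csum_natLeq_small:
  assumes "|X| <o \<delta>"
  shows "|X| +c natLeq <o \<delta>"
proof -
  have C: "Cinfinite \<delta>" using infinite_Field_of_natLeq_ordLess[OF card_order nat_less] .
  have "|X <+> (UNIV :: nat set)| <o \<delta>"
    using C assms ordLess_countable[OF nat_less, of "UNIV :: nat set"]
    by (intro card_of_Plus_ordLess_infinite_Field) (auto simp: cinfinite_def)
  moreover have "|X| +c natLeq =o |X <+> (UNIV :: nat set)|"
    using ordIso_transitive[OF csum_cong2[OF ordIso_symmetric[OF card_of_nat]] ordIso_symmetric[OF Plus_csum]] .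
  ultimately show ?thesis by (meson ordIso_ordLess_trans)
qed

lemma LS_small:
  assumes "str T" and "X \<subseteq> T" and "|X| <o \<delta>"
  obtains S where "str S" "X \<subseteq> S" "S \<subseteq> T" "|S| <o \<delta>"
proof -
  obtain S where S: "str S" "X \<subseteq> S" "S \<subseteq> T" "|S| \<le>o |X| +c natLeq" using LS_str assms by blast
  show thesis using that[OF S(1-3)] ordLeq_ordLess_trans[OF S(4) csum_natLeq_small[OF assms(3)]] by blast
qed

lemma countable_small: "countable X \<Longrightarrow> |X| <o \<delta>"
  using ordLess_countable[OF nat_less] .

lemma small_Un: "|X| <o \<delta> \<Longrightarrow> |Y| <o \<delta> \<Longrightarrow> |X \<union> Y| <o \<delta>"
  using card_of_Un_ordLess_infinite_Field[of \<delta> X Y] infinite_Field_of_natLeq_ordLess[OF card_order nat_less] card_order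
  by (simp add: cinfinite_def)

lemma str_closed: "str S \<Longrightarrow> F \<in> fun_syms (lang K) \<Longrightarrow> xs \<in> tuples (fun_arity (lang K) F) S \<Longrightarrow> fun_of M F xs \<in> S"
  using members_struct[OF str_mem, of S] by (auto simp: is_struct_def induced_def)

lemma is_struct_ind:
  assumes "\<And>F xs. F \<in> fun_syms (lang K) \<Longrightarrow> xs \<in> tuples (fun_arity (lang K) F) S \<Longrightarrow> fun_of M F xs \<in> S"
  shows "is_struct (lang K) (ind S)"
  using assms struct_M by (auto simp: is_struct_def induced_def tuples_def)

lemma Aut_bij: "f \<in> G \<Longrightarrow> bij_betw f (car M) (car M)"
  by (simp add: Aut_def iso_struct_def)

lemma Aut_in [simp]: "f \<in> G \<Longrightarrow> x \<in> car M \<Longrightarrow> f x \<in> car M"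
  using Aut_bij by (auto simp: bij_betw_def)

lemma Aut_inj: "f \<in> G \<Longrightarrow> x \<in> car M \<Longrightarrow> y \<in> car M \<Longrightarrow> f x = f y \<longleftrightarrow> x = y"
  using Aut_bij by (auto simp: bij_betw_def inj_on_def)

lemma Aut_id: "(\<lambda>x. x) \<in> G"
  by (simp add: Aut_def iso_struct_id)

lemma Aut_comp: "f \<in> G \<Longrightarrow> g \<in> G \<Longrightarrow> (\<lambda>x. f (g x)) \<in> G"
  using iso_struct_comp[of "lang K" M M g M f] by (simp add: Aut_def comp_def)

lemma Aut_cong: "f \<in> G \<Longrightarrow> (\<And>x. x \<in> car M \<Longrightarrow> f x = g x) \<Longrightarrow> g \<in> G"
  using iso_struct_cong[of "lang K" M M f g] struct_M by (simp add: Aut_def)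

lemma Aut_inv:
  assumes "f \<in> G"
  obtains g where "g \<in> G" "\<And>x. x \<in> car M \<Longrightarrow> g (f x) = x" "\<And>x. x \<in> car M \<Longrightarrow> f (g x) = x"
proof
  show "inv_into (car M) f \<in> G" using iso_struct_inv[of "lang K" M M f] struct_M assms by (simp add: Aut_def)
  show "inv_into (car M) f (f x) = x" "f (inv_into (car M) f x) = x" if "x \<in> car M" for x
    using Aut_bij[OF assms] that by (simp_all add: bij_betw_inv_into_left bij_betw_inv_into_right)
qed

lemma Aut_rel: "f \<in> G \<Longrightarrow> R \<in> rel_syms (lang K) \<Longrightarrow> xs \<in> tuples (rel_arity (lang K) R) (car M) \<Longrightarrow>
    map f xs \<in> rel_of M R \<longleftrightarrow> xs \<in> rel_of M R"
  by (simp add: Aut_def iso_struct_def)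

lemma Aut_fun: "f \<in> G \<Longrightarrow> F \<in> fun_syms (lang K) \<Longrightarrow> xs \<in> tuples (fun_arity (lang K) F) (car M) \<Longrightarrow>
    f (fun_of M F xs) = fun_of M F (map f xs)"
  by (simp add: Aut_def iso_struct_def)

text \<open>Relations and functions involve finitely many points, so agreement with automorphisms on
  finite lists suffices. Closure of \<open>S\<close> allows the value \<open>fun_of M F xs\<close>
  to be added to the list on which the automorphism is taken.\<close>

lemma iso_local:
  assumes S: "S \<subseteq> car M" and cl: "\<And>F xs. F \<in> fun_syms (lang K) \<Longrightarrow> xs \<in> tuples (fun_arity (lang K) F) S \<Longrightarrow> fun_of M F xs \<in> S"
    and T: "h ` S = T" and loc: "\<And>xs. xs \<in> lists S \<Longrightarrow> \<exists>g\<in>G. map g xs = map h xs"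
  shows "iso_struct (lang K) (ind S) (ind T) h"
proof -
  have "inj_on h S"
  proof (rule inj_onI)
    fix x y assume xy: "x \<in> S" "y \<in> S" "h x = h y"
    obtain g where "g \<in> G" "map g [x, y] = map h [x, y]" using loc[of "[x, y]"] xy by auto
    then show "x = y" using xy Aut_inj[of g x y] S by auto
  qed
  moreover have "xs \<in> rel_of (ind S) R \<longleftrightarrow> map h xs \<in> rel_of (ind T) R"
    if R: "R \<in> rel_syms (lang K)" and xs: "xs \<in> tuples (rel_arity (lang K) R) S" for R xs
  proof -
    obtain g where g: "g \<in> G" "map g xs = map h xs" using loc[of xs] xs by (auto simp: tuples_def)
    have "map g xs \<in> rel_of M R \<longleftrightarrow> xs \<in> rel_of M R"
      using Aut_rel[OF g(1) R] xs S by (auto simp: tuples_iff)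
    moreover have "xs \<in> lists S" using xs by (auto simp: tuples_iff)
    moreover have "map h xs \<in> lists T" using xs image_mono[of "set xs" S h] T by (simp add: tuples_iff lists_eq_set)
    ultimately show ?thesis using g(2) by (auto simp: induced_def)
  qed
  moreover have "h (fun_of (ind S) F xs) = fun_of (ind T) F (map h xs)"
    if F: "F \<in> fun_syms (lang K)" and xs: "xs \<in> tuples (fun_arity (lang K) F) S" for F xs
  proof -
    let ?y = "fun_of M F xs"
    have y: "?y \<in> S" using cl F xs by blast
    obtain g where g: "g \<in> G" "map g (?y # xs) = map h (?y # xs)" using loc[of "?y # xs"] xs y by (auto simp: tuples_def)
    have "g ?y = fun_of M F (map g xs)" using Aut_fun[OF g(1) F] xs S by (auto simp: tuples_iff)
    moreover have "map h xs \<in> tuples (fun_arity (lang K) F) T" using xs T by (auto simp: tuples_iff)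
    moreover have "g ?y = h ?y" "map g xs = map h xs" using g(2) by simp_all
    ultimately show ?thesis using F xs by (simp add: induced_def del: map_eq_conv)
  qed
  ultimately show ?thesis using T by (simp add: iso_struct_def bij_betw_def)
qed

lemma str_image:
  assumes f: "f \<in> G" and S: "str S"
  shows "str (f ` S)" "iso_struct (lang K) (ind S) (ind (f ` S)) f"
proof -
  show iso: "iso_struct (lang K) (ind S) (ind (f ` S)) f"
    using f by (intro iso_local[OF str_car[OF S] str_closed[OF S]]) auto
  have "is_struct (lang K) (ind (f ` S))"
  proof (rule is_struct_ind)
    fix F xs assume F: "F \<in> fun_syms (lang K)" and xs: "xs \<in> tuples (fun_arity (lang K) F) (f ` S)"
    then have "xs \<in> lists (f ` S)" by (auto simp: tuples_def)
    then obtain ys where ys: "ys \<in> lists S" "xs = map f ys" by (auto simp: lists_image)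
    then have "ys \<in> tuples (fun_arity (lang K) F) S" using xs by (auto simp: tuples_iff)
    moreover then have "ys \<in> tuples (fun_arity (lang K) F) (car M)" using str_car[OF S] by (auto simp: tuples_iff)
    ultimately have "fun_of M F xs = f (fun_of M F ys)" "fun_of M F ys \<in> S"
      using Aut_fun[OF f F] str_closed[OF S F] ys(2) by auto
    then show "fun_of M F xs \<in> f ` S" by auto
  qed
  then have "strong K (ind (f ` S)) M"
    using strong_iso[of "ind S" M "ind (f ` S)" M f] iso S f struct_M by (simp add: str_def Aut_def)
  then show "str (f ` S)" using str_strong by fastforce
qed

lemma homogeneous:
  assumes "str S" "str T" "|S| <o \<delta>" "|T| <o \<delta>" and "iso_struct (lang K) (ind S) (ind T) h"
  obtains g where "g \<in> G" "\<And>x. x \<in> S \<Longrightarrow> g x = h x"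
proof -
  have "model K M \<delta> S" "model K M \<delta> T" using assms by (simp_all add: model_iff)
  then show thesis using homo assms(5) that unfolding model_homogeneous_def Aut_def by blast
qed

text \<open>Finite agreement becomes one automorphism, provided the image is again strong; this
  proviso is what has to be established in each application.\<close>

lemma homogeneous_local:
  assumes "str S" "str (h ` S)" "|S| <o \<delta>" and "\<And>xs. xs \<in> lists S \<Longrightarrow> \<exists>g\<in>G. map g xs = map h xs"
  obtains g where "g \<in> G" "\<And>x. x \<in> S \<Longrightarrow> g x = h x"
  using homogeneous[OF assms(1-3) ordLess_image[OF assms(3)]
      iso_local[OF str_car[OF assms(1)] str_closed[OF assms(1)] refl assms(4)]] that by blast

text \<open>The chain axiom, read on carriers. Every finite list from the union lies in one member,
  so the union structure is the induced one.\<close>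

lemma chain_union_str:
  assumes ne: "\<C> \<noteq> {}" and str: "\<And>S. S \<in> \<C> \<Longrightarrow> str S"
    and wo: "\<And>\<S>. \<S> \<subseteq> \<C> \<Longrightarrow> \<S> \<noteq> {} \<Longrightarrow> \<exists>S\<in>\<S>. \<forall>T\<in>\<S>. S \<subseteq> T"
  shows "str (\<Union>\<C>)"
proof -
  have lin: "S \<subseteq> T \<or> T \<subseteq> S" if "S \<in> \<C>" "T \<in> \<C>" for S T
    using wo[of "{S, T}"] that by auto
  have fin: "\<exists>S\<in>\<C>. xs \<in> lists S" if "xs \<in> lists (\<Union>\<C>)" for xs
    using that
  proof (induction xs)
    case Nil
    then show ?case using ne by auto
  next
    case (Cons x xs)
    then obtain S T where "S \<in> \<C>" "xs \<in> lists S" "T \<in> \<C>" "x \<in> T" by auto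
    then show ?case using lin[of S T] by (metis Cons_in_lists_iff in_mono lists_mono)
  qed
  have "union_struct (lang K) (ind ` \<C>) = ind (\<Union>\<C>)"
  proof -
    have "(THE y. \<exists>A\<in>ind ` \<C>. xs \<in> lists (car A) \<and> y = fun_of A F xs) = fun_of M F xs"
      if "F \<in> fun_syms (lang K)" "xs \<in> tuples (fun_arity (lang K) F) (\<Union>\<C>)" for F xs
    proof (rule the_equality)
      show "\<exists>A\<in>ind ` \<C>. xs \<in> lists (car A) \<and> fun_of M F xs = fun_of A F xs"
        using fin[of xs] that by (auto simp: tuples_def induced_def)
      show "y = fun_of M F xs" if "\<exists>A\<in>ind ` \<C>. xs \<in> lists (car A) \<and> y = fun_of A F xs" for y
        using that \<open>F \<in> fun_syms (lang K)\<close> \<open>xs \<in> tuples (fun_arity (lang K) F) (\<Union>\<C>)\<close>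
        by (auto simp: tuples_def induced_def)
    qed
    moreover have "(\<lambda>R. \<Union>A\<in>\<C>. rel_of M R \<inter> lists A) = (\<lambda>R. rel_of M R \<inter> lists (\<Union>\<C>))"
    proof (intro ext equalityI subsetI)
      fix R xs assume "xs \<in> (\<Union>A\<in>\<C>. rel_of M R \<inter> lists A)"
      then show "xs \<in> rel_of M R \<inter> lists (\<Union>\<C>)" by auto
    qed (use fin in blast)
    ultimately show ?thesis
      unfolding union_struct_def by (auto simp: induced_def fun_eq_iff)
  qed
  moreover have "ind ` \<C> \<subseteq> members K" using str str_mem by auto
  moreover have "\<exists>A\<in>S. \<forall>B\<in>S. strong K A B" if S: "S \<subseteq> ind ` \<C>" "S \<noteq> {}" for S
  proof -
    obtain \<S> where \<S>: "\<S> \<subseteq> \<C>" "S = ind ` \<S>" using S(1) by (auto simp: subset_image_iff)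
    then obtain X where X: "X \<in> \<S>" "\<forall>T\<in>\<S>. X \<subseteq> T" using wo[of \<S>] S(2) by blast
    then have "strong K (ind X) (ind T)" if "T \<in> \<S>" for T
      using that \<S>(1) str by (intro str_strong_ind) auto
    then show ?thesis using \<S>(2) X(1) by blast
  qed
  moreover have "\<forall>A\<in>ind ` \<C>. strong K A M" using str by (auto simp: str_def)
  ultimately have "strong K (ind (\<Union>\<C>)) M"
    using strong_union[of "ind ` \<C>" M] ne mem by auto
  then show ?thesis using str_strong by fastforce
qed

text \<open>Induction on \<open>|I|\<close>. An infinite \<open>I\<close> is enumerated in its
  initial order type; the unions over finite subsets of proper initial segments form a well-ordered
  chain whose members are strong by induction, and every finite subset of \<open>I\<close> lies in
  some proper initial segment because an infinite cardinal is a limit.\<close>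

lemma finite_subsets_union_str:
  fixes I :: "'i set"
  assumes "\<And>F. finite F \<Longrightarrow> F \<subseteq> I \<Longrightarrow> str (N F)"
    and "\<And>F F'. finite F \<Longrightarrow> F \<subseteq> I \<Longrightarrow> F' \<subseteq> F \<Longrightarrow> N F' \<subseteq> N F"
  shows "str (\<Union>F\<in>{F. finite F \<and> F \<subseteq> I}. N F)"
proof -
  have "(\<forall>F. finite F \<and> F \<subseteq> I \<longrightarrow> str (N F)) \<and> (\<forall>F F'. finite F \<and> F \<subseteq> I \<and> F' \<subseteq> F \<longrightarrow> N F' \<subseteq> N F) \<Longrightarrow>
      str (\<Union>F\<in>{F. finite F \<and> F \<subseteq> I}. N F)"
  proof (induction "|I|" arbitrary: I rule: wf_induct_rule[OF wf_ordLess])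
    case (1 I)
    show ?case
    proof (cases "finite I")
      case True
      have "(\<Union>F\<in>{F. finite F \<and> F \<subseteq> I}. N F) = N I"
        using 1(2)[THEN conjunct2, rule_format, of I] True by (intro equalityI UN_least UN_upper) auto
      then show ?thesis using 1(2) True by simp
    next
      case False
      define r where "r = |I|"
      have r: "Card_order r" "Field r = I" "Well_order r"
        using card_of_Card_order[of I] card_of_well_order_on[of I] by (simp_all add: r_def Field_card_of)
      define U where "U i = (\<Union>F\<in>{F. finite F \<and> F \<subseteq> underS r i}. N F)" for i
      have sub: "underS r i \<subseteq> I" for i using r(2) by (auto simp: underS_def Field_def)
      have strU: "str (U i)" if "i \<in> I" for i
      proof -
        have "|underS r i| <o |I|" using card_of_underS[OF r(1)] that r(2) by (simp add: r_def)
        moreover have "(\<forall>F. finite F \<and> F \<subseteq> underS r i \<longrightarrow> str (N F)) \<and>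
            (\<forall>F F'. finite F \<and> F \<subseteq> underS r i \<and> F' \<subseteq> F \<longrightarrow> N F' \<subseteq> N F)"
          using 1(2) sub[of i] by (meson order_trans)
        ultimately show ?thesis unfolding U_def using 1(1)[of "underS r i"] by blast
      qed
      have wfr: "wf (r - Id)" and tr: "trans r" and asy: "antisym r" and tot: "total_on I r"
        using r(2,3) by (auto simp: order_on_defs)
      have monoU: "U i \<subseteq> U j" if "(i, j) \<in> r" for i j
      proof -
        have "underS r i \<subseteq> underS r j"
          using that tr asy unfolding underS_def trans_def antisym_def by blast
        then show ?thesis unfolding U_def by blast
      qed
      have "str (\<Union>(U ` I))"
      proof (rule chain_union_str)
        show "U ` I \<noteq> {}" using False by auto
        show "str S" if "S \<in> U ` I" for S using that strU by auto
        fix \<S> assume \<S>: "\<S> \<subseteq> U ` I" "\<S> \<noteq> {}"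
        define T where "T = {i \<in> I. U i \<in> \<S>}"
        have "T \<noteq> {}" using \<S> by (auto simp: T_def)
        then obtain i where i: "i \<in> T" "\<And>j. (j, i) \<in> r - Id \<Longrightarrow> j \<notin> T"
          using wfE_min'[OF wfr, of T] by metis
        have "U i \<subseteq> X" if X: "X \<in> \<S>" for X
        proof -
          obtain j where j: "j \<in> T" "X = U j" using X \<S>(1) by (auto simp: T_def)
          have "i = j \<or> (i, j) \<in> r"
            using i(2)[of j] j(1) i(1) tot by (auto simp: T_def total_on_def)
          then show ?thesis using monoU j(2) by auto
        qed
        then show "\<exists>S\<in>\<S>. \<forall>T\<in>\<S>. S \<subseteq> T" using i(1) by (auto simp: T_def)
      qed
      moreover have "\<exists>i\<in>I. F \<subseteq> underS r i" if F: "finite F" "F \<subseteq> I" for F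
      proof (cases "F = {}")
        case True
        then show ?thesis using False by (metis all_not_in_conv empty_subsetI finite.emptyI)
      next
        case F0: False
        then obtain t where t: "t \<in> F" "\<forall>j\<in>F. j \<noteq> t \<longrightarrow> j \<in> underS r t"
          using finite_has_top[OF F(1) F0 _ r(3)] F(2) r(2) by auto
        obtain b where b: "b \<in> I" "t \<noteq> b" "(t, b) \<in> r"
          using infinite_Card_order_limit[OF r(1), of t] False r(2) t F by auto
        have "F \<subseteq> underS r b"
        proof
          fix j assume "j \<in> F"
          then have jt: "j = t \<or> j \<noteq> t \<and> (j, t) \<in> r" using t(2) by (auto simp: underS_def)
          then have "(j, b) \<in> r" using b(3) transD[OF tr] by blast
          moreover have "j \<noteq> b" using jt b(2,3) antisymD[OF asy, of t b] by blast
          ultimately show "j \<in> underS r b"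
            by (simp add: underS_def)
        qed
        then show ?thesis using b by blast
      qed
      then have "(\<Union>F\<in>{F. finite F \<and> F \<subseteq> I}. N F) \<subseteq> \<Union>(U ` I)"
        unfolding U_def by (auto simp: subset_iff) metis
      moreover have "\<Union>(U ` I) \<subseteq> (\<Union>F\<in>{F. finite F \<and> F \<subseteq> I}. N F)"
        using sub unfolding U_def by (auto dest: order_trans)
      ultimately show ?thesis by (metis subset_antisym)
    qed
  qed
  then show ?thesis using assms by blast
qed

text \<open>Indexing by the finite subsets of \<open>\<S>\<close> itself turns directedness into
  monotonicity.\<close>

lemma directed_union_str:
  assumes "\<S> \<noteq> {}" and "\<And>S. S \<in> \<S> \<Longrightarrow> str S" and "\<And>S T. S \<in> \<S> \<Longrightarrow> T \<in> \<S> \<Longrightarrow> \<exists>V\<in>\<S>. S \<union> T \<subseteq> V"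
  shows "str (\<Union>\<S>)"
proof -
  obtain N where N: "\<And>F. finite F \<Longrightarrow> N F \<in> \<S>" "\<And>F y. finite F \<Longrightarrow> y \<in> F \<Longrightarrow> y \<in> \<S> \<Longrightarrow> y \<subseteq> N F"
    "\<And>F F'. finite F \<Longrightarrow> F' \<subseteq> F \<Longrightarrow> N F' \<subseteq> N F"
    using directed_monotone_family[of \<S> "\<lambda>S. S", OF assms(1,3)] by (metis (no_types, lifting))
  have "str (\<Union>F\<in>{F. finite F \<and> F \<subseteq> \<S>}. N F)"
  proof (rule finite_subsets_union_str)
    show "str (N F)" if "finite F" "F \<subseteq> \<S>" for F using N(1) assms(2) that by blast
    show "N F' \<subseteq> N F" if "finite F" "F \<subseteq> \<S>" "F' \<subseteq> F" for F F' using N(3) that by blast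
  qed
  moreover have "(\<Union>F\<in>{F. finite F \<and> F \<subseteq> \<S>}. N F) = \<Union>\<S>"
  proof
    show "(\<Union>F\<in>{F. finite F \<and> F \<subseteq> \<S>}. N F) \<subseteq> \<Union>\<S>" using N(1) by auto
    have "S \<subseteq> N {S}" "{S} \<in> {F. finite F \<and> F \<subseteq> \<S>}" if "S \<in> \<S>" for S
      using N(2)[of "{S}" S] that by auto
    then have "S \<subseteq> (\<Union>F\<in>{F. finite F \<and> F \<subseteq> \<S>}. N F)" if "S \<in> \<S>" for S
      by (rule order_trans[OF _ UN_upper[of "{S}"]]) (use that in auto)
    then show "\<Union>\<S> \<subseteq> (\<Union>F\<in>{F. finite F \<and> F \<subseteq> \<S>}. N F)" by (rule Sup_least)
  qed
  ultimately show ?thesis by simp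
qed

end

section \<open>Stretching indiscernible systems\<close>

text \<open>Finite subsets of an initial segment, kept as increasing lists because the position of
  an index in the order matters for the structure attached to it.\<close>

definition subs :: "nat \<Rightarrow> nat list set" where
  "subs k = {ns. sorted_wrt (<) ns \<and> set ns \<subseteq> {..<k}}"

definition sel :: "'b list \<Rightarrow> nat list \<Rightarrow> 'b list" where
  "sel xs ns = map (nth xs) ns"

lemma sel_simps [simp]:
  "sel xs [] = []" "sel xs (n # ns) = xs ! n # sel xs ns" "length (sel xs ns) = length ns"
  by (simp_all add: sel_def)

lemma sel_upt [simp]: "sel xs [0..<length xs] = xs"
  by (simp add: sel_def map_nth)

lemma sel_map: "ns \<in> subs (length xs) \<Longrightarrow> sel (map f xs) ns = map f (sel xs ns)"
  by (auto simp: sel_def subs_def)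

lemma sel_sel: "ms \<in> subs (length ns) \<Longrightarrow> sel (sel xs ns) ms = sel xs (sel ns ms)"
  by (auto simp: sel_def subs_def)

lemma sel_idx: "ns \<in> subs k \<Longrightarrow> sel [0..<k] ns = ns"
  by (auto simp: sel_def subs_def intro!: map_idI)

lemma set_sel: "ns \<in> subs (length xs) \<Longrightarrow> set (sel xs ns) \<subseteq> set xs"
  by (auto simp: sel_def subs_def)

lemma sorted_sel:
  assumes "sorted_wrt R xs" and "ns \<in> subs (length xs)"
  shows "sorted_wrt R (sel xs ns)"
  using assms by (auto simp: sorted_wrt_iff_nth_less subs_def sel_def nth_mem subset_iff)

lemma subs_sel: "ms \<in> subs (length ns) \<Longrightarrow> ns \<in> subs k \<Longrightarrow> sel ns ms \<in> subs k"
  using sorted_sel[of "(<)" ns ms] set_sel[of ms ns] by (auto simp: subs_def)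

lemma subs_Nil [simp]: "[] \<in> subs k" and subs_upt [simp]: "[0..<k] \<in> subs k"
  and subs_single [simp]: "[i] \<in> subs k \<longleftrightarrow> i < k"
  by (auto simp: subs_def)

lemma subs_mono: "ns \<in> subs k \<Longrightarrow> k \<le> l \<Longrightarrow> ns \<in> subs l"
  by (auto simp: subs_def)

text \<open>
  An \<omega>-indexed system of countable structures \<open>range (e ns)\<close>, one for each increasing list \<open>ns\<close>, all of
  the same type along increasing index lists, over a finite set \<open>A\<close>.  The first \<open>m\<close> values of
  \<open>e [i]\<close> form the \<open>i\<close>-th point of an indiscernible sequence of pairwise inequivalent tuples.
\<close>

locale indiscernible_system = homogeneous_structure K M \<delta>
  for K :: "('a, 'r, 'f) aec_data" and M :: "('a, 'r, 'f) fo_struct" and \<delta> :: "'a rel" +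
  fixes E :: "'a list rel" and m :: nat and A :: "'a set" and e :: "nat list \<Rightarrow> nat \<Rightarrow> 'a"
  assumes E: "equiv (tuples m (car M)) E"
    and E_inv: "\<And>f x y. f \<in> G \<Longrightarrow> (\<And>z. z \<in> A \<Longrightarrow> f z = z) \<Longrightarrow> x \<in> tuples m (car M) \<Longrightarrow>
      y \<in> tuples m (car M) \<Longrightarrow> (x, y) \<in> E \<longleftrightarrow> (map f x, map f y) \<in> E"
    and e_str: "\<And>ns. sorted_wrt (<) ns \<Longrightarrow> str (range (e ns))"
    and e_mono: "\<And>ns k. ns \<in> subs k \<Longrightarrow> range (e ns) \<subseteq> range (e [0..<k])"
    and e_indisc: "\<And>ns. sorted_wrt (<) ns \<Longrightarrow> \<exists>g\<in>G. \<forall>is\<in>subs (length ns). \<forall>j. g (e is j) = e (sel ns is) j"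
    and e_base: "A \<subseteq> range (e [])"
    and e_ineq: "\<And>i j. i < j \<Longrightarrow> (map (e [i]) [0..<m], map (e [j]) [0..<m]) \<notin> E"
begin

text \<open>Stands for a stretched index order, made of new points \<open>Inl y\<close> and a tail
  \<open>Inr n\<close> of type \<open>\<omega>\<close>, and given only through the set
  \<open>D\<close> of its finite increasing lists. A new point is labelled by the tuple it carries,
  so all index sets live in one type and Zorn's lemma applies. The clauses say that \<open>D\<close>
  is closed under sublists and directed, that the tail may be shifted, that each \<open>zs\<close>
  looks like the standard list of its length, and that the tail carries the original system.\<close>

definition system :: "('a list + nat) list set \<Rightarrow> (('a list + nat) list \<Rightarrow> nat \<Rightarrow> 'a) \<Rightarrow> bool" where
  "system D d \<longleftrightarrow>
     (\<forall>zs\<in>D. \<forall>is\<in>subs (length zs). sel zs is \<in> D) \<and>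
     (\<forall>xs\<in>D. \<forall>ys\<in>D. \<exists>zs\<in>D. \<exists>is\<in>subs (length zs). \<exists>js\<in>subs (length zs). xs = sel zs is \<and> ys = sel zs js) \<and>
     (\<forall>zs\<in>D. \<forall>u. strict_mono u \<longrightarrow> map (map_sum id u) zs \<in> D) \<and>
     (\<forall>zs\<in>D. \<exists>g\<in>G. \<forall>is\<in>subs (length zs). \<forall>j. g (e is j) = d (sel zs is) j) \<and>
     (\<forall>y. [Inl y] \<in> D \<longrightarrow> map (d [Inl y]) [0..<m] = y) \<and>
     (\<forall>ns. sorted_wrt (<) ns \<longrightarrow> map Inr ns \<in> D \<and> d (map Inr ns) = e ns)"

lemma systemD:
  assumes "system D d"
  shows sys_sel: "zs \<in> D \<Longrightarrow> is \<in> subs (length zs) \<Longrightarrow> sel zs is \<in> D"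
    and sys_dir: "xs \<in> D \<Longrightarrow> ys \<in> D \<Longrightarrow>
      \<exists>zs\<in>D. \<exists>is\<in>subs (length zs). \<exists>js\<in>subs (length zs). xs = sel zs is \<and> ys = sel zs js"
    and sys_shift: "zs \<in> D \<Longrightarrow> strict_mono u \<Longrightarrow> map (map_sum id u) zs \<in> D"
    and sys_indisc: "zs \<in> D \<Longrightarrow> \<exists>g\<in>G. \<forall>is\<in>subs (length zs). \<forall>j. g (e is j) = d (sel zs is) j"
    and sys_val: "[Inl y] \<in> D \<Longrightarrow> map (d [Inl y]) [0..<m] = y"
    and sys_base: "sorted_wrt (<) ns \<Longrightarrow> map Inr ns \<in> D" "sorted_wrt (<) ns \<Longrightarrow> d (map Inr ns) = e ns"
proof -
  note s = assms[unfolded system_def]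
  show "zs \<in> D \<Longrightarrow> is \<in> subs (length zs) \<Longrightarrow> sel zs is \<in> D" using s[THEN conjunct1] by blast
  note s = s[THEN conjunct2]
  show "xs \<in> D \<Longrightarrow> ys \<in> D \<Longrightarrow>
      \<exists>zs\<in>D. \<exists>is\<in>subs (length zs). \<exists>js\<in>subs (length zs). xs = sel zs is \<and> ys = sel zs js"
    using s[THEN conjunct1] by blast
  note s = s[THEN conjunct2]
  show "zs \<in> D \<Longrightarrow> strict_mono u \<Longrightarrow> map (map_sum id u) zs \<in> D" using s[THEN conjunct1] by blast
  note s = s[THEN conjunct2]
  show "zs \<in> D \<Longrightarrow> \<exists>g\<in>G. \<forall>is\<in>subs (length zs). \<forall>j. g (e is j) = d (sel zs is) j"
    using s[THEN conjunct1] by blast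
  note s = s[THEN conjunct2]
  show "[Inl y] \<in> D \<Longrightarrow> map (d [Inl y]) [0..<m] = y" using s[THEN conjunct1] by blast
  show "sorted_wrt (<) ns \<Longrightarrow> map Inr ns \<in> D" "sorted_wrt (<) ns \<Longrightarrow> d (map Inr ns) = e ns"
    using s[THEN conjunct2] by simp_all
qed

lemma e_car: "sorted_wrt (<) ns \<Longrightarrow> e ns j \<in> car M"
  using str_car[OF e_str, of ns] by auto

lemma sys_range:
  assumes S: "system D d" and zs: "zs \<in> D"
  shows "str (range (d zs))" "is \<in> subs (length zs) \<Longrightarrow> range (d (sel zs is)) \<subseteq> range (d zs)"
proof -
  obtain g where g: "g \<in> G" "\<And>is j. is \<in> subs (length zs) \<Longrightarrow> g (e is j) = d (sel zs is) j"
    using sys_indisc[OF S zs] by blast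
  have r: "range (d (sel zs is)) = g ` range (e is)" if "is \<in> subs (length zs)" for "is"
    using g(2)[OF that] by (auto simp: image_image)
  have r0: "range (d zs) = g ` range (e [0..<length zs])" using r[of "[0..<length zs]"] by simp
  show "str (range (d zs))" unfolding r0 by (rule str_image[OF g(1) e_str]) simp
  show "is \<in> subs (length zs) \<Longrightarrow> range (d (sel zs is)) \<subseteq> range (d zs)"
    unfolding r0 using r e_mono by blast
qed

lemma sys_car: "system D d \<Longrightarrow> zs \<in> D \<Longrightarrow> d zs j \<in> car M"
  using str_car[OF sys_range(1), of D d zs] by auto

text \<open>The parameter \<open>u\<close> covers both the whole system, with \<open>u\<close> the
  identity, and its image under the shift of the tail.\<close>

lemma sys_union_str:
  assumes S: "system D d" and u: "\<And>zs. zs \<in> D \<Longrightarrow> map u zs \<in> D"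
  shows "str (\<Union>zs\<in>D. range (d (map u zs)))"
proof (rule directed_union_str)
  show "(\<lambda>zs. range (d (map u zs))) ` D \<noteq> {}" using sys_base(1)[OF S, of "[]"] by auto
  show "str X" if "X \<in> (\<lambda>zs. range (d (map u zs))) ` D" for X
    using that sys_range(1)[OF S u] by auto
  fix X Y assume "X \<in> (\<lambda>zs. range (d (map u zs))) ` D" "Y \<in> (\<lambda>zs. range (d (map u zs))) ` D"
  then obtain xs ys where xy: "xs \<in> D" "X = range (d (map u xs))" "ys \<in> D" "Y = range (d (map u ys))" by blast
  obtain zs "is" js where z: "zs \<in> D" "is \<in> subs (length zs)" "js \<in> subs (length zs)" "xs = sel zs is" "ys = sel zs js"
    using sys_dir[OF S xy(1,3)] by blast
  have "X \<subseteq> range (d (map u zs))" "Y \<subseteq> range (d (map u zs))"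
    using sys_range(2)[OF S u[OF z(1)], of "is"] sys_range(2)[OF S u[OF z(1)], of js] z xy by (auto simp: sel_map)
  then show "\<exists>V\<in>(\<lambda>zs. range (d (map u zs))) ` D. X \<union> Y \<subseteq> V" using z(1) by blast
qed

lemma sys_common:
  assumes S: "system D d" and "finite P" and "P \<subseteq> D"
  shows "\<exists>zs\<in>D. \<forall>xs\<in>P. \<exists>is\<in>subs (length zs). xs = sel zs is"
  using assms(2,3)
proof (induction P)
  case empty
  then show ?case using sys_base(1)[OF S, of "[]"] by auto
next
  case (insert x P)
  then obtain zs where zs: "zs \<in> D" "\<forall>xs\<in>P. \<exists>is\<in>subs (length zs). xs = sel zs is" by auto
  obtain ws "is" js where w: "ws \<in> D" "is \<in> subs (length ws)" "js \<in> subs (length ws)" "x = sel ws is" "zs = sel ws js"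
    using sys_dir[OF S _ zs(1), of x] insert.prems by blast
  have "\<exists>is\<in>subs (length ws). xs = sel ws is" if P: "xs \<in> P" for xs
  proof -
    obtain ks where ks: "ks \<in> subs (length js)" "xs = sel zs ks" using zs(2) P w(5) by auto
    then have "xs = sel ws (sel js ks)" using w(5) by (simp add: sel_sel)
    then show ?thesis using subs_sel[OF ks(1) w(3)] by blast
  qed
  then show ?case using w by blast
qed

text \<open>A list containing all of \<open>P\<close> and its shift are images of the same finite
  piece of \<open>e\<close> under automorphisms; one of them composed with the inverse of the other
  is the shift on that piece.\<close>

lemma sys_shift_auto:
  assumes S: "system D d" and u: "strict_mono u" and "finite P" and P: "P \<subseteq> D"
  shows "\<exists>g\<in>G. \<forall>xs\<in>P. \<forall>j. g (d xs j) = d (map (map_sum id u) xs) j"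
proof -
  obtain zs where zs: "zs \<in> D" "\<And>xs. xs \<in> P \<Longrightarrow> \<exists>is\<in>subs (length zs). xs = sel zs is"
    using sys_common[OF S assms(3,4)] by blast
  obtain g where g: "g \<in> G" "\<And>is j. is \<in> subs (length zs) \<Longrightarrow> g (e is j) = d (sel zs is) j"
    using sys_indisc[OF S zs(1)] by blast
  obtain h where h: "h \<in> G" "\<And>is j. is \<in> subs (length zs) \<Longrightarrow> h (e is j) = d (map (map_sum id u) (sel zs is)) j"
    using sys_indisc[OF S sys_shift[OF S zs(1) u]] by (auto simp: sel_map)
  obtain g' where g': "g' \<in> G" "\<And>x. x \<in> car M \<Longrightarrow> g' (g x) = x" "\<And>x. x \<in> car M \<Longrightarrow> g (g' x) = x"
    using Aut_inv[OF g(1)] by blast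
  have "h (g' (d xs j)) = d (map (map_sum id u) xs) j" if P: "xs \<in> P" for xs j
  proof -
    obtain "is" where i: "is \<in> subs (length zs)" "xs = sel zs is" using zs(2)[OF P] by blast
    then have "e is j \<in> car M" by (intro e_car) (auto simp: subs_def)
    then show ?thesis using g(2)[OF i(1), of j] h(2)[OF i(1), of j] g'(2) i(2) by metis
  qed
  then show ?thesis using Aut_comp[OF h(1) g'(1)] by (intro bexI[of _ "\<lambda>x. h (g' x)"]) simp_all
qed

text \<open>Any two points occur at different positions of a common list, where they can be compared
  with the original sequence; the comparing automorphism fixes \<open>A\<close> because it fixes the
  values of \<open>e []\<close>.\<close>

lemma sys_ineq:
  assumes S: "system D d" and x: "[x] \<in> D" "[y] \<in> D" and "x \<noteq> y"
  shows "(map (d [x]) [0..<m], map (d [y]) [0..<m]) \<notin> E"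
proof -
  obtain zs "is" js where z: "zs \<in> D" "is \<in> subs (length zs)" "js \<in> subs (length zs)" "[x] = sel zs is" "[y] = sel zs js"
    using sys_dir[OF S x] by blast
  obtain p q where pq: "is = [p]" "js = [q]" using z(4,5) by (auto simp: sel_def Cons_eq_map_conv)
  have l: "p < length zs" "q < length zs" using z(2,3) by (auto simp: pq)
  obtain g where g: "g \<in> G" "\<And>is j. is \<in> subs (length zs) \<Longrightarrow> g (e is j) = d (sel zs is) j"
    using sys_indisc[OF S z(1)] by blast
  have "g (e [] j) = e [] j" for j using g(2)[of "[]" j] sys_base(2)[OF S, of "[]"] by simp
  then have gA: "g z = z" if "z \<in> A" for z using e_base that by auto
  have t: "map (e [i]) [0..<m] \<in> tuples m (car M)" for i by (auto simp: tuples_iff e_car)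
  have dx: "map (d [x]) [0..<m] = map g (map (e [p]) [0..<m])"
    using g(2)[of "[p]"] l z(4) pq by simp
  have dy: "map (d [y]) [0..<m] = map g (map (e [q]) [0..<m])"
    using g(2)[of "[q]"] l z(5) pq by simp
  have "p \<noteq> q" using z(4,5) pq assms(4) by auto
  then have "(map (e [p]) [0..<m], map (e [q]) [0..<m]) \<notin> E"
    using e_ineq[of p q] e_ineq[of q p] E by (metis equivE linorder_neqE_nat symE)
  then show ?thesis using E_inv[OF g(1) gA t t, of p q] dx dy by metis
qed

text \<open>
  The tail \<open>\<omega>\<close> of the index set is what allows a new point: the shift of the tail embeds the system
  into itself and misses the first point of the tail; the inverse of the shift places this point
  between the old points and the tail.
\<close>

lemma sys_extend:
  assumes S: "system D d" and small: "|\<Union>zs\<in>D. range (d zs)| <o \<delta>"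
  shows "\<exists>D' d' y. system D' d' \<and> D \<subseteq> D' \<and> (\<forall>zs\<in>D. d' zs = d zs) \<and> [Inl y] \<in> D' - D"
proof -
  define \<sigma> :: "'a list + nat \<Rightarrow> 'a list + nat" where "\<sigma> = map_sum id Suc"
  have mono: "strict_mono Suc" by (simp add: strict_mono_def)
  have sh: "map \<sigma> zs \<in> D" if "zs \<in> D" for zs using sys_shift[OF S that mono] by (simp add: \<sigma>_def)
  define U where "U = (\<Union>zs\<in>D. range (d zs))"
  have wd: "d (map \<sigma> zs) j = d (map \<sigma> zs') j'" if "zs \<in> D" "zs' \<in> D" "d zs j = d zs' j'" for zs zs' j j'
    using sys_shift_auto[OF S mono, of "{zs, zs'}"] that unfolding \<sigma>_def
    by (metis empty_subsetI finite.emptyI finite.insertI insertCI insert_subset)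
  \<comment> \<open>The shift of the tail as a map on elements; \<open>wd\<close> makes it
    independent of the list through which an element is named.\<close>
  define h where "h x = (THE z. \<exists>zs\<in>D. \<exists>j. x = d zs j \<and> z = d (map \<sigma> zs) j)" for x
  have h: "h (d zs j) = d (map \<sigma> zs) j" if "zs \<in> D" for zs j
    unfolding h_def
  proof (rule the_equality)
    show "\<exists>zs'\<in>D. \<exists>j'. d zs j = d zs' j' \<and> d (map \<sigma> zs) j = d (map \<sigma> zs') j'" using that by blast
    show "z = d (map \<sigma> zs) j" if "\<exists>zs'\<in>D. \<exists>j'. d zs j = d zs' j' \<and> z = d (map \<sigma> zs') j'" for z
      using that wd \<open>zs \<in> D\<close> by metis
  qed
  have hU: "h ` U = (\<Union>zs\<in>D. range (d (map \<sigma> zs)))"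
    using h by (auto simp: U_def image_UN image_image)
  \<comment> \<open>Smallness of the system enters here: model homogeneity turns the shift into an
    automorphism.\<close>
  obtain s where s: "s \<in> G" "\<And>x. x \<in> U \<Longrightarrow> s x = h x"
  proof (rule homogeneous_local[of U h])
    show "str U" unfolding U_def using sys_union_str[OF S, of id] by simp
    show "str (h ` U)" unfolding hU by (rule sys_union_str[OF S sh])
    show "|U| <o \<delta>" using small by (simp add: U_def)
    show "\<exists>g\<in>G. map g xs = map h xs" if xs: "xs \<in> lists U" for xs
    proof -
      have "\<exists>zs\<in>D. \<exists>j. x = d zs j" if "x \<in> set xs" for x
      proof -
        have "x \<in> U" using xs that by auto
        then show ?thesis by (auto simp: U_def)
      qed
      then obtain f where f: "\<And>x. x \<in> set xs \<Longrightarrow> f x \<in> D \<and> (\<exists>j. x = d (f x) j)" by metis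
      obtain g where "g \<in> G" "\<forall>zs\<in>f ` set xs. \<forall>j. g (d zs j) = d (map \<sigma> zs) j"
        using sys_shift_auto[OF S mono, of "f ` set xs"] f unfolding \<sigma>_def by blast
      then show ?thesis using f h by (intro bexI[of _ g]) (auto, metis)
    qed
  qed blast
  have sd: "s (d zs j) = d (map \<sigma> zs) j" if "zs \<in> D" for zs j
    using s(2)[of "d zs j"] h[OF that] that by (auto simp: U_def)
  obtain t where t: "t \<in> G" "\<And>x. x \<in> car M \<Longrightarrow> t (s x) = x" "\<And>x. x \<in> car M \<Longrightarrow> s (t x) = x"
    using Aut_inv[OF s(1)] by blast
  have td: "t (d (map \<sigma> zs) j) = d zs j" if "zs \<in> D" for zs j
    using sd[OF that, of j] t(2)[OF sys_car[OF S that, of j]] by simp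
  have base0: "[Inr 0] \<in> D" using sys_base(1)[OF S, of "[0]"] by simp
  \<comment> \<open>The shifted tail starts at \<open>Inr 1\<close>, so undoing the shift by
    \<open>t\<close> leaves room for one point, the preimage of the point at
    \<open>Inr 0\<close>.\<close>
  define y where "y = map t (map (d [Inr 0]) [0..<m])"
  \<comment> \<open>Old labels are fixed by the shift, so a label \<open>y\<close> already present
    would carry the same tuple as \<open>Inr 0\<close>, against \<open>sys_ineq\<close>.\<close>
  have yD: "[Inl y] \<notin> D"
  proof
    assume y: "[Inl y] \<in> D"
    have "map s y = map (d [Inr 0]) [0..<m]"
      using t(3)[OF sys_car[OF S base0]] by (simp add: y_def)
    moreover have "map s (map (d [Inl y]) [0..<m]) = map (d [Inl y]) [0..<m]"
      using sd[OF y] by (simp add: \<sigma>_def)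
    then have "map s y = y" using sys_val[OF S y] by metis
    ultimately have "map (d [Inl y]) [0..<m] = map (d [Inr 0]) [0..<m]" using sys_val[OF S y] by simp
    moreover have "map (d [Inr 0]) [0..<m] \<in> tuples m (car M)"
      using sys_car[OF S base0] by (auto simp: tuples_iff)
    then have "(map (d [Inr 0]) [0..<m], map (d [Inr 0]) [0..<m]) \<in> E"
      using E by (meson equivE refl_onD)
    ultimately show False using sys_ineq[OF S y base0] by (metis sum.distinct(1))
  qed
  \<comment> \<open>Reads a list of the extended order as one of the old order: the new point
    becomes the start of the tail, and the tail moves up by one.\<close>
  define \<theta> :: "'a list + nat \<Rightarrow> 'a list + nat" where
    "\<theta> = case_sum (\<lambda>z. if z = y then Inr 0 else Inl z) (\<lambda>n. Inr (Suc n))"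
  have inj: "inj \<theta>" by (auto simp: \<theta>_def inj_on_def split: sum.splits if_splits)
  have elt: "[x] \<in> D" if "zs \<in> D" "x \<in> set zs" for zs x
    using that sys_sel[OF S that(1)] by (metis in_set_conv_nth sel_simps(1,2) subs_single)
  have \<theta>\<sigma>: "map \<theta> zs = map \<sigma> zs" if "zs \<in> D" for zs
  proof (rule map_cong[OF refl])
    fix x assume "x \<in> set zs"
    then have "x \<noteq> Inl y" using elt[OF that] yD by blast
    then show "\<theta> x = \<sigma> x" by (auto simp: \<theta>_def \<sigma>_def split: sum.splits)
  qed
  define D' where "D' = {zs. map \<theta> zs \<in> D}"
  define d' where "d' zs j = t (d (map \<theta> zs) j)" for zs j
  have DD': "D \<subseteq> D'" using sh \<theta>\<sigma> unfolding D'_def by (metis mem_Collect_eq subsetI)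
  have dd': "d' zs = d zs" if "zs \<in> D" for zs
    using td[OF that] \<theta>\<sigma>[OF that] by (simp add: d'_def fun_eq_iff del: map_eq_conv)
  have "system D' d'"
    unfolding system_def
  proof (intro conjI ballI allI impI)
    show "sel zs is \<in> D'" if "zs \<in> D'" "is \<in> subs (length zs)" for zs "is"
      using that sys_sel[OF S, of "map \<theta> zs" "is"] by (auto simp: D'_def sel_map)
    show "\<exists>zs\<in>D'. \<exists>is\<in>subs (length zs). \<exists>js\<in>subs (length zs). xs = sel zs is \<and> ys = sel zs js"
      if xy: "xs \<in> D'" "ys \<in> D'" for xs ys
    proof -
      obtain zs "is" js where z: "zs \<in> D" "is \<in> subs (length zs)" "js \<in> subs (length zs)"
          "map \<theta> xs = sel zs is" "map \<theta> ys = sel zs js"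
        using sys_dir[OF S, of "map \<theta> xs" "map \<theta> ys"] xy by (auto simp: D'_def)
      have "\<exists>x'. x = \<theta> x'" if x: "x \<in> set zs" for x
      proof (cases x)
        case (Inl w)
        then have "w \<noteq> y" using elt[OF z(1) x] yD by auto
        then show ?thesis using Inl by (intro exI[of _ "Inl w"]) (simp add: \<theta>_def)
      next
        case (Inr n)
        show ?thesis
        proof (cases n)
          case 0
          then show ?thesis using Inr by (intro exI[of _ "Inl y"]) (simp add: \<theta>_def)
        next
          case (Suc k)
          then show ?thesis using Inr by (intro exI[of _ "Inr k"]) (simp add: \<theta>_def)
        qed
      qed
      then obtain zs' where zs': "zs = map \<theta> zs'" using ex_map_conv[of zs \<theta>] by blast
      have "map \<theta> xs = map \<theta> (sel zs' is)" "map \<theta> ys = map \<theta> (sel zs' js)"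
        using z by (simp_all add: zs' sel_map)
      then have "xs = sel zs' is" "ys = sel zs' js" using inj by (simp_all add: inj_map_eq_map)
      then show ?thesis using z by (intro bexI[of _ zs'] bexI[of _ "is"] bexI[of _ js]) (auto simp: D'_def zs')
    qed
    show "map (map_sum id u) zs \<in> D'" if "zs \<in> D'" "strict_mono u" for zs and u :: "nat \<Rightarrow> nat"
    proof -
      \<comment> \<open>A shift of the new tail is read as a shift of the old tail that keeps
        \<open>0\<close>, the place of the new point.\<close>
      define u' where "u' = case_nat 0 (\<lambda>n. Suc (u n))"
      have "strict_mono u'"
        using that(2) unfolding strict_mono_def u'_def by (auto split: nat.splits)
      moreover have "map \<theta> zs \<in> D" using that(1) unfolding D'_def by blast
      ultimately have "map (map_sum id u') (map \<theta> zs) \<in> D" using sys_shift[OF S] by blast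
      moreover have "\<theta> (map_sum id u x) = map_sum id u' (\<theta> x)" for x
        by (auto simp: \<theta>_def u'_def split: sum.splits)
      ultimately show ?thesis by (simp add: D'_def comp_def)
    qed
    show "\<exists>g\<in>G. \<forall>is\<in>subs (length zs). \<forall>j. g (e is j) = d' (sel zs is) j" if zs: "zs \<in> D'" for zs
    proof -
      have "map \<theta> zs \<in> D" using zs unfolding D'_def by blast
      then obtain g where g: "g \<in> G" "\<And>is j. is \<in> subs (length zs) \<Longrightarrow> g (e is j) = d (map \<theta> (sel zs is)) j"
        using sys_indisc[OF S, of "map \<theta> zs"] by (auto simp: sel_map simp del: map_map)
      then show ?thesis using Aut_comp[OF t(1) g(1)] by (intro bexI[of _ "\<lambda>x. t (g x)"]) (auto simp: d'_def)
    qed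
    show "map (d' [Inl z]) [0..<m] = z" if "[Inl z] \<in> D'" for z
    proof (cases "z = y")
      case True
      then show ?thesis by (auto simp: d'_def \<theta>_def y_def)
    next
      case False
      then have "[Inl z] \<in> D" using that by (simp add: D'_def \<theta>_def)
      then show ?thesis using dd' sys_val[OF S] by simp
    qed
    show "map Inr ns \<in> D'" "d' (map Inr ns) = e ns" if "sorted_wrt (<) ns" for ns
      using sys_base[OF S that] DD' dd' by auto
  qed
  moreover have "[Inl y] \<in> D'" using base0 by (simp add: D'_def \<theta>_def)
  ultimately show ?thesis using DD' dd' yD by blast
qed

text \<open>Zorn's lemma on systems ordered by extension. With few classes the labels of a maximal
  system would be few, being pairwise inequivalent tuples; then all its elements would form a small
  set and \<open>sys_extend\<close> would enlarge it.\<close>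

lemma many_classes: "\<not> |tuples m (car M) // E| <o \<delta>"
proof
  assume few: "|tuples m (car M) // E| <o \<delta>"
  \<comment> \<open>Systems become sets of pairs, so that extension of systems is inclusion.\<close>
  define graph where "graph D d = {(zs, d zs) |zs. zs \<in> D}"
    for D :: "('a list + nat) list set" and d :: "('a list + nat) list \<Rightarrow> nat \<Rightarrow> 'a"
  define \<A> where "\<A> = {graph D d |D d. system D d}"
  have gr: "(zs, \<phi>) \<in> graph D d \<longleftrightarrow> zs \<in> D \<and> \<phi> = d zs" for zs \<phi> D d by (auto simp: graph_def)
  have "graph (map Inr ` {ns. sorted_wrt (<) ns}) (\<lambda>zs. e (map (case_sum (\<lambda>_. 0) id) zs)) \<in> \<A>"
  proof -
    let ?D = "map Inr ` {ns. sorted_wrt (<) ns} :: ('a list + nat) list set"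
    let ?d = "\<lambda>zs. e (map (case_sum (\<lambda>_. 0) id) zs)"
    have d: "?d (map Inr ns) = e ns" for ns by (simp add: comp_def)
    have "system ?D ?d"
      unfolding system_def
    proof (intro conjI ballI allI impI)
      show "sel zs is \<in> ?D" if "zs \<in> ?D" "is \<in> subs (length zs)" for zs "is"
        using that by (auto simp: sel_map sorted_sel)
      show "\<exists>zs\<in>?D. \<exists>is\<in>subs (length zs). \<exists>js\<in>subs (length zs). xs = sel zs is \<and> ys = sel zs js"
        if xy: "xs \<in> ?D" "ys \<in> ?D" for xs ys
      proof -
        obtain ns ms where nm: "xs = map Inr ns" "sorted_wrt (<) ns" "ys = map Inr ms" "sorted_wrt (<) ms"
          using xy by auto
        define k where "k = Suc (sum_list ns + sum_list ms)"
        have "x < k" if "x \<in> set ns \<union> set ms" for x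
          using that member_le_sum_list[of x ns] member_le_sum_list[of x ms] by (auto simp: k_def)
        then have "ns \<in> subs k" "ms \<in> subs k" using nm by (auto simp: subs_def)
        then show ?thesis using nm
          by (intro bexI[of _ "map Inr [0..<k]"] bexI[of _ ns] bexI[of _ ms]) (auto simp: sel_map sel_idx)
      qed
      show "map (map_sum id u) zs \<in> ?D" if z: "zs \<in> ?D" "strict_mono u" for zs and u :: "nat \<Rightarrow> nat"
      proof -
        obtain ns where ns: "zs = map Inr ns" "sorted_wrt (<) ns" using z by auto
        have "sorted_wrt (<) (map u ns)"
          using ns(2) z(2) by (simp add: sorted_wrt_map strict_mono_less)
        then show ?thesis using ns(1) by (intro image_eqI[of _ _ "map u ns"]) auto
      qed
      show "\<exists>g\<in>G. \<forall>is\<in>subs (length zs). \<forall>j. g (e is j) = ?d (sel zs is) j" if z: "zs \<in> ?D" for zs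
      proof -
        obtain ns where ns: "zs = map Inr ns" "sorted_wrt (<) ns" using z by auto
        then show ?thesis using e_indisc[OF ns(2)] by (auto simp: sel_map comp_def)
      qed
      show "map Inr ns \<in> ?D" "?d (map Inr ns) = e ns" if "sorted_wrt (<) ns" for ns
        using that d by auto
    qed auto
    then show ?thesis by (auto simp: \<A>_def)
  qed
  then have "\<A> \<noteq> {}" by blast
  moreover have "\<Union>\<C> \<in> \<A>" if \<C>0: "\<C> \<noteq> {}" and ch: "subset.chain \<A> \<C>" for \<C>
  proof -
    have sub: "\<C> \<subseteq> \<A>" and lin: "\<And>X Y. X \<in> \<C> \<Longrightarrow> Y \<in> \<C> \<Longrightarrow> X \<subseteq> Y \<or> Y \<subseteq> X"
      using ch by (auto simp: subset_chain_def)
    define D where "D = Domain (\<Union>\<C>)"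
    define d where "d zs = (THE \<phi>. (zs, \<phi>) \<in> \<Union>\<C>)" for zs
    have uniq: "\<phi> = \<psi>" if z: "(zs, \<phi>) \<in> \<Union>\<C>" "(zs, \<psi>) \<in> \<Union>\<C>" for zs \<phi> \<psi>
    proof -
      obtain X Y where X: "X \<in> \<C>" "Y \<in> \<C>" "(zs, \<phi>) \<in> X" "(zs, \<psi>) \<in> Y" using z by blast
      then obtain Z where "Z \<in> \<C>" "(zs, \<phi>) \<in> Z" "(zs, \<psi>) \<in> Z" using lin by blast
      then show ?thesis using sub by (auto simp: \<A>_def gr)
    qed
    have deq: "d zs = \<phi>" if "(zs, \<phi>) \<in> \<Union>\<C>" for zs \<phi>
      unfolding d_def using that uniq by (intro the_equality) auto
    have UC: "\<Union>\<C> = graph D d"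
    proof (rule set_eqI)
      fix p :: "('a list + nat) list \<times> (nat \<Rightarrow> 'a)"
      obtain zs \<phi> where p: "p = (zs, \<phi>)" using prod.exhaust by blast
      show "p \<in> \<Union>\<C> \<longleftrightarrow> p \<in> graph D d"
        unfolding p gr D_def using deq by (metis DomainE DomainI)
    qed
    have sys: "\<exists>D' d'. system D' d' \<and> xs \<in> D' \<and> ys \<in> D' \<and> D' \<subseteq> D \<and> (\<forall>zs\<in>D'. d zs = d' zs)"
      if xy: "xs \<in> D" "ys \<in> D" for xs ys
    proof -
      obtain X Y where X: "X \<in> \<C>" "Y \<in> \<C>" "xs \<in> Domain X" "ys \<in> Domain Y"
        using xy unfolding D_def by blast
      then obtain Z where Z: "Z \<in> \<C>" "xs \<in> Domain Z" "ys \<in> Domain Z" using lin[OF X(1,2)] by blast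
      obtain D' d' where D': "Z = graph D' d'" "system D' d'" using Z(1) sub by (auto simp: \<A>_def)
      have "zs \<in> D \<and> d zs = d' zs" if "zs \<in> D'" for zs
      proof -
        have "(zs, d' zs) \<in> \<Union>\<C>" using that D'(1) Z(1) gr by blast
        then show ?thesis using deq by (auto simp: D_def)
      qed
      then show ?thesis using D' Z(2,3) by (intro exI[of _ D'] exI[of _ d']) (auto simp: gr)
    qed
    have ne: "[] \<in> D"
    proof -
      obtain X where "X \<in> \<C>" using \<C>0 by blast
      then obtain D' d' where "graph D' d' \<in> \<C>" "system D' d'" using sub by (auto simp: \<A>_def)
      then show ?thesis using sys_base(1)[of D' d' "[]"] gr[of "[]" "d' []" D' d'] by (auto simp: D_def)
    qed
    have "system D d"
      unfolding system_def
    proof (intro conjI ballI allI impI)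
      show "sel zs is \<in> D" if z: "zs \<in> D" "is \<in> subs (length zs)" for zs "is"
        using sys[OF z(1) z(1)] sys_sel z(2) by blast
      show "\<exists>zs\<in>D. \<exists>is\<in>subs (length zs). \<exists>js\<in>subs (length zs). xs = sel zs is \<and> ys = sel zs js"
        if xy: "xs \<in> D" "ys \<in> D" for xs ys
        using sys[OF xy] sys_dir[of _ _ xs ys] by (meson subsetD)
      show "map (map_sum id u) zs \<in> D" if z: "zs \<in> D" "strict_mono u" for zs and u :: "nat \<Rightarrow> nat"
        using sys[OF z(1) z(1)] sys_shift[OF _ _ z(2)] by blast
      show "\<exists>g\<in>G. \<forall>is\<in>subs (length zs). \<forall>j. g (e is j) = d (sel zs is) j" if z: "zs \<in> D" for zs
      proof -
        obtain D' d' where D': "system D' d'" "zs \<in> D'" "\<forall>zs\<in>D'. d zs = d' zs" using sys[OF z z] by blast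
        then show ?thesis using sys_indisc[OF D'(1,2)] sys_sel[OF D'(1,2)] by metis
      qed
      show "map (d [Inl y]) [0..<m] = y" if z: "[Inl y] \<in> D" for y
        using sys[OF z z] sys_val by metis
      show "map Inr ns \<in> D" "d (map Inr ns) = e ns" if "sorted_wrt (<) ns" for ns
        using sys[OF ne ne] sys_base[OF _ that] by (auto dest: subsetD)
    qed
    then show ?thesis using UC by (auto simp: \<A>_def)
  qed
  ultimately obtain \<Gamma> where \<Gamma>: "\<Gamma> \<in> \<A>" "\<And>X. X \<in> \<A> \<Longrightarrow> \<Gamma> \<subseteq> X \<Longrightarrow> X = \<Gamma>"
    using subset_Zorn_nonempty[of \<A>] by metis
  then obtain D d where D: "\<Gamma> = graph D d" "system D d" by (auto simp: \<A>_def)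
  define J where "J = {y. [Inl y] \<in> D}"
  have Jt: "y \<in> tuples m (car M)" if "y \<in> J" for y
  proof -
    have "y = map (d [Inl y]) [0..<m]" using sys_val[OF D(2)] that by (simp add: J_def)
    moreover have "map (d [Inl y]) [0..<m] \<in> tuples m (car M)"
      using sys_car[OF D(2)] that by (auto simp: tuples_iff J_def)
    ultimately show ?thesis by simp
  qed
  have "inj_on (\<lambda>y. E `` {y}) J"
  proof (rule inj_onI, rule ccontr)
    fix x y assume xy: "x \<in> J" "y \<in> J" "E `` {x} = E `` {y}" "x \<noteq> y"
    then have "(x, y) \<in> E" using eq_equiv_class[OF xy(3) E Jt[OF xy(2)]] by blast
    then show False using sys_ineq[OF D(2), of "Inl x" "Inl y"] xy sys_val[OF D(2)] by (simp add: J_def)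
  qed
  moreover have "(\<lambda>y. E `` {y}) ` J \<subseteq> tuples m (car M) // E" using Jt by (auto intro: quotientI)
  ultimately have J: "|J| <o \<delta>" by (rule ordLess_inj[OF few])
  define I where "I = Inl ` J \<union> range (Inr :: nat \<Rightarrow> 'a list + nat)"
  have "|I| <o \<delta>"
    unfolding I_def by (intro small_Un ordLess_image[OF J] countable_small countable_image countableI_type)
  then have "|lists I| <o \<delta>" by (rule card_of_lists_ordLess[OF card_order nat_less])
  \<comment> \<open>An element is coded by one list over \<open>I\<close>: the head
    \<open>Inr j\<close> gives the place in the enumeration and the rest is
    \<open>zs\<close>.\<close>
  moreover have "(\<Union>zs\<in>D. range (d zs)) \<subseteq> (\<lambda>l. d (tl l) (case_sum (\<lambda>_. 0) id (hd l))) ` lists I"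
  proof
    fix x assume "x \<in> (\<Union>zs\<in>D. range (d zs))"
    then obtain zs j where x: "zs \<in> D" "x = d zs j" by auto
    have "set zs \<subseteq> I"
    proof
      fix z assume z: "z \<in> set zs"
      then have "[z] \<in> D"
        using sys_sel[OF D(2) x(1)] by (metis in_set_conv_nth sel_simps(1,2) subs_single)
      then show "z \<in> I" by (cases z) (auto simp: I_def J_def)
    qed
    then have "Inr j # zs \<in> lists I" by (auto simp: I_def)
    then show "x \<in> (\<lambda>l. d (tl l) (case_sum (\<lambda>_. 0) id (hd l))) ` lists I"
      using x(2) by (intro image_eqI[of _ _ "Inr j # zs"]) auto
  qed
  ultimately have "|\<Union>zs\<in>D. range (d zs)| <o \<delta>" by (rule ordLess_subset[OF ordLess_image])
  then obtain D' d' y where D': "system D' d'" "D \<subseteq> D'" "\<forall>zs\<in>D. d' zs = d zs" "[Inl y] \<in> D' - D"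
    using sys_extend[OF D(2)] by blast
  then have "graph D' d' \<in> \<A>" "\<Gamma> \<subseteq> graph D' d'" by (auto simp: \<A>_def D(1) graph_def)
  then have "graph D' d' = \<Gamma>" using \<Gamma>(2) by blast
  then have "([Inl y], d' [Inl y]) \<in> graph D d" using D'(4) gr D(1) by blast
  then show False using D'(4) by (auto simp: gr)
qed

end

text \<open>Colourings take finite sets while systems are indexed by increasing lists; a fixed
  linear order of the type translates between the two.\<close>

lemma ex_sorting:
  "\<exists>(lt :: 'b \<Rightarrow> 'b \<Rightarrow> bool) sl. (\<forall>s. finite s \<longrightarrow> sorted_wrt lt (sl s) \<and> set (sl s) = s) \<and>
     (\<forall>xs. sorted_wrt lt xs \<longrightarrow> sl (set xs) = xs \<and> distinct xs)"
proof -
  obtain r :: "'b rel" where r: "well_order_on UNIV r" using well_order_on by blast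
  define le where "le x y \<longleftrightarrow> (x, y) \<in> r" for x y
  define lt where "lt x y \<longleftrightarrow> (x, y) \<in> r \<and> x \<noteq> y" for x y
  have r': "refl r" "trans r" "antisym r" "total r" using r by (auto simp: order_on_defs)
  interpret lo: linorder le lt
  proof
    show "lt x y \<longleftrightarrow> le x y \<and> \<not> le y x" for x y
      using antisymD[OF r'(3), of x y] refl_onD[OF r'(1), of x] by (auto simp: le_def lt_def)
    show "le x x" for x using refl_onD[OF r'(1)] by (simp add: le_def)
    show "le x z" if "le x y" "le y z" for x y z using that transD[OF r'(2)] by (auto simp: le_def)
    show "x = y" if "le x y" "le y x" for x y using that antisymD[OF r'(3)] by (simp add: le_def)
    show "le x y \<or> le y x" for x y
      using r'(4) refl_onD[OF r'(1), of x] unfolding total_on_def le_def by (metis UNIV_I)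
  qed
  show ?thesis
  proof (intro exI conjI allI impI)
    show "sorted_wrt lt (lo.sorted_list_of_set s)" "set (lo.sorted_list_of_set s) = s" if "finite s" for s
      using that by simp_all
    fix xs :: "'b list" assume xs: "sorted_wrt lt xs"
    then show "lo.sorted_list_of_set (set xs) = xs"
      by (intro lo.strict_sorted_equal) simp_all
    show "distinct xs" using xs by (simp add: lo.strict_sorted_iff)
  qed
qed

lemma map_map_upt_eq: "map g (map \<phi> [0..<n]) = map \<psi> [0..<n] \<longleftrightarrow> (\<forall>j<n. g (\<phi> j) = \<psi> j)"
  by (auto simp: list_eq_iff_nth_eq)

section \<open>The Hanf number of invariant equivalence relations\<close>

context homogeneous_structure
begin

text \<open>An enumeration may repeat points, so the map is defined by choosing indices; agreement
  on a prefix that contains two competing indices shows that the choice does not matter.\<close>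

lemma enumeration_extend:
  assumes \<phi>: "str (range \<phi>)" and \<psi>: "str (range \<psi>)"
    and loc: "\<And>n. \<exists>g\<in>G. map g (map \<phi> [0..<n]) = map \<psi> [0..<n]"
  shows "\<exists>g\<in>G. \<forall>j :: nat. g (\<phi> j) = \<psi> j"
proof -
  have loc': "\<exists>g\<in>G. \<forall>j<n. g (\<phi> j) = \<psi> j" for n using loc[of n] unfolding map_map_upt_eq .
  define h where "h x = \<psi> (SOME j. \<phi> j = x)" for x
  have h: "h (\<phi> j) = \<psi> j" for j
  proof -
    define i where "i = (SOME i. \<phi> i = \<phi> j)"
    have "\<phi> i = \<phi> j" unfolding i_def by (rule someI) simp
    moreover obtain g where "\<forall>k<Suc (max i j). g (\<phi> k) = \<psi> k" using loc' by blast
    then have "g (\<phi> i) = \<psi> i" "g (\<phi> j) = \<psi> j" by simp_all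
    ultimately show ?thesis by (simp add: h_def i_def)
  qed
  have im: "h ` range \<phi> = range \<psi>" using h by (simp add: image_image)
  have "\<exists>g\<in>G. map g xs = map h xs" if "xs \<in> lists (range \<phi>)" for xs
  proof -
    have "\<exists>ns. xs = map \<phi> ns" using that by (metis ex_map_conv in_lists_conv_set rangeE)
    then obtain ns where ns: "xs = map \<phi> ns" by blast
    obtain g where g: "g \<in> G" "\<forall>k<Suc (sum_list ns). g (\<phi> k) = \<psi> k" using loc' by blast
    have "n < Suc (sum_list ns)" if "n \<in> set ns" for n using member_le_sum_list[of n ns] that by simp
    then show ?thesis using g h by (intro bexI[of _ g]) (auto simp: ns)
  qed
  moreover have "countable (range \<phi>)" by simp
  ultimately obtain g where "g \<in> G" "\<And>x. x \<in> range \<phi> \<Longrightarrow> g x = h x"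
    using homogeneous_local[OF \<phi> _ countable_small] \<psi> im by metis
  then show ?thesis using h by (metis rangeI)
qed

text \<open>
  Below an inaccessible the Erdos-Rado theorem provides, for all lengths at once, sequences along
  which the isomorphism type of a monotone system of countable substructures depends only on the
  length; gluing finite such sequences gives an indiscernible system.
\<close>

theorem hanf_number:
  fixes \<kappa> :: "'a rel"
  assumes \<kappa>: "inaccessible \<kappa>" and ne: "car M \<noteq> {}"
    and T: "countable T" "\<And>l. l \<in> lists (car M) \<Longrightarrow> \<exists>l'\<in>T. \<exists>g\<in>G. map g l = l'"
    and E: "equiv (tuples m (car M)) E" and A: "finite A" "A \<subseteq> car M"
    and E_inv: "\<And>f x y. f \<in> G \<Longrightarrow> (\<And>z. z \<in> A \<Longrightarrow> f z = z) \<Longrightarrow> x \<in> tuples m (car M) \<Longrightarrow>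
      y \<in> tuples m (car M) \<Longrightarrow> (x, y) \<in> E \<longleftrightarrow> (map f x, map f y) \<in> E"
    and few: "|tuples m (car M) // E| <o \<delta>"
  shows "|tuples m (car M) // E| <o \<kappa>"
proof (rule ccontr)
  assume many: "\<not> |tuples m (car M) // E| <o \<kappa>"
  interpret inaccessible_cardinal \<kappa> by standard (rule \<kappa>)
  define Y where "Y = (\<lambda>c. SOME x. x \<in> c) ` (tuples m (car M) // E)"
  have some: "(SOME x. x \<in> c) \<in> c" if "c \<in> tuples m (car M) // E" for c
    using in_quotient_imp_non_empty[OF E that] by (meson ex_in_conv someI_ex)
  have Yt: "Y \<subseteq> tuples m (car M)"
    using some in_quotient_imp_subset[OF E] by (auto simp: Y_def)
  have YE: "(x, y) \<notin> E" if xy: "x \<in> Y" "y \<in> Y" "x \<noteq> y" for x y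
  proof
    assume e: "(x, y) \<in> E"
    obtain c c' where c: "c \<in> tuples m (car M) // E" "x = (SOME x. x \<in> c)"
        "c' \<in> tuples m (car M) // E" "y = (SOME x. x \<in> c')" using xy by (auto simp: Y_def)
    then have "c = c'" using quotient_eq_iff[OF E c(1,3), of x y] some[of c] some[of c'] e by auto
    then show False using c xy(3) by simp
  qed
  have Ybig: "\<not> |Y| <o \<kappa>"
  proof
    assume "|Y| <o \<kappa>"
    moreover have "inj_on (\<lambda>c. SOME x. x \<in> c) (tuples m (car M) // E)"
      by (rule inj_onI) (metis quotient_disj[OF E] some disjoint_iff)
    ultimately have "|tuples m (car M) // E| <o \<kappa>" by (rule ordLess_inj) (simp add: Y_def)
    then show False using many by blast
  qed
  obtain lt :: "'a list \<Rightarrow> 'a list \<Rightarrow> bool" and sl where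
    sl: "\<And>s. finite s \<Longrightarrow> sorted_wrt lt (sl s)" "\<And>s. finite s \<Longrightarrow> set (sl s) = s"
    and lt: "\<And>xs. sorted_wrt lt xs \<Longrightarrow> sl (set xs) = xs" "\<And>xs. sorted_wrt lt xs \<Longrightarrow> distinct xs"
    using ex_sorting by metis

  obtain p where p: "p \<in> car M" using ne by blast
  \<comment> \<open>Every substructure is to contain \<open>A\<close>, so that the automorphisms
    obtained later fix \<open>A\<close>, and a point \<open>p\<close>, so that it is nonempty and
    can be enumerated.\<close>
  define \<S> where "\<S> = {S. str S \<and> countable S \<and> insert p A \<subseteq> S}"
  have LS': "\<exists>S\<in>\<S>. X \<subseteq> S" if X: "X \<subseteq> car M" "countable X" for X
  proof -
    have "countable (X \<union> insert p A)" using X A by (simp add: countable_finite)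
    moreover have "X \<union> insert p A \<subseteq> car M" using X A p by auto
    ultimately obtain S where "str S" "X \<union> insert p A \<subseteq> S" "countable S"
      using LS_countable[OF str_M] by metis
    then show ?thesis by (auto simp: \<S>_def)
  qed
  define b where "b y = (SOME S. S \<in> \<S> \<and> set y \<subseteq> S)" for y
  have b: "b y \<in> \<S> \<and> set y \<subseteq> b y" if "y \<in> Y" for y
  proof -
    have "set y \<subseteq> car M" using subsetD[OF Yt that] by (simp add: tuples_iff)
    then have "\<exists>S. S \<in> \<S> \<and> set y \<subseteq> S" using LS'[of "set y"] by (auto simp: countable_finite)
    then show ?thesis unfolding b_def by (rule someI_ex)
  qed
  have dir: "\<exists>V\<in>\<S>. S \<union> S' \<subseteq> V" if "S \<in> \<S>" "S' \<in> \<S>" for S S'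
    using that str_car by (intro LS') (auto simp: \<S>_def)
  have "\<S> \<noteq> {}" using LS'[of "{}"] by auto
  then obtain N where N: "\<And>F. finite F \<Longrightarrow> N F \<in> \<S>" "\<And>F y. finite F \<Longrightarrow> y \<in> F \<Longrightarrow> b y \<in> \<S> \<Longrightarrow> b y \<subseteq> N F"
    "\<And>F F'. finite F \<Longrightarrow> F' \<subseteq> F \<Longrightarrow> N F' \<subseteq> N F"
    using directed_monotone_family[of \<S> b, OF _ dir] by (metis (no_types, lifting))
  have Nst: "str (N F)" "countable (N F)" "N F \<noteq> {}" "A \<subseteq> N F" if "finite F" for F
    using N(1)[OF that] by (auto simp: \<S>_def)
  \<comment> \<open>The enumeration starts with the first tuple of \<open>xs\<close>, so that the
    first \<open>m\<close> values at a one-element list give back its point.\<close>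
  have "\<exists>\<phi>. range \<phi> = N (set xs) \<and> (xs \<in> lists Y \<and> xs \<noteq> [] \<longrightarrow> map \<phi> [0..<m] = hd xs)" for xs
  proof -
    obtain f :: "nat \<Rightarrow> 'a" where f: "range f = N (set xs)"
      using Nst(2,3)[of "set xs"] uncountable_def by (metis List.finite_set)
    show ?thesis
    proof (cases "xs \<in> lists Y \<and> xs \<noteq> []")
      case True
      then have y: "hd xs \<in> Y" "hd xs \<in> set xs" by (auto simp: in_lists_conv_set)
      then have l: "length (hd xs) = m" "set (hd xs) \<subseteq> N (set xs)"
        using Yt b[of "hd xs"] N(2)[of "set xs" "hd xs"] by (auto simp: tuples_iff)
      define \<phi> where "\<phi> n = (if n < m then hd xs ! n else f (n - m))" for n
      have "range \<phi> = N (set xs)"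
      proof
        show "range \<phi> \<subseteq> N (set xs)" using f l by (auto simp: \<phi>_def)
        have "f n = \<phi> (n + m)" for n by (simp add: \<phi>_def)
        then show "N (set xs) \<subseteq> range \<phi>" using f by (metis image_subset_iff rangeI)
      qed
      moreover have "map \<phi> [0..<m] = hd xs" using l by (auto simp: \<phi>_def intro: nth_equalityI)
      ultimately show ?thesis by blast
    qed (use f in auto)
  qed
  then obtain e where e: "\<And>xs. range (e xs) = N (set xs)"
    "\<And>xs. xs \<in> lists Y \<Longrightarrow> xs \<noteq> [] \<Longrightarrow> map (e xs) [0..<m] = hd xs" by metis

  \<comment> \<open>One enumeration running through those of all substructures named by index lists,
    so that a single automorphism respects all of them at once. Numbers that code no admissible
    index list take values of \<open>e []\<close>, which lie in every
    \<open>N (set xs)\<close>.\<close>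
  define \<Phi> where "\<Phi> xs j = (case prod_decode j of (c, n) \<Rightarrow>
      if from_nat c \<in> subs (length xs) then e (sel xs (from_nat c)) n else e [] n)" for xs j
  have \<Phi>_eq: "\<Phi> xs (prod_encode (to_nat ns, n)) = e (sel xs ns) n" if "ns \<in> subs (length xs)" for xs ns n
    using that by (simp add: \<Phi>_def)
  have range_\<Phi>: "range (\<Phi> xs) = N (set xs)" for xs
  proof
    have "e (sel xs ns) n \<in> N (set xs)" if "ns \<in> subs (length xs)" for ns n
      using e(1)[of "sel xs ns"] N(3)[of "set xs" "set (sel xs ns)"] set_sel[OF that] by auto
    moreover have "e [] n \<in> N (set xs)" for n
      using e(1)[of "[]"] N(3)[of "set xs" "set []"] by auto
    ultimately show "range (\<Phi> xs) \<subseteq> N (set xs)" by (auto simp: \<Phi>_def split: prod.splits)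
    have "e xs n \<in> range (\<Phi> xs)" for n
      using \<Phi>_eq[of "[0..<length xs]" xs n] by (metis rangeI sel_upt subs_upt)
    then show "N (set xs) \<subseteq> range (\<Phi> xs)" unfolding e(1)[of xs, symmetric] by blast
  qed
  have "\<forall>l. \<exists>l'. l \<in> lists (car M) \<longrightarrow> l' \<in> T \<and> (\<exists>g\<in>G. map g l = l')" using T(2) by blast
  then obtain rp where rp: "\<And>l. l \<in> lists (car M) \<Longrightarrow> rp l \<in> T \<and> (\<exists>g\<in>G. map g l = rp l)" by metis
  \<comment> \<open>The colour records the types of all prefixes of \<open>\<Phi> xs\<close> by
    their representatives in \<open>T\<close>; as \<open>T\<close> is countable, there are at most
    continuum many colours.\<close>
  define color where "color xs = {(n, rp (map (\<Phi> xs) [0..<n])) |n. True}" for xs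
  have \<Phi>_car: "\<Phi> xs j \<in> car M" for xs j
    using range_\<Phi>[of xs] Nst(1)[of "set xs"] str_car by auto
  have \<Phi>_lists: "map (\<Phi> xs) [0..<n] \<in> lists (car M)" for xs n
    using \<Phi>_car by (simp add: in_lists_conv_set)
  have color_sim: "\<exists>g\<in>G. \<forall>ns\<in>subs (length xs). \<forall>j. g (e (sel xs ns) j) = e (sel ys ns) j"
    if c: "color xs = color ys" and l: "length xs = length ys" for xs ys
  proof -
    have "\<exists>g\<in>G. map g (map (\<Phi> xs) [0..<n]) = map (\<Phi> ys) [0..<n]" for n
    proof -
      have "(n, rp (map (\<Phi> xs) [0..<n])) \<in> color ys" unfolding c[symmetric] by (auto simp: color_def)
      then have eq: "rp (map (\<Phi> xs) [0..<n]) = rp (map (\<Phi> ys) [0..<n])" by (auto simp: color_def)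
      obtain g where g: "g \<in> G" "map g (map (\<Phi> xs) [0..<n]) = rp (map (\<Phi> xs) [0..<n])"
        using rp[OF \<Phi>_lists] by blast
      obtain h where h: "h \<in> G" "map h (map (\<Phi> ys) [0..<n]) = rp (map (\<Phi> ys) [0..<n])"
        using rp[OF \<Phi>_lists] by blast
      obtain h' where h': "h' \<in> G" "\<And>x. x \<in> car M \<Longrightarrow> h' (h x) = x" "\<And>x. x \<in> car M \<Longrightarrow> h (h' x) = x"
        using Aut_inv[OF h(1)] by blast
      have "map g (map (\<Phi> xs) [0..<n]) = map (\<lambda>j. h (\<Phi> ys j)) [0..<n]"
        using g(2) h(2) eq by (simp add: comp_def)
      then have "g (\<Phi> xs j) = h (\<Phi> ys j)" if "j < n" for j
        using that unfolding map_map_upt_eq by blast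
      then show ?thesis using Aut_comp[OF h'(1) g(1)] h'(2) \<Phi>_car
        by (intro bexI[of _ "\<lambda>x. h' (g x)"]) simp_all
    qed
    then obtain g where g: "g \<in> G" "\<And>j. g (\<Phi> xs j) = \<Phi> ys j"
      using enumeration_extend[of "\<Phi> xs" "\<Phi> ys"] range_\<Phi> Nst(1) by auto
    have "g (e (sel xs ns) j) = e (sel ys ns) j" if "ns \<in> subs (length xs)" for ns j
      using g(2)[of "prod_encode (to_nat ns, j)"] \<Phi>_eq that l by simp
    then show ?thesis using g(1) by blast
  qed

  define C where "C = Pow (UNIV \<times> T :: (nat \<times> 'a list) set)"
  have C: "|C| <o \<kappa>" unfolding C_def using T(1) by (intro small_Pow small_countable) simp
  have colC: "color xs \<in> C" for xs
    using rp[OF \<Phi>_lists] by (auto simp: color_def C_def simp del: lists_image)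
  define fc where "fc s = color (sl s)" for s
  \<comment> \<open>Homogeneous sets of every size below \<open>\<kappa>\<close> for all arities up
    to \<open>n\<close>, with colours \<open>t\<close> that do not depend on the size. This
    uniformity lets the colours of successive arities be chosen one after the other.\<close>
  define Q where "Q n t \<longleftrightarrow> (\<forall>X :: 'a set. |X| <o \<kappa> \<longrightarrow> (\<exists>H\<subseteq>Y. |X| \<le>o |H| \<and> (\<forall>s\<subseteq>H. finite s \<and> card s \<le> n \<longrightarrow> fc s = t (card s))))"
    for n :: nat and t
  have XY: "|X| \<le>o |Y|" if "|X| <o \<kappa>" for X :: "'a set"
  proof -
    have "\<kappa> \<le>o |Y|"
      using ordLess_or_ordLeq[of "|Y|" \<kappa>] Ybig card_of_Well_order card_order by (auto simp: card_order_on_def)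
    then show ?thesis using that ordLess_ordLeq_trans ordLess_imp_ordLeq by blast
  qed
  have Q0: "Q 0 (\<lambda>_. fc {})"
    unfolding Q_def using XY by (auto simp: card_eq_0_iff)
  have QS: "\<exists>c. Q (Suc n) (t(Suc n := c))" if Qn: "Q n t" for n t
  proof (rule ccontr)
    assume no: "\<nexists>c. Q (Suc n) (t(Suc n := c))"
    \<comment> \<open>If every colour \<open>c\<close> failed at some size \<open>Xc c\<close>,
      Erdos-Rado for the union \<open>U\<close> of these sizes would give a set on which its own
      colour does not fail; \<open>U\<close> is small because there are few colours.\<close>
    define bad where "bad c X \<longleftrightarrow> |X :: 'a set| <o \<kappa> \<and> \<not> (\<exists>H\<subseteq>Y. |X| \<le>o |H| \<and>
        (\<forall>s\<subseteq>H. finite s \<and> card s \<le> Suc n \<longrightarrow> fc s = (t(Suc n := c)) (card s)))" for c X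
    have "\<exists>X. bad c X" for c
    proof -
      have "\<not> Q (Suc n) (t(Suc n := c))" using no by blast
      then show ?thesis unfolding Q_def bad_def by (simp only: not_all not_imp)
    qed
    then obtain Xc where Xc: "\<And>c. bad c (Xc c)" by metis
    define U where "U = (\<Union>c\<in>C. Xc c)"
    have U: "|U| <o \<kappa>" unfolding U_def using C Xc by (intro small_UN) (auto simp: bad_def)
    obtain X' :: "'a set" where X': "|X'| <o \<kappa>" "\<And>(H :: 'a list set) f. |X'| \<le>o |H| \<Longrightarrow>
        (\<forall>s\<subseteq>H. finite s \<and> card s = Suc n \<longrightarrow> f s \<in> C) \<Longrightarrow> \<exists>H'\<subseteq>H. \<exists>c. |U| \<le>o |H'| \<and> homog H' (Suc n) f c"
      using erdos_rado[OF C U, of "Suc n"] by metis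
    obtain H where H: "H \<subseteq> Y" "|X'| \<le>o |H|" "\<forall>s\<subseteq>H. finite s \<and> card s \<le> n \<longrightarrow> fc s = t (card s)"
      using Qn[unfolded Q_def, THEN spec, THEN mp, OF X'(1)] by blast
    obtain H' c where H': "H' \<subseteq> H" "|U| \<le>o |H'|" "homog H' (Suc n) fc c"
      using X'(2)[OF H(2), of fc] colC by (auto simp: fc_def)
    \<comment> \<open>\<open>H'\<close> may have no subset of size \<open>Suc n\<close>; then it is
      homogeneous for every colour, and one from \<open>C\<close> can be taken.\<close>
    have "\<exists>c\<in>C. homog H' (Suc n) fc c"
    proof (cases "\<exists>s\<subseteq>H'. finite s \<and> card s = Suc n")
      case True
      then have "c \<in> C" using H'(3) colC unfolding homog_def fc_def by metis
      then show ?thesis using H'(3) by blast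
    next
      case False
      then have "homog H' (Suc n) fc (color [])" unfolding homog_def by blast
      then show ?thesis using colC by blast
    qed
    then obtain c where c: "c \<in> C" "homog H' (Suc n) fc c" by blast
    have "|Xc c| \<le>o |U|" using c(1) by (intro card_of_mono1) (auto simp: U_def)
    then have "|Xc c| \<le>o |H'|" using H'(2) ordLeq_transitive by blast
    moreover have "fc s = (t(Suc n := c)) (card s)" if "s \<subseteq> H'" "finite s" "card s \<le> Suc n" for s
      using that c(2) H(3) H'(1) unfolding homog_def by (cases "card s = Suc n") auto
    ultimately show False using Xc[of c] H(1) H'(1) unfolding bad_def by (meson order_trans)
  qed
  obtain f where f: "\<And>n. Q n (f n)" "\<And>n. \<exists>c. f (Suc n) = (f n)(Suc n := c)"
    using dependent_nat_choice[of Q "\<lambda>n t t'. \<exists>c. t' = t(Suc n := c)"] Q0 QS by metis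
  define \<tau> where "\<tau> k = f k k" for k
  have f\<tau>: "f n k = \<tau> k" if "k \<le> n" for n k
    using that
  proof (induction n)
    case (Suc n)
    obtain c where "f (Suc n) = (f n)(Suc n := c)" using f(2) by blast
    then show ?case using Suc by (cases "k = Suc n") (simp_all add: \<tau>_def)
  qed (simp add: \<tau>_def)
  \<comment> \<open>Finite sequences of every length with the same colours \<open>\<tau>\<close> are
    enough. They need not extend each other, since automorphisms will glue them.\<close>
  have "\<exists>xs. sorted_wrt lt xs \<and> set xs \<subseteq> Y \<and> length xs = n \<and> (\<forall>s\<subseteq>set xs. fc s = \<tau> (card s))" for n
  proof -
    have "infinite (UNIV :: 'a set)" using inf_Field by (metis finite_subset subset_UNIV)
    then obtain X :: "'a set" where X: "finite X" "card X = n" using infinite_arbitrarily_large by blast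
    have "|X| <o \<kappa>" using X by (intro small_countable countable_finite)
    then obtain H where H: "H \<subseteq> Y" "|X| \<le>o |H|" "\<forall>s\<subseteq>H. finite s \<and> card s \<le> n \<longrightarrow> fc s = f n (card s)"
      using f(1)[of n, unfolded Q_def, THEN spec, THEN mp, OF \<open>|X| <o \<kappa>\<close>] by blast
    obtain g where g: "inj_on g X" "g ` X \<subseteq> H" using H(2) card_of_ordLeq by metis
    let ?s = "g ` X"
    have s: "finite ?s" "card ?s = n" using X g by (simp_all add: card_image)
    have "fc s = \<tau> (card s)" if "s \<subseteq> ?s" for s
    proof -
      have "finite s" "card s \<le> n" using that s by (auto intro: finite_subset card_mono)
      then show ?thesis using H(3) that g(2) f\<tau> by (metis order_trans)
    qed
    moreover have "length (sl ?s) = n" using lt(2)[OF sl(1)] sl(2) s by (metis distinct_card)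
    ultimately show ?thesis using sl[OF s(1)] g(2) H(1) by (intro exI[of _ "sl ?s"]) auto
  qed
  then obtain xs where xs: "\<And>n. sorted_wrt lt (xs n)" "\<And>n. set (xs n) \<subseteq> Y" "\<And>n. length (xs n) = n"
    "\<And>n s. s \<subseteq> set (xs n) \<Longrightarrow> fc s = \<tau> (card s)" by metis
  have sim: "\<exists>g\<in>G. \<forall>is\<in>subs (length ns). \<forall>j. g (e (sel (sel (xs k) ns) is) j) = e (sel (sel (xs l) ms) is) j"
    if n: "ns \<in> subs k" "ms \<in> subs l" "length ns = length ms" for ns ms k l
  proof -
    have col: "color (sel (xs k) ns) = \<tau> (length ns)" if "ns \<in> subs k" for k ns
    proof -
      have i: "ns \<in> subs (length (xs k))" using that xs(3) by simp
      have srt: "sorted_wrt lt (sel (xs k) ns)" using sorted_sel[OF xs(1) i] .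
      have "fc (set (sel (xs k) ns)) = \<tau> (card (set (sel (xs k) ns)))" using xs(4) set_sel[OF i] by blast
      then show ?thesis using lt[OF srt] by (simp add: fc_def distinct_card)
    qed
    have "color (sel (xs k) ns) = color (sel (xs l) ms)" using col[OF n(1)] col[OF n(2)] n(3) by simp
    then show ?thesis using color_sim n(3) by (metis sel_simps(3))
  qed
  have "\<exists>g\<in>G. \<forall>is\<in>subs n. \<forall>j. g (e (sel (xs (Suc n)) is) j) = e (sel (xs n) is) j" for n
  proof -
    have "[0..<n] \<in> subs (Suc n)" "[0..<n] \<in> subs n" using subs_mono[OF subs_upt] by auto
    then obtain g where "g \<in> G"
      "\<forall>is\<in>subs n. \<forall>j. g (e (sel (sel (xs (Suc n)) [0..<n]) is) j) = e (sel (sel (xs n) [0..<n]) is) j"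
      using sim[of "[0..<n]" "Suc n" "[0..<n]" n] by auto
    then show ?thesis by (intro bexI[of _ g]) (auto simp: sel_sel sel_idx)
  qed
  then obtain gg where gg: "\<And>n. gg n \<in> G"
    "\<And>n is j. is \<in> subs n \<Longrightarrow> gg n (e (sel (xs (Suc n)) is) j) = e (sel (xs n) is) j" by metis
  \<comment> \<open>\<open>gg n\<close> matches the first \<open>n\<close> points of the sequence of
    length \<open>Suc n\<close> with the sequence of length \<open>n\<close>; composing downwards
    makes all sequences agree on common index lists.\<close>
  define h where "h = rec_nat (\<lambda>x. x) (\<lambda>n f x. f (gg n x))"
  have h0: "h 0 = (\<lambda>x. x)" and hS: "h (Suc n) = (\<lambda>x. h n (gg n x))" for n by (simp_all add: h_def)
  have hG: "h n \<in> G" for n by (induction n) (auto simp: h0 hS Aut_id intro: Aut_comp gg(1))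
  have h_le: "h l (e (sel (xs l) is) j) = h k (e (sel (xs k) is) j)" if "is \<in> subs k" "k \<le> l" for k l "is" j
    using that(2)
  proof (induction l rule: dec_induct)
    case (step l)
    then have "is \<in> subs l" using that(1) subs_mono by blast
    then show ?case using step gg(2) by (simp add: hS)
  qed simp
  \<comment> \<open>\<open>Suc (sum_list ns)\<close> exceeds every entry of \<open>ns\<close>, so it
    is a length at which \<open>ns\<close> can be evaluated; by \<open>h_le\<close> any other such
    length gives the same value.\<close>
  define ew where "ew ns j = h (Suc (sum_list ns)) (e (sel (xs (Suc (sum_list ns))) ns) j)" for ns j
  have sub: "ns \<in> subs (Suc (sum_list ns))" if "sorted_wrt (<) ns" for ns
    using that member_le_sum_list[of _ ns] by (auto simp: subs_def less_Suc_eq_le)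
  have ew: "ew ns j = h k (e (sel (xs k) ns) j)" if "ns \<in> subs k" for ns k j
  proof -
    have "ns \<in> subs (Suc (sum_list ns))" using sub that by (auto simp: subs_def)
    then show ?thesis
      using h_le[of ns k "Suc (sum_list ns)" j] h_le[of ns "Suc (sum_list ns)" k j] that
      by (cases "k \<le> Suc (sum_list ns)") (auto simp: ew_def)
  qed
  have ew0: "ew [] = e []" using ew[of "[]" 0] by (auto simp: h0)
  have hA: "h n z = z" if zA: "z \<in> A" for n z
  proof -
    obtain j where z: "z = e [] j" using zA Nst(4)[of "{}"] e(1)[of "[]"] by auto
    then show ?thesis using ew[of "[]" n j] ew0 by simp
  qed
  have e_car: "e ns j \<in> car M" for ns j using e(1)[of ns] Nst(1)[of "set ns"] str_car by auto
  have val: "map (ew [i]) [0..<m] = map (h k) (xs k ! i)" if "i < k" for i k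
  proof -
    have "xs k ! i \<in> Y" using subsetD[OF xs(2) nth_mem[of i "xs k"]] xs(3) that by simp
    then have y: "map (e [xs k ! i]) [0..<m] = xs k ! i" using e(2)[of "[xs k ! i]"] by simp
    have "map (h k) (map (e [xs k ! i]) [0..<m]) = map (\<lambda>j. h k (e [xs k ! i] j)) [0..<m]"
      by (simp add: comp_def)
    then have "map (h k) (xs k ! i) = map (\<lambda>j. h k (e [xs k ! i] j)) [0..<m]" unfolding y .
    then show ?thesis using ew[of "[i]" k] that by simp
  qed
  interpret indiscernible_system K M \<delta> E m A ew
  proof
    show "equiv (tuples m (car M)) E" by (rule E)
    show "(x, y) \<in> E \<longleftrightarrow> (map f x, map f y) \<in> E" if "f \<in> G" "\<And>z. z \<in> A \<Longrightarrow> f z = z"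
      "x \<in> tuples m (car M)" "y \<in> tuples m (car M)" for f x y using E_inv that by blast
    have rng: "range (ew ns) = h k ` N (set (sel (xs k) ns))" if "ns \<in> subs k" for ns k
      using ew[OF that] e(1)[of "sel (xs k) ns"] by (metis (no_types, lifting) image_cong image_image)
    show "str (range (ew ns))" if "sorted_wrt (<) ns" for ns
      using rng[OF sub[OF that]] str_image(1)[OF hG Nst(1)] by simp
    show "range (ew ns) \<subseteq> range (ew [0..<k])" if n: "ns \<in> subs k" for ns k
      unfolding rng[OF n] rng[OF subs_upt]
    proof (intro image_mono N(3))
      show "set (sel (xs k) ns) \<subseteq> set (sel (xs k) [0..<k])"
        using n by (auto simp: sel_def subs_def)
    qed simp
    show "\<exists>g\<in>G. \<forall>is\<in>subs (length ns). \<forall>j. g (ew is j) = ew (sel ns is) j" if n: "sorted_wrt (<) ns" for ns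
    proof -
      let ?k = "length ns" and ?l = "Suc (sum_list ns)"
      obtain g where g: "g \<in> G" "\<And>is j. is \<in> subs ?k \<Longrightarrow> g (e (sel (xs ?k) is) j) = e (sel (xs ?l) (sel ns is)) j"
        using sim[OF subs_upt sub[OF n], of ?k] by (auto simp: sel_sel sel_idx)
      obtain h' where h': "h' \<in> G" "\<And>x. x \<in> car M \<Longrightarrow> h' (h ?k x) = x" "\<And>x. x \<in> car M \<Longrightarrow> h ?k (h' x) = x"
        using Aut_inv[OF hG[of ?k]] by blast
      have "h ?l (g (h' (ew is j))) = ew (sel ns is) j" if i: "is \<in> subs ?k" for "is" j
      proof -
        have "h' (ew is j) = e (sel (xs ?k) is) j" using ew[OF i] h'(2) e_car by simp
        then show ?thesis using g(2)[OF i] ew[OF subs_sel[OF i sub[OF n]]] by simp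
      qed
      moreover have "(\<lambda>x. h ?l (g (h' x))) \<in> G" using Aut_comp[OF hG Aut_comp[OF g(1) h'(1)]] .
      ultimately show ?thesis by (intro bexI[of _ "\<lambda>x. h ?l (g (h' x))"]) simp_all
    qed
    show "A \<subseteq> range (ew [])" using Nst(4)[of "{}"] e(1)[of "[]"] ew0 by simp
    show "(map (ew [i]) [0..<m], map (ew [j]) [0..<m]) \<notin> E" if ij: "i < j" for i j :: nat
    proof -
      let ?k = "Suc j"
      have Y: "xs ?k ! i \<in> Y" "xs ?k ! j \<in> Y" using xs(2)[of ?k] xs(3)[of ?k] ij by (auto simp: subset_iff)
      have "xs ?k ! i \<noteq> xs ?k ! j"
        using lt(2)[OF xs(1)[of ?k]] xs(3)[of ?k] ij by (simp add: nth_eq_iff_index_eq)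
      then have "(xs ?k ! i, xs ?k ! j) \<notin> E" using YE Y by blast
      then have "(map (h ?k) (xs ?k ! i), map (h ?k) (xs ?k ! j)) \<notin> E"
        using E_inv[OF hG hA] Y Yt by blast
      then show ?thesis using val[of i ?k] val[of j ?k] ij by simp
    qed
  qed
  show False using many_classes few by blast
qed

end

section \<open>Types over finite sets\<close>

context homogeneous_structure
begin

abbreviation U :: "('a, 'a) ambient" where
  "U \<equiv> ambient_of K M \<delta>"

abbreviation eqv :: "'a set \<Rightarrow> 'a list \<Rightarrow> 'a list \<Rightarrow> bool" where
  "eqv \<equiv> gtp_eq U"

lemma eqv_iff: "eqv X a b \<longleftrightarrow> (\<exists>f\<in>G. (\<forall>x\<in>X. f x = x) \<and> map f a = b)"
  by (auto simp: gtp_eq_def aut_over_def)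

lemma eqvI: "f \<in> G \<Longrightarrow> (\<And>x. x \<in> X \<Longrightarrow> f x = x) \<Longrightarrow> map f a = b \<Longrightarrow> eqv X a b"
  by (auto simp: eqv_iff)

lemma eqvE:
  assumes "eqv X a b"
  obtains f where "f \<in> G" "\<And>x. x \<in> X \<Longrightarrow> f x = x" "map f a = b"
  using assms by (auto simp: eqv_iff)

lemma map_car [simp]: "f \<in> G \<Longrightarrow> a \<in> lists (car M) \<Longrightarrow> map f a \<in> lists (car M)"
  by (auto simp: in_lists_conv_set)

lemma eqv_lists: "eqv X a b \<Longrightarrow> a \<in> lists (car M) \<Longrightarrow> b \<in> lists (car M)"
  by (metis eqvE map_car)

lemma map_inv_car: "(\<And>x. x \<in> car M \<Longrightarrow> g (f x) = x) \<Longrightarrow> a \<in> lists (car M) \<Longrightarrow> map g (map f a) = a"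
  by (auto simp: in_lists_conv_set intro!: map_idI)

lemma eqv_sym:
  assumes "eqv X a b" and "a \<in> lists (car M)" and "X \<subseteq> car M"
  shows "eqv X b a"
proof -
  obtain f where f: "f \<in> G" "\<And>x. x \<in> X \<Longrightarrow> f x = x" "map f a = b" using assms(1) unfolding eqv_iff by blast
  obtain g where g: "g \<in> G" "\<And>x. x \<in> car M \<Longrightarrow> g (f x) = x" "\<And>x. x \<in> car M \<Longrightarrow> f (g x) = x"
    using Aut_inv[OF f(1)] by blast
  have "g x = x" if "x \<in> X" for x using g(2)[of x] f(2)[OF that] that assms(3) by auto
  moreover have "map g b = a" using map_inv_car[of g f, OF g(2) assms(2)] f(3) by simp
  ultimately show ?thesis using g(1) by (intro eqvI[of g]) auto
qed

lemma eqv_trans: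
  assumes "eqv X a b" and "eqv X b c"
  shows "eqv X a c"
proof -
  obtain f where f: "f \<in> G" "\<And>x. x \<in> X \<Longrightarrow> f x = x" "map f a = b" using assms(1) unfolding eqv_iff by blast
  obtain g where g: "g \<in> G" "\<And>x. x \<in> X \<Longrightarrow> g x = x" "map g b = c" using assms(2) unfolding eqv_iff by blast
  show ?thesis using f g Aut_comp[OF g(1) f(1)] by (intro eqvI[of "\<lambda>x. g (f x)"]) auto
qed

lemma eqv_mono: "eqv X a b \<Longrightarrow> Y \<subseteq> X \<Longrightarrow> eqv Y a b"
  unfolding eqv_iff by blast

lemma eqv_length: "eqv X a b \<Longrightarrow> length a = length b"
  by (metis eqvE length_map)

lemma eqv_map:
  assumes h: "h \<in> G" and e: "eqv X a b" and X: "X \<subseteq> car M" and a: "a \<in> lists (car M)"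
  shows "eqv (h ` X) (map h a) (map h b)"
proof -
  obtain f where f: "f \<in> G" "\<And>x. x \<in> X \<Longrightarrow> f x = x" "map f a = b" using e unfolding eqv_iff by blast
  obtain g where g: "g \<in> G" "\<And>x. x \<in> car M \<Longrightarrow> g (h x) = x" "\<And>x. x \<in> car M \<Longrightarrow> h (g x) = x"
    using Aut_inv[OF h] by blast
  have "map (\<lambda>x. h (f (g x))) (map h a) = map h (map f (map g (map h a)))" by (simp add: comp_def)
  moreover have "map g (map h a) = a" by (rule map_inv_car) (use g(2) a in auto)
  ultimately have "map (\<lambda>x. h (f (g x))) (map h a) = map h b" using f(3) by metis
  moreover have "(\<lambda>x. h (f (g x))) \<in> G" using Aut_comp[OF h Aut_comp[OF f(1) g(1)]] .
  ultimately show ?thesis using f(2) g(2) X by (intro eqvI[of "\<lambda>x. h (f (g x))"]) auto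
qed

lemma eqv_fix:
  assumes "eqv X (a @ u) (b @ u)" and "length a = length b"
  shows "eqv (X \<union> set u) a b"
proof -
  obtain f where f: "f \<in> G" "\<And>x. x \<in> X \<Longrightarrow> f x = x" "map f (a @ u) = b @ u" using assms(1) unfolding eqv_iff by blast
  then have "map f u = u" "map f a = b" using assms(2) by auto
  then show ?thesis using f by (intro eqvI[of f]) (auto simp: map_idI dest: map_eq_conv[THEN iffD1, of _ _ id, simplified])
qed

lemma eqv_unfix:
  assumes "eqv (X \<union> set u) a b"
  shows "eqv X (a @ u) (b @ u)" "eqv X (u @ a) (u @ b)"
proof -
  obtain f where f: "f \<in> G" "\<And>x. x \<in> X \<union> set u \<Longrightarrow> f x = x" "map f a = b" using assms unfolding eqv_iff by blast
  then have "map f u = u" by (simp add: map_idI)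
  then show "eqv X (a @ u) (b @ u)" "eqv X (u @ a) (u @ b)" using f by (auto intro!: eqvI[of f])
qed

lemma wtp_finite: "finite X \<Longrightarrow> wtp_eq U X a b \<longleftrightarrow> eqv X a b"
  unfolding wtp_eq_def using eqv_mono by blast

lemma wtpD: "wtp_eq U X a b \<Longrightarrow> finite B \<Longrightarrow> B \<subseteq> X \<Longrightarrow> eqv B a b"
  by (simp add: wtp_eq_def)

text \<open>Over a finite \<open>A\<close> weak and Galois types coincide, so for finite
  \<open>A\<close> this is the negation of \<open>splits\<close>.\<close>

definition nosplit :: "'a list \<Rightarrow> 'a set \<Rightarrow> 'a set \<Rightarrow> bool" where
  "nosplit a D A \<longleftrightarrow> (\<forall>u\<in>lists D. \<forall>v\<in>lists D. eqv A u v \<longrightarrow> eqv A (a @ u) (a @ v))"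

lemma nosplitD: "nosplit a D A \<Longrightarrow> u \<in> lists D \<Longrightarrow> v \<in> lists D \<Longrightarrow> eqv A u v \<Longrightarrow> eqv A (a @ u) (a @ v)"
  by (simp add: nosplit_def)

lemma ns_indep_iff: "ns_indep U a B C \<longleftrightarrow> (\<exists>A. finite A \<and> A \<subseteq> B \<and> nosplit a (B \<union> C) A)"
  unfolding ns_indep_def splits_def nosplit_def using wtp_finite by meson

lemma nosplit_subset: "nosplit a D A \<Longrightarrow> D' \<subseteq> D \<Longrightarrow> nosplit a D' A"
  unfolding nosplit_def using lists_mono by blast

text \<open>With an enumeration of the larger base appended to both tuples, equality of types over
  \<open>A'\<close> becomes equality over \<open>A\<close> of longer tuples from
  \<open>D\<close>.\<close>

lemma nosplit_mono:
  assumes ns: "nosplit a D A" and A: "A \<subseteq> A'" "A' \<subseteq> D" "finite A'"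
  shows "nosplit a D A'"
  unfolding nosplit_def
proof (intro ballI impI)
  fix u v assume u: "u \<in> lists D" and v: "v \<in> lists D" and e: "eqv A' u v"
  obtain l where l: "set l = A'" using A(3) finite_list by blast
  have "eqv A (u @ l) (v @ l)"
    using eqv_unfix(1)[of A l u v] eqv_mono[OF e, of "A \<union> set l"] l A by auto
  moreover have "u @ l \<in> lists D" "v @ l \<in> lists D" using u v l A(2) by (auto simp: in_lists_conv_set)
  ultimately have "eqv A (a @ u @ l) (a @ v @ l)" using nosplitD[OF ns] by blast
  then have "eqv (A \<union> set l) (a @ u) (a @ v)" using eqv_length[OF e] by (intro eqv_fix) auto
  then show "eqv A' (a @ u) (a @ v)" using l A(1) eqv_mono by (metis Un_upper2)
qed

end

section \<open>The monster model and the supermonster\<close>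

locale fur =
  fixes K :: "('a, 'r, 'f) aec_data" and M M' :: "('a, 'r, 'f) fo_struct" and \<delta> :: "'a rel"
  assumes FUR: "FUR_class K M \<delta>" and super: "supermonster K M M'"
begin

lemma fur_facts:
  shows "aec_axioms K" "M \<in> members K" "inaccessible \<delta>" "universal K M \<delta>" "model_homogeneous K M \<delta>"
    "LS_property K natLeq" "arbitrarily_large K" "\<And>A. A \<in> members K \<Longrightarrow> infinite (car A)"
    "AI K M \<delta>" "AIV K M \<delta>" "AV K M \<delta>" "AVI K M \<delta>"
  using FUR unfolding FUR_class_def monster_def by auto

lemma super_facts:
  shows "M' \<in> members K" "strong K M M'" "|car M| <o |car M'|" "universal K M' |car M'|" "model_homogeneous K M' |car M'|"
  using super unfolding supermonster_def by auto

end

sublocale fur \<subseteq> inaccessible_cardinal \<delta>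
  by standard (rule fur_facts)

sublocale fur \<subseteq> homogeneous_structure K M \<delta>
  by standard (use fur_facts card_order nat_less in auto)

context fur
begin

text \<open>Otherwise the power set of \<open>M\<close> is small. A member of \<open>K\<close> of at
  least that size, cut down by Loewenheim-Skolem to a small one that still has it, embeds into
  \<open>M\<close> by universality, against Cantor's theorem. Consequently a set below
  \<open>\<delta>\<close> is also bounded for \<open>M'\<close>.\<close>

lemma delta_le: "\<delta> \<le>o |car M|"
proof (rule ccontr)
  assume "\<not> \<delta> \<le>o |car M|"
  then have "|car M| <o \<delta>"
    using ordLess_or_ordLeq[of "|car M|" \<delta>] card_of_Well_order card_order by (auto simp: card_order_on_def)
  then have P: "|Pow (car M)| <o \<delta>" by (rule small_Pow)
  obtain X :: "'a set" where X: "|X| =o |Pow (car M)|" using small_copy[OF P] .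
  obtain A where A: "A \<in> members K" "|X| \<le>o |car A|"
    using fur_facts(7) unfolding arbitrarily_large_def by blast
  then obtain f where f: "inj_on f X" "f ` X \<subseteq> car A" by (metis card_of_ordLeq)
  obtain B where B: "strong K B A" "f ` X \<subseteq> car B" "|car B| \<le>o |f ` X| +c natLeq"
    using LS A(1) f(2) unfolding LS_property_def by blast
  have "|X| <o \<delta>" using X P by (rule ordIso_ordLess_trans)
  then have "|f ` X| +c natLeq <o \<delta>" by (intro csum_natLeq_small ordLess_image)
  then have "|car B| <o \<delta>" using B(3) by (rule ordLeq_ordLess_trans[rotated])
  moreover have "B \<in> members K" using strongD[OF B(1)] by blast
  ultimately obtain g where "elem_embedding K B M g" using univ unfolding universal_def by blast
  then obtain C where C: "iso_struct (lang K) B C g" "strong K C M" unfolding elem_embedding_def by blast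
  have "|car B| \<le>o |car M|"
  proof (rule card_of_ordLeq[THEN iffD1], intro exI conjI)
    show "inj_on g (car B)" using C(1) by (auto simp: iso_struct_def bij_betw_def)
    show "g ` car B \<subseteq> car M" using C str_car[OF str_strong[OF C(2)]] by (auto simp: iso_struct_def bij_betw_def)
  qed
  moreover have "|X| \<le>o |car B|" using f(1) B(2) card_of_ordLeq by blast
  ultimately have "|Pow (car M)| \<le>o |car M|"
    using X by (meson ordIso_ordLeq_trans ordIso_symmetric ordLeq_transitive)
  then show False using card_of_Pow[of "car M"] not_ordLess_ordLeq by metis
qed

lemma delta_less: "\<delta> <o |car M'|"
  using delta_le super_facts(3) by (rule ordLeq_ordLess_trans)

lemma small_super: "|X| <o \<delta> \<Longrightarrow> |X| <o |car M'|"
  using delta_less ordLess_transitive by blast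

end

sublocale fur \<subseteq> S: homogeneous_structure K M' "|car M'|"
  by standard (use fur_facts super_facts ordLess_transitive[OF nat_less delta_less] card_of_Card_order in auto)

context fur
begin

lemma M_super: "S.str (car M)" "S.ind (car M) = M" "car M \<subseteq> car M'"
  using S.str_strong[OF super_facts(2)] S.strong_eq_ind[OF super_facts(2)] S.str_car by simp_all

lemma str_super: "str X \<Longrightarrow> S.str X \<and> S.ind X = ind X"
  using strong_trans[OF _ super_facts(2), of "ind X"] S.str_strong[of "ind X"] S.strong_eq_ind[of "ind X"]
  by (simp add: str_def)

lemma super_str:
  assumes "S.str X" and "X \<subseteq> car M"
  shows "str X"
proof -
  have "strong K (S.ind X) M"
    using strong_coherent[OF _ super_facts(2), of "S.ind X"] assms by (simp add: S.str_def)
  then show ?thesis using str_strong by fastforce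
qed

lemma Aut_extend:
  assumes "f \<in> G"
  obtains g where "g \<in> S.G" "\<And>x. x \<in> car M \<Longrightarrow> g x = f x"
proof -
  have "iso_struct (lang K) (S.ind (car M)) (S.ind (car M)) f"
    using assms by (simp add: M_super(2) Aut_def)
  then show thesis using S.homogeneous[OF M_super(1) M_super(1) super_facts(3) super_facts(3)] that by blast
qed

lemma super_inv_M:
  assumes "h \<in> G" "h' \<in> S.G" "\<And>x. x \<in> car M \<Longrightarrow> h' x = h x"
    and "g \<in> S.G" "\<And>x. x \<in> car M' \<Longrightarrow> g (h' x) = x" and "y \<in> car M"
  shows "g y \<in> car M"
proof -
  obtain x where "x \<in> car M" "y = h x" using Aut_bij[OF assms(1)] assms(6) by (auto simp: bij_betw_def)
  then have "g y = x" using assms(3)[of x] assms(5)[of x] M_super(3) by auto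
  then show ?thesis using \<open>x \<in> car M\<close> by simp
qed

text \<open>A model around \<open>X\<close> and \<open>Z\<close> embeds into \<open>M\<close> by
  universality, and the embedding extends to an automorphism of \<open>M'\<close>. Its effect on a
  model around \<open>X\<close> is then undone by an automorphism of \<open>M\<close>, extended to
  \<open>M'\<close>. In this sense \<open>M\<close> is saturated inside \<open>M'\<close>.\<close>

lemma embed_over:
  assumes X: "X \<subseteq> car M" "|X| <o \<delta>" and Z: "Z \<subseteq> car M'" "|Z| <o \<delta>"
  obtains s where "s \<in> S.G" "\<And>x. x \<in> X \<Longrightarrow> s x = x" "s ` Z \<subseteq> car M"
proof -
  obtain S0 where S0: "str S0" "X \<subseteq> S0" "S0 \<subseteq> car M" "|S0| <o \<delta>" using LS_small[OF str_M X] by blast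
  have S0': "S.str S0" using str_super S0(1) by blast
  have "S0 \<union> Z \<subseteq> car M'" using S0(3) M_super(3) Z(1) by blast
  then obtain T where T: "S.str T" "S0 \<union> Z \<subseteq> T" "|T| \<le>o |S0 \<union> Z| +c natLeq"
    using S.LS_str[OF S.str_M] by metis
  have Td: "|T| <o \<delta>"
    using ordLeq_ordLess_trans[OF T(3) csum_natLeq_small[OF small_Un[OF S0(4) Z(2)]]] .
  obtain g where "elem_embedding K (S.ind T) M g"
    using univ S.str_mem[OF T(1)] Td unfolding universal_def by fastforce
  then obtain C where C: "iso_struct (lang K) (S.ind T) C g" "strong K C M" unfolding elem_embedding_def by blast
  have gT: "car C = g ` T" using C(1) by (auto simp: iso_struct_def bij_betw_def)
  have gTs: "str (g ` T)" "C = ind (g ` T)" using str_strong[OF C(2)] strong_eq_ind[OF C(2)] gT by simp_all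
  then have gTS: "S.str (g ` T)" "S.ind (g ` T) = C" using str_super by simp_all
  obtain k where k: "k \<in> S.G" "\<And>x. x \<in> T \<Longrightarrow> k x = g x"
  proof (rule S.homogeneous[OF T(1) gTS(1)])
    show "|T| <o |car M'|" "|g ` T| <o |car M'|" using small_super Td ordLess_image by blast+
    show "iso_struct (lang K) (S.ind T) (S.ind (g ` T)) g" using C(1) gTS(2) by simp
  qed blast
  have kT: "k x \<in> car M" if "x \<in> T" for x using k(2)[OF that] that str_car[OF gTs(1)] by auto
  have kS0: "S.str (k ` S0)" "iso_struct (lang K) (S.ind S0) (S.ind (k ` S0)) k"
    using S.str_image[OF k(1) S0'] by blast+
  have kS0M: "str (k ` S0)" using super_str[OF kS0(1)] kT T(2) by blast
  obtain h where h: "h \<in> G" "\<And>x. x \<in> S0 \<Longrightarrow> h x = k x"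
  proof (rule homogeneous[OF S0(1) kS0M S0(4) ordLess_image[OF S0(4)]])
    show "iso_struct (lang K) (ind S0) (ind (k ` S0)) k"
      using kS0(2) str_super[OF S0(1)] str_super[OF kS0M] by simp
  qed blast
  obtain h' where h': "h' \<in> S.G" "\<And>x. x \<in> car M \<Longrightarrow> h' x = h x" using Aut_extend[OF h(1)] by blast
  obtain j where j: "j \<in> S.G" "\<And>x. x \<in> car M' \<Longrightarrow> j (h' x) = x" "\<And>x. x \<in> car M' \<Longrightarrow> h' (j x) = x"
    using S.Aut_inv[OF h'(1)] by blast
  show thesis
  proof (rule that[of "\<lambda>x. j (k x)"])
    show "(\<lambda>x. j (k x)) \<in> S.G" by (rule S.Aut_comp[OF j(1) k(1)])
    show "j (k x) = x" if x: "x \<in> X" for x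
    proof -
      have "x \<in> S0" "x \<in> car M" using x S0 by auto
      then show ?thesis using h(2)[of x] h'(2)[of x] j(2)[of x] M_super(3) by auto
    qed
    show "(\<lambda>x. j (k x)) ` Z \<subseteq> car M"
      using super_inv_M[OF h(1) h' j(1,2)] kT T(2) by auto
  qed
qed

text \<open>\<open>f\<close> may carry a model around \<open>X\<close> out of \<open>M\<close>. Its
  image is first brought back into \<open>M\<close> over the image of \<open>X\<close>, and then
  model homogeneity of \<open>M\<close> applies.\<close>

lemma Aut_descend:
  assumes f: "f \<in> S.G" and X: "X \<subseteq> car M" "|X| <o \<delta>" and fX: "f ` X \<subseteq> car M"
  obtains h where "h \<in> G" "\<And>x. x \<in> X \<Longrightarrow> h x = f x"
proof -
  obtain T where T: "str T" "X \<subseteq> T" "T \<subseteq> car M" "|T| <o \<delta>" using LS_small[OF str_M X] by blast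
  have TS: "S.str T" using str_super T(1) by blast
  have "f ` T \<subseteq> car M'" using T(3) M_super(3) f S.Aut_in by blast
  then obtain t where t: "t \<in> S.G" "\<And>x. x \<in> f ` X \<Longrightarrow> t x = x" "t ` f ` T \<subseteq> car M"
    using embed_over[OF fX ordLess_image[OF X(2)] _ ordLess_image[OF T(4)]] by blast
  define g where "g x = t (f x)" for x
  have g: "g \<in> S.G" unfolding g_def by (rule S.Aut_comp[OF t(1) f])
  have gT: "S.str (g ` T)" "iso_struct (lang K) (S.ind T) (S.ind (g ` T)) g"
    using S.str_image[OF g TS] by blast+
  have gTM: "str (g ` T)" using super_str[OF gT(1)] t(3) by (auto simp: g_def image_image)
  obtain h where h: "h \<in> G" "\<And>x. x \<in> T \<Longrightarrow> h x = g x"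
  proof (rule homogeneous[OF T(1) gTM T(4) ordLess_image[OF T(4)]])
    show "iso_struct (lang K) (ind T) (ind (g ` T)) g"
      using gT(2) str_super[OF T(1)] str_super[OF gTM] by simp
  qed blast
  show thesis
  proof (rule that[OF h(1)])
    show "h x = f x" if "x \<in> X" for x using h(2)[of x] t(2)[of "f x"] that T(2) by (auto simp: g_def)
  qed
qed

lemma eqv_super:
  assumes X: "X \<subseteq> car M" "|X| <o \<delta>" and ab: "a \<in> lists (car M)" "b \<in> lists (car M)"
  shows "S.eqv X a b \<longleftrightarrow> eqv X a b"
proof
  assume "S.eqv X a b"
  then obtain f where f: "f \<in> S.G" "\<And>x. x \<in> X \<Longrightarrow> f x = x" "map f a = b" unfolding S.eqv_iff by blast
  have "|X \<union> set a| <o \<delta>" by (rule small_Un[OF X(2)]) (simp add: small_countable countable_finite)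
  moreover have "X \<union> set a \<subseteq> car M" using X(1) ab(1) by (auto simp: in_lists_conv_set)
  moreover have "f ` (X \<union> set a) \<subseteq> car M" using f(2,3) X(1) ab(2) by (auto simp: in_lists_conv_set)
  ultimately obtain h where h: "h \<in> G" "\<And>x. x \<in> X \<union> set a \<Longrightarrow> h x = f x" using Aut_descend[OF f(1)] by metis
  have "map h a = b" using h(2) f(3) by auto
  then show "eqv X a b" using h f(2) by (intro eqvI[of h]) auto
next
  assume "eqv X a b"
  then obtain f where f: "f \<in> G" "\<And>x. x \<in> X \<Longrightarrow> f x = x" "map f a = b" unfolding eqv_iff by blast
  obtain g where g: "g \<in> S.G" "\<And>x. x \<in> car M \<Longrightarrow> g x = f x" using Aut_extend[OF f(1)] by blast
  have "map g a = b" using g(2) f(3) ab(1) by (auto simp: in_lists_conv_set)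
  then show "S.eqv X a b" using g f(2) X(1) by (intro S.eqvI[of g]) auto
qed

section \<open>Splitting and symmetry over countable models\<close>

lemma countable_model: "str N \<Longrightarrow> countable N \<Longrightarrow> model K M \<delta> N"
  by (simp add: model_iff small_countable)

lemma s_saturated:
  assumes N: "str N" "countable N" and A: "finite A" "A \<subseteq> N" and b: "b \<in> lists (car M)"
  obtains a where "a \<in> lists N" "eqv A b a"
proof -
  have "s_saturated U N" using fur_facts(9) countable_model[OF N] N(2) by (simp add: AI_def)
  then have "\<exists>a\<in>lists N. wtp_eq U A a b"
    using A b by (simp add: s_saturated_def)
  then obtain a where "a \<in> lists N" "eqv A a b" using wtp_finite[OF A(1)] by blast
  moreover then have "a \<in> lists (car M)" using str_car[OF N(1)] by (meson lists_mono subsetD)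
  ultimately show thesis using that eqv_sym[of A a b] A(2) str_car[OF N(1)] by blast
qed

text \<open>By s-saturation a tuple \<open>u\<close> of \<open>D\<close> has a copy \<open>v\<close>
  in \<open>N\<close> over the finite base. Both types pass from \<open>u\<close> to
  \<open>v\<close> by nonsplitting, and over \<open>v\<close> they agree.\<close>

lemma nosplit_unique:
  assumes N: "str N" "countable N" and D: "N \<subseteq> D" "D \<subseteq> car M"
    and ns: "ns_indep U a N D" "ns_indep U b N D" and ab: "a \<in> lists (car M)" "wtp_eq U N a b"
  shows "wtp_eq U D a b"
proof -
  have ND: "N \<union> D = D" using D by auto
  obtain A1 A2 where A12: "finite A1" "A1 \<subseteq> N" "nosplit a D A1" "finite A2" "A2 \<subseteq> N" "nosplit b D A2"
    using ns unfolding ns_indep_iff ND by blast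
  define A where "A = A1 \<union> A2"
  have A: "finite A" "A \<subseteq> N" using A12 by (auto simp: A_def)
  have nsa: "nosplit a D A" and nsb: "nosplit b D A"
    using nosplit_mono[OF A12(3), of A] nosplit_mono[OF A12(6), of A] A D by (auto simp: A_def)
  have bM: "b \<in> lists (car M)" using wtpD[OF ab(2), of "{}"] eqv_lists ab(1) by blast
  have AM: "A \<subseteq> car M" using A(2) D by blast
  show ?thesis
    unfolding wtp_eq_def
  proof (intro allI impI)
    fix B assume B: "finite B \<and> B \<subseteq> D"
    then obtain u where u: "set u = B" using finite_list by blast
    have uD: "u \<in> lists D" "u \<in> lists (car M)" using u B D by (auto simp: in_lists_conv_set)
    obtain v where v: "v \<in> lists N" "eqv A u v" using s_saturated[OF N A uD(2)] by blast
    have vD: "v \<in> lists D" using v(1) D(1) by (meson lists_mono subsetD)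
    have "eqv A (a @ u) (a @ v)" by (rule nosplitD[OF nsa uD(1) vD v(2)])
    moreover have "eqv A (a @ v) (b @ v)"
      using wtpD[OF ab(2), of "A \<union> set v"] A v(1) by (intro eqv_unfix(1)) (auto simp: in_lists_conv_set)
    moreover have "eqv A (b @ v) (b @ u)"
      using eqv_sym[OF nosplitD[OF nsb uD(1) vD v(2)]] bM uD(2) AM by simp
    ultimately have "eqv A (a @ u) (b @ u)" using eqv_trans by blast
    then have "eqv (A \<union> set u) a b"
      using eqv_length[OF wtpD[OF ab(2), of "{}"]] by (intro eqv_fix) auto
    then show "eqv B a b" using u eqv_mono by blast
  qed
qed

text \<open>(AV) needs a model independent from \<open>a\<close>, which \<open>B\<close> is not
  known to be. (AVI) gives a copy \<open>C\<close> of \<open>B\<close> over \<open>N\<close> that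
  is, so (AV) makes \<open>a\<close> independent from \<open>C\<close>. Pulled back to
  \<open>B\<close>, this yields \<open>a1\<close> with the type of \<open>a\<close> over
  \<open>N\<close>, hence over \<open>B\<close> by \<open>nosplit_unique\<close>, and the
  independence of \<open>C\<close> from \<open>a\<close> transfers to \<open>B\<close>.\<close>

lemma nosplit_symmetry:
  assumes N: "str N" "countable N" and B: "str B" "countable B" "N \<subseteq> B"
    and a: "a \<in> lists (car M)" "ns_indep U a N B" and x: "x \<in> lists B"
  shows "ns_indep U x N (set a)"
proof -
  have "countable (N \<union> set a)" "N \<union> set a \<subseteq> car M"
    using N a str_car[OF N(1)] by (auto simp: countable_finite in_lists_conv_set)
  then obtain D where D: "str D" "N \<union> set a \<subseteq> D" "countable D" using LS_countable[OF str_M] by metis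
  have "model K M \<delta> N \<and> model K M \<delta> B \<and> model K M \<delta> D \<and> N \<subseteq> B \<inter> D"
    using countable_model N B D by simp
  then obtain C g where C: "model K M \<delta> C" "C = g ` B" "wtp_eq_enum U N B g" "ns_indep_set U C N D"
    using fur_facts(12) unfolding AVI_def by meson
  have gN: "g z = z" if "z \<in> N" for z
  proof -
    have "\<exists>f\<in>aut_over U {z}. \<forall>x\<in>B. f x = g x"
      using C(3)[unfolded wtp_eq_enum_def, THEN spec[of _ "{z}"]] that by simp
    then show ?thesis using that B(3) by (auto simp: aut_over_def)
  qed
  obtain f where f: "f \<in> G" "\<And>x. x \<in> B \<Longrightarrow> f x = g x"
    using C(3)[unfolded wtp_eq_enum_def, rule_format, of "{}"] by (auto simp: aut_over_def)
  have fN: "f z = z" if "z \<in> N" for z using that f(2) gN B(3) by auto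
  have fB: "f ` B = C" using f(2) C(2) by auto
  have "ns_indep_set U C N (set a)"
  proof -
    have "nosplit z (N \<union> D) A \<Longrightarrow> nosplit z (N \<union> set a) A" for z A
      using D(2) nosplit_subset[of z "N \<union> D" A "N \<union> set a"] by blast
    then have "ns_indep U z N D \<Longrightarrow> ns_indep U z N (set a)" for z unfolding ns_indep_iff by meson
    then show ?thesis using C(4) unfolding ns_indep_set_def by simp
  qed
  moreover have "countable C" "str C" "N \<subseteq> C"
    using C(1,2) B(2) gN B(3) by (auto simp: model_iff image_iff) (metis subsetD)
  ultimately have "ns_indep U a N C"
    using fur_facts(11) countable_model[OF N] C(1) N(2) a(1) unfolding AV_def by blast
  then obtain A where A: "finite A" "A \<subseteq> N" "nosplit a (N \<union> C) A" unfolding ns_indep_iff by blast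
  obtain h where h: "h \<in> G" "\<And>x. x \<in> car M \<Longrightarrow> h (f x) = x" "\<And>x. x \<in> car M \<Longrightarrow> f (h x) = x"
    using Aut_inv[OF f(1)] by blast
  have BM: "B \<subseteq> car M" and NM: "N \<subseteq> car M" using str_car B N by auto
  have hN: "h z = z" if "z \<in> N" for z using h(2)[of z] fN[OF that] that NM by auto
  define a1 where "a1 = map h a"
  have a1: "a1 \<in> lists (car M)" using a(1) h(1) by (simp add: a1_def)
  have fa1: "map f a1 = a" using map_inv_car[of f h, OF h(3) a(1)] by (simp add: a1_def)
  have "nosplit a1 (N \<union> B) A"
    unfolding nosplit_def
  proof (intro ballI impI)
    fix u v assume uv: "u \<in> lists (N \<union> B)" "v \<in> lists (N \<union> B)" "eqv A u v"
    have uvM: "u \<in> lists (car M)" "v \<in> lists (car M)" using uv BM NM by (auto simp: in_lists_conv_set)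
    have fA: "f ` A = A" "h ` A = A" using fN hN A(2) by force+
    have "eqv A (map f u) (map f v)" using eqv_map[OF f(1) uv(3)] uvM A NM fA by auto
    moreover have "map f u \<in> lists (N \<union> C)" "map f v \<in> lists (N \<union> C)"
      using uv fB fN by (auto simp: in_lists_conv_set)
    ultimately have "eqv A (a @ map f u) (a @ map f v)" using nosplitD[OF A(3)] by blast
    then have "eqv (h ` A) (map h (a @ map f u)) (map h (a @ map f v))"
      using A NM a(1) uvM f(1) by (intro eqv_map[OF h(1)]) auto
    then show "eqv A (a1 @ u) (a1 @ v)"
      using map_inv_car[of h f, OF h(2)] uvM fA by (simp add: a1_def del: map_map)
  qed
  then have "ns_indep U a1 N B" using A unfolding ns_indep_iff by blast
  moreover have "wtp_eq U N a a1"
    unfolding wtp_eq_def using hN by (auto simp: a1_def intro!: eqvI[OF h(1)])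
  ultimately have aa1: "wtp_eq U B a a1" using nosplit_unique[OF N B(3) BM a(2)] a(1) by blast
  have "map g x \<in> lists C" using x C(2) by auto
  then obtain A where A: "finite A" "A \<subseteq> N" "nosplit (map g x) (N \<union> set a) A"
    using \<open>ns_indep_set U C N (set a)\<close> unfolding ns_indep_set_def ns_indep_iff by blast
  have gx: "map g x = map f x" using x f(2) by (auto simp: in_lists_conv_set)
  have xM: "x \<in> lists (car M)" using x BM by (auto simp: in_lists_conv_set)
  have "nosplit x (N \<union> set a) A"
    unfolding nosplit_def
  proof (intro ballI impI)
    fix u v assume uv: "u \<in> lists (N \<union> set a)" "v \<in> lists (N \<union> set a)" "eqv A u v"
    \<comment> \<open>Equality of weak types over \<open>B\<close> only provides automorphisms
      fixing finite subsets of \<open>B\<close>; \<open>F\<close> collects what this instance needs.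
      Composed with \<open>f\<close>, such an automorphism fixes \<open>a\<close> and the part of
      \<open>u\<close> and \<open>v\<close> in \<open>N\<close>, and it maps \<open>x\<close> to its
      copy in \<open>C\<close>.\<close>
    define F where "F = A \<union> set x \<union> (set u \<inter> N) \<union> (set v \<inter> N)"
    have "finite F" "F \<subseteq> B" using A x B(3) by (auto simp: F_def in_lists_conv_set)
    then have "eqv F a a1" using wtpD[OF aa1] by blast
    then obtain k where k: "k \<in> G" "\<And>z. z \<in> F \<Longrightarrow> k z = z" "map k a = a1" unfolding eqv_iff by blast
    define w where "w z = f (k z)" for z
    have w: "w \<in> G" unfolding w_def by (rule Aut_comp[OF f(1) k(1)])
    have "map w a = map f (map k a)" by (simp add: w_def)
    then have wa: "map w a = a" using fa1 k(3) by simp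
    have wN: "w z = z" if "z \<in> F" "z \<in> N" for z using that k(2) fN by (simp add: w_def)
    have wx: "map w x = map g x" using k(2) gx by (auto simp: w_def F_def)
    have wuv: "w z = z" if "z \<in> set u \<union> set v" for z
    proof (cases "z \<in> N")
      case True
      then show ?thesis using that wN by (auto simp: F_def)
    next
      case False
      then have "z \<in> set a" using that uv by (auto simp: in_lists_conv_set)
      then show ?thesis using wa by (metis map_eq_conv map_ident)
    qed
    have wA: "w z = z" if "z \<in> A" for z using that wN A(2) by (auto simp: F_def)
    have "eqv A (map g x @ u) (map g x @ v)" by (rule nosplitD[OF A(3) uv])
    obtain j where j: "j \<in> G" "\<And>x. x \<in> car M \<Longrightarrow> j (w x) = x" "\<And>x. x \<in> car M \<Longrightarrow> w (j x) = x"
      using Aut_inv[OF w] by blast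
    have uvM: "u \<in> lists (car M)" "v \<in> lists (car M)" using uv a(1) NM by (auto simp: in_lists_conv_set)
    have jA: "j ` A = A" and ju: "map j u = u" "map j v = v"
    proof -
      show "j ` A = A" using wA j(2) A NM by force
      have "map w u = u" "map w v = v" using wuv by (auto intro: map_idI)
      then show "map j u = u" "map j v = v" using map_inv_car[of j w, OF j(2)] uvM by metis+
    qed
    have "eqv (j ` A) (map j (map w x @ u)) (map j (map w x @ v))"
      using \<open>eqv A (map g x @ u) (map g x @ v)\<close> A NM xM uvM w unfolding wx[symmetric] by (intro eqv_map[OF j(1)]) auto
    then show "eqv A (x @ u) (x @ v)" using map_inv_car[of j w, OF j(2) xM] jA ju by (simp del: map_map)
  qed
  then show ?thesis using A unfolding ns_indep_iff by blast
qed

end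

section \<open>Imaginaries\<close>

definition lift :: "('a \<Rightarrow> 'a) \<Rightarrow> 'a imag \<Rightarrow> 'a imag" where
  "lift f p = (fst p, map f ` snd p)"

lemma lift_comp: "lift f (lift g p) = lift (\<lambda>x. f (g x)) p"
  by (simp add: lift_def image_image comp_def)

locale fur_imag = fur K M M' \<delta>
  for K :: "('a, 'r, 'f) aec_data" and M M' :: "('a, 'r, 'f) fo_struct" and \<delta> :: "'a rel" +
  fixes \<E> :: "'a list rel set"
  assumes family: "imaginary_family K M \<delta> \<E>"
begin

abbreviation Ueq :: "('a imag, 'a) ambient" where
  "Ueq \<equiv> ambient_eq K M \<delta> \<E>"

abbreviation re :: "'a list \<Rightarrow> 'a imag list" where
  "re \<equiv> map (real_elt M)"

lemma Ueq_simps [simp]: "pts Ueq = Meq \<E>" "auts Ueq = aut_eq K M \<E>" "bd Ueq = \<delta>"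
  by (simp_all add: ambient_eq_def)

lemma familyE:
  assumes "E \<in> \<E>"
  obtains n where "equiv (tuples n (car M)) E" "Field E = tuples n (car M)"
    "\<And>f x y. f \<in> G \<Longrightarrow> x \<in> tuples n (car M) \<Longrightarrow> y \<in> tuples n (car M) \<Longrightarrow> (x, y) \<in> E \<longleftrightarrow> (map f x, map f y) \<in> E"
proof -
  obtain n where n: "equiv (tuples n (car M)) E"
    "\<forall>f\<in>G. \<forall>a\<in>tuples n (car M). \<forall>b\<in>tuples n (car M). (a, b) \<in> E \<longleftrightarrow> (map f a, map f b) \<in> E"
    using family assms unfolding imaginary_family_def by auto
  have "E \<subseteq> tuples n (car M) \<times> tuples n (car M)" "refl_on (tuples n (car M)) E"
    using n(1) by (auto simp: equiv_def)
  then have "Field E = tuples n (car M)" by (auto simp: Field_def refl_on_def)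
  then show thesis using that n by blast
qed

lemma Field_lists: "E \<in> \<E> \<Longrightarrow> r \<in> Field E \<Longrightarrow> r \<in> lists (car M)"
  by (metis familyE in_listsI subsetD tuples_iff)

lemma map_Field: "f \<in> G \<Longrightarrow> E \<in> \<E> \<Longrightarrow> r \<in> Field E \<Longrightarrow> map f r \<in> Field E"
  by (metis familyE in_lists_conv_set map_car subsetI length_map subsetD tuples_iff)

lemma lift_quot:
  assumes f: "f \<in> G" and E: "E \<in> \<E>" and r: "r \<in> Field E"
  shows "lift f (quot E r) = quot E (map f r)"
proof -
  obtain n where n: "equiv (tuples n (car M)) E" "Field E = tuples n (car M)"
    "\<And>f x y. f \<in> G \<Longrightarrow> x \<in> tuples n (car M) \<Longrightarrow> y \<in> tuples n (car M) \<Longrightarrow> (x, y) \<in> E \<longleftrightarrow> (map f x, map f y) \<in> E"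
    using E by (rule familyE) blast
  have sub: "E \<subseteq> tuples n (car M) \<times> tuples n (car M)" using n(1) by (auto simp: equiv_def)
  have rt: "r \<in> tuples n (car M)" using r n(2) by simp
  have "map f ` (E `` {r}) = E `` {map f r}"
  proof
    show "map f ` (E `` {r}) \<subseteq> E `` {map f r}"
      using n(3)[OF f rt] sub by auto
    show "E `` {map f r} \<subseteq> map f ` (E `` {r})"
    proof
      fix s assume s: "s \<in> E `` {map f r}"
      then have st: "s \<in> tuples n (car M)" using sub by auto
      obtain g where g: "g \<in> G" "\<And>x. x \<in> car M \<Longrightarrow> g (f x) = x" "\<And>x. x \<in> car M \<Longrightarrow> f (g x) = x"
        using Aut_inv[OF f] by blast
      have sM: "s \<in> lists (car M)" using st by (auto simp: tuples_iff)
      have fg: "map f (map g s) = s" by (rule map_inv_car) (use g(3) sM in auto)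
      have gt: "map g s \<in> tuples n (car M)" using st g(1) by (auto simp: tuples_iff)
      have "(r, map g s) \<in> E" using n(3)[OF f rt gt] s fg by simp
      then show "s \<in> map f ` (E `` {r})" using fg by (intro image_eqI[of _ _ "map g s"]) auto
    qed
  qed
  then show ?thesis by (simp add: lift_def quot_def)
qed

lemma eq_rel_in: "eq_rel M \<in> \<E>" and eq_rel_Field: "x \<in> car M \<Longrightarrow> [x] \<in> Field (eq_rel M)"
  using family by (auto simp: imaginary_family_def eq_rel_def Field_def tuples_iff Id_on_def)

lemma MeqE:
  assumes "p \<in> Meq \<E>"
  obtains E r where "E \<in> \<E>" "r \<in> Field E" "p = quot E r"
  using assms by (auto simp: Meq_def sort_of_def)

lemma quot_Meq: "E \<in> \<E> \<Longrightarrow> r \<in> Field E \<Longrightarrow> quot E r \<in> Meq \<E>"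
  by (auto simp: Meq_def sort_of_def)

lemma real_Meq [simp]: "x \<in> car M \<Longrightarrow> real_elt M x \<in> Meq \<E>"
  by (simp add: real_elt_def quot_Meq eq_rel_in eq_rel_Field)

lemma re_Meq [simp]: "l \<in> lists (car M) \<Longrightarrow> re l \<in> lists (Meq \<E>)"
  by (auto simp: in_lists_conv_set)

lemma lift_real: "f \<in> G \<Longrightarrow> x \<in> car M \<Longrightarrow> lift f (real_elt M x) = real_elt M (f x)"
  using lift_quot[of f "eq_rel M" "[x]"] by (simp add: real_elt_def eq_rel_in eq_rel_Field)

lemma lift_re: "f \<in> G \<Longrightarrow> l \<in> lists (car M) \<Longrightarrow> map (lift f) (re l) = re (map f l)"
  by (auto simp: in_lists_conv_set lift_real)

lemma real_inj: "x \<in> car M \<Longrightarrow> y \<in> car M \<Longrightarrow> real_elt M x = real_elt M y \<longleftrightarrow> x = y"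
  by (auto simp: real_elt_def quot_def eq_rel_def tuples_iff Id_on_def)

lemma re_inj: "l \<in> lists (car M) \<Longrightarrow> l' \<in> lists (car M) \<Longrightarrow> re l = re l' \<longleftrightarrow> l = l'"
proof (rule inj_on_map_eq_map)
  assume "l \<in> lists (car M)" "l' \<in> lists (car M)"
  then have "set l \<union> set l' \<subseteq> car M" by auto
  then show "inj_on (real_elt M) (set l \<union> set l')" using real_inj unfolding inj_on_def by blast
qed

lemma lift_Meq [simp]: "f \<in> G \<Longrightarrow> p \<in> Meq \<E> \<Longrightarrow> lift f p \<in> Meq \<E>"
  by (metis MeqE lift_quot map_Field quot_Meq)

lemma lift_cong: "p \<in> Meq \<E> \<Longrightarrow> (\<And>x. x \<in> car M \<Longrightarrow> f x = g x) \<Longrightarrow> lift f p = lift g p"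
proof -
  assume p: "p \<in> Meq \<E>" and fg: "\<And>x. x \<in> car M \<Longrightarrow> f x = g x"
  obtain E r where E: "E \<in> \<E>" "r \<in> Field E" "p = quot E r" using p by (rule MeqE) blast
  have "s \<in> lists (car M)" if "s \<in> E `` {r}" for s
    using Field_lists[OF E(1), of s] that by (auto simp: Field_def)
  then have "map f s = map g s" if "s \<in> E `` {r}" for s
    using fg that by (auto simp: in_lists_conv_set)
  then have "map f ` (E `` {r}) = map g ` (E `` {r})" by (rule image_cong[OF refl])
  then show "lift f p = lift g p" by (simp add: lift_def E(3) quot_def)
qed

lemma lift_id: "p \<in> Meq \<E> \<Longrightarrow> (\<And>x. x \<in> car M \<Longrightarrow> f x = x) \<Longrightarrow> lift f p = p"
  using lift_cong[of p f "\<lambda>x. x"] by (simp add: lift_def)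

lemma on_reals_lift: "f \<in> G \<Longrightarrow> x \<in> car M \<Longrightarrow> on_reals M (lift f) x = f x"
  unfolding on_reals_def by (rule the_equality) (auto simp: lift_real real_inj)

lemma lift_aut:
  assumes f: "f \<in> G"
  shows "lift f \<in> aut_eq K M \<E>"
proof -
  obtain g where g: "g \<in> G" "\<And>x. x \<in> car M \<Longrightarrow> g (f x) = x" "\<And>x. x \<in> car M \<Longrightarrow> f (g x) = x"
    using Aut_inv[OF f] by blast
  have inv: "lift g (lift f p) = p" "lift f (lift g p) = p" if "p \<in> Meq \<E>" for p
    using lift_id[OF that, of "\<lambda>x. g (f x)"] lift_id[OF that, of "\<lambda>x. f (g x)"] g(2,3) by (simp_all add: lift_comp)
  have bij: "bij_betw (lift f) (Meq \<E>) (Meq \<E>)"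
    by (rule bij_betw_byWitness[of _ "lift g"]) (use inv f g(1) in auto)
  have sort: "p \<in> sort_of E \<longleftrightarrow> lift f p \<in> sort_of E" if "E \<in> \<E>" "p \<in> Meq \<E>" for E p
  proof -
    have s: "lift h q \<in> sort_of E" if "h \<in> G" "q \<in> sort_of E" for h q
      using that \<open>E \<in> \<E>\<close> by (auto simp: sort_of_def lift_quot map_Field)
    show ?thesis using s[OF f, of p] s[OF g(1), of "lift f p"] inv(1)[OF that(2)] by auto
  qed
  have "iso_struct (lang K) M M (on_reals M (lift f))"
    using Aut_cong[OF f, of "on_reals M (lift f)"] on_reals_lift[OF f] by (simp add: Aut_def)
  moreover have "lift f (quot E r) = quot E (map (on_reals M (lift f)) r)" if "E \<in> \<E>" "r \<in> Field E" for E r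
  proof -
    have "map (on_reals M (lift f)) r = map f r"
      using Field_lists[OF that] on_reals_lift[OF f] by (auto simp: in_lists_conv_set)
    then show ?thesis using lift_quot[OF f that] by metis
  qed
  ultimately show ?thesis using bij sort by (simp add: aut_eq_def)
qed

text \<open>The functions to the imaginary sorts are preserved, so an automorphism is determined by
  its action on the home sort. Automorphisms of \<open>M\<close> and of its imaginary expansion are
  thereby interchangeable.\<close>

lemma aut_lift:
  assumes "h \<in> aut_eq K M \<E>"
  shows "on_reals M h \<in> G" "\<And>p. p \<in> Meq \<E> \<Longrightarrow> h p = lift (on_reals M h) p"
proof -
  show G: "on_reals M h \<in> G" using assms by (simp add: aut_eq_def Aut_def)
  show "h p = lift (on_reals M h) p" if p: "p \<in> Meq \<E>" for p
  proof -
    obtain E r where E: "E \<in> \<E>" "r \<in> Field E" "p = quot E r" using p by (rule MeqE) blast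
    then show ?thesis using assms lift_quot[OF G E(1,2)] by (simp add: aut_eq_def)
  qed
qed

lemma gtp_Ueq_iff:
  assumes A: "A \<subseteq> Meq \<E>" and x: "x \<in> lists (Meq \<E>)"
  shows "gtp_eq Ueq A x y \<longleftrightarrow> (\<exists>f\<in>G. (\<forall>p\<in>A. lift f p = p) \<and> map (lift f) x = y)"
proof
  assume "gtp_eq Ueq A x y"
  then obtain h where h: "h \<in> aut_eq K M \<E>" "\<forall>p\<in>A. h p = p" "map h x = y"
    by (auto simp: gtp_eq_def aut_over_def)
  have "map (lift (on_reals M h)) x = y"
    using aut_lift(2)[OF h(1)] x h(3) by (auto simp: in_lists_conv_set)
  moreover have "lift (on_reals M h) p = p" if "p \<in> A" for p
    using aut_lift(2)[OF h(1), of p] h(2) A that by auto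
  ultimately show "\<exists>f\<in>G. (\<forall>p\<in>A. lift f p = p) \<and> map (lift f) x = y"
    using aut_lift(1)[OF h(1)] by blast
next
  assume "\<exists>f\<in>G. (\<forall>p\<in>A. lift f p = p) \<and> map (lift f) x = y"
  then obtain f where "f \<in> G" "\<forall>p\<in>A. lift f p = p" "map (lift f) x = y" by blast
  then show "gtp_eq Ueq A x y" using lift_aut unfolding gtp_eq_def aut_over_def by (intro bexI[of _ "lift f"]) auto
qed

text \<open>The entries of a representative of \<open>p\<close> serve. Such finite supports reduce
  statements about imaginary parameters to real ones.\<close>

lemma cover_exists: "\<exists>cv. \<forall>p\<in>Meq \<E>. finite (cv p) \<and> cv p \<subseteq> car M \<and>
    (\<forall>f\<in>G. (\<forall>z\<in>cv p. f z = z) \<longrightarrow> lift f p = p)"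
proof -
  have "\<exists>c. finite c \<and> c \<subseteq> car M \<and> (\<forall>f\<in>G. (\<forall>z\<in>c. f z = z) \<longrightarrow> lift f p = p)" if p: "p \<in> Meq \<E>" for p
  proof -
    obtain E r where E: "E \<in> \<E>" "r \<in> Field E" "p = quot E r" using p by (rule MeqE) blast
    have "lift f p = p" if "f \<in> G" "\<forall>z\<in>set r. f z = z" for f
      using lift_quot[OF that(1) E(1,2)] that(2) E(3) by (simp add: map_idI)
    then show ?thesis using Field_lists[OF E(1,2)] by (intro exI[of _ "set r"]) (auto simp: in_lists_conv_set)
  qed
  then show ?thesis by metis
qed

definition cv :: "'a imag \<Rightarrow> 'a set" where
  "cv = (SOME cv. \<forall>p\<in>Meq \<E>. finite (cv p) \<and> cv p \<subseteq> car M \<and> (\<forall>f\<in>G. (\<forall>z\<in>cv p. f z = z) \<longrightarrow> lift f p = p))"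

lemma cv:
  assumes "p \<in> Meq \<E>"
  shows "finite (cv p)" "cv p \<subseteq> car M" "\<And>f. f \<in> G \<Longrightarrow> (\<And>z. z \<in> cv p \<Longrightarrow> f z = z) \<Longrightarrow> lift f p = p"
proof -
  have "\<forall>p\<in>Meq \<E>. finite (cv p) \<and> cv p \<subseteq> car M \<and> (\<forall>f\<in>G. (\<forall>z\<in>cv p. f z = z) \<longrightarrow> lift f p = p)"
    unfolding cv_def using cover_exists by (rule someI_ex)
  then show "finite (cv p)" "cv p \<subseteq> car M" "\<And>f. f \<in> G \<Longrightarrow> (\<And>z. z \<in> cv p \<Longrightarrow> f z = z) \<Longrightarrow> lift f p = p"
    using assms by auto
qed

lemma cv_small: "C \<subseteq> Meq \<E> \<Longrightarrow> |C| <o \<delta> \<Longrightarrow> |\<Union>(cv ` C)| <o \<delta>"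
  using cv(1) by (intro small_UN) (auto intro!: small_countable countable_finite)

lemma cv_car: "C \<subseteq> Meq \<E> \<Longrightarrow> \<Union>(cv ` C) \<subseteq> car M"
  using cv(2) by blast

section \<open>The game GI\<close>

text \<open>Replaces a strategy of player I by an invariant \<open>I\<close>, to be maintained
  against an arbitrary finite answer \<open>X\<close>. The range \<open>i \<le> n\<close> gives
  \<open>Suc n\<close> moves, one more than a winning strategy for player II permits.\<close>

lemma game_survival:
  assumes win: "GI_win U n a A N" and A: "finite A" "A \<subseteq> N" and start: "I 0 a"
    and step: "\<And>i x X. i \<le> n \<Longrightarrow> I i x \<Longrightarrow> finite X \<Longrightarrow> X \<subseteq> N \<Longrightarrow> \<exists>y Y. GI_move U N (x, X) (y, Y) \<and> I (Suc i) y"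
  shows False
proof -
  obtain \<sigma> where \<sigma>: "\<And>ms. GI_play U a A N \<sigma> ms \<Longrightarrow> length ms \<le> n \<and>
     (ms \<noteq> [] \<longrightarrow> finite (\<sigma> ms) \<and> \<sigma> ms \<subseteq> N \<and> snd (last ms) \<subseteq> \<sigma> ms)"
    using win unfolding GI_win_def by blast
  have "\<exists>ms. length ms = i \<and> GI_play U a A N \<sigma> ms \<and> I i (fst (GI_pos a A \<sigma> ms))" if "i \<le> Suc n" for i
    using that
  proof (induction i)
    case 0
    then show ?case using start by (intro exI[of _ "[]"]) (simp add: GI_play_def GI_pos_def)
  next
    case (Suc i)
    then obtain ms where ms: "length ms = i" "GI_play U a A N \<sigma> ms" "I i (fst (GI_pos a A \<sigma> ms))" by auto
    define x X where "x = fst (GI_pos a A \<sigma> ms)" and "X = snd (GI_pos a A \<sigma> ms)"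
    have X: "finite X" "X \<subseteq> N" using \<sigma>[OF ms(2)] A by (auto simp: X_def GI_pos_def)
    obtain y Y where y: "GI_move U N (x, X) (y, Y)" "I (Suc i) y"
      using step[OF _ _ X, of i x] Suc.prems ms(3) by (auto simp: x_def)
    have "GI_play U a A N \<sigma> (ms @ [(y, Y)])"
      unfolding GI_play_def
    proof (intro allI impI)
      fix j assume "j < length (ms @ [(y, Y)])"
      then consider "j < length ms" | "j = length ms" by fastforce
      then show "GI_move U N (GI_pos a A \<sigma> (take j (ms @ [(y, Y)]))) ((ms @ [(y, Y)]) ! j)"
        using ms(2) y(1) by cases (simp_all add: GI_play_def nth_append x_def X_def)
    qed
    then show ?case using y(2) ms(1) by (intro exI[of _ "ms @ [(y, Y)]"]) (simp add: GI_pos_def)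
  qed
  from this[of "Suc n"] show False using \<sigma> by fastforce
qed

end

section \<open>Morley sequences of a type with canonical base\<close>

text \<open>\<open>base\<close> is the canonical base property for automorphisms of the form
  \<open>lift f\<close>; by \<open>aut_lift\<close> every automorphism agrees with one of these on
  \<open>Meq \<E>\<close>.\<close>

locale canonical = fur_imag K M M' \<delta> \<E>
  for K :: "('a, 'r, 'f) aec_data" and M M' :: "('a, 'r, 'f) fo_struct" and \<delta> :: "'a rel" and \<E> :: "'a list rel set" +
  fixes b :: "'a list" and \<alpha> :: "'a imag list"
  assumes b: "b \<in> lists (car M')" and \<alpha>: "\<alpha> \<in> lists (Meq \<E>)"
    and base: "\<And>f. f \<in> G \<Longrightarrow> fixes_global_type M (lift f) (global_type_of K M M' b) \<longleftrightarrow> map (lift f) \<alpha> = \<alpha>"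
begin

abbreviation fx :: "('a \<Rightarrow> 'a) \<Rightarrow> bool" where
  "fx f \<equiv> map (lift f) \<alpha> = \<alpha>"

text \<open>
  Write \<open>p = t(b/M)\<close>.  \<open>Pr d X\<close> says that \<open>d\<close> in \<open>M\<close> realizes \<open>p\<close> over \<open>X\<close>, \<open>Cov X\<close> that \<open>X\<close>
  determines \<open>\<alpha>\<close>, and \<open>PM X ds\<close> that \<open>ds\<close> is a Morley sequence of \<open>p\<close> over \<open>X\<close>.
\<close>

definition Pr :: "'a list \<Rightarrow> 'a set \<Rightarrow> bool" where
  "Pr d X \<longleftrightarrow> d \<in> lists (car M) \<and> wtp_eq S.U X d b"

definition Cov :: "'a set \<Rightarrow> bool" where
  "Cov X \<longleftrightarrow> X \<subseteq> car M \<and> (\<forall>f\<in>G. (\<forall>z\<in>X. f z = z) \<longrightarrow> fx f)"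

lemma CovD: "Cov X \<Longrightarrow> f \<in> G \<Longrightarrow> (\<And>z. z \<in> X \<Longrightarrow> f z = z) \<Longrightarrow> fx f"
  by (simp add: Cov_def)

lemma Cov_mono: "Cov X \<Longrightarrow> X \<subseteq> Y \<Longrightarrow> Y \<subseteq> car M \<Longrightarrow> Cov Y"
  unfolding Cov_def by blast

lemma Cov_exists: "\<exists>c. finite c \<and> Cov c"
proof (intro exI conjI)
  have sub: "set \<alpha> \<subseteq> Meq \<E>" using \<alpha> by auto
  then show "finite (\<Union>(cv ` set \<alpha>))" using cv(1) by blast
  show "Cov (\<Union>(cv ` set \<alpha>))"
    unfolding Cov_def
  proof (intro conjI ballI impI)
    show "\<Union>(cv ` set \<alpha>) \<subseteq> car M" using cv_car[OF sub] .
    fix f assume f: "f \<in> G" "\<forall>z\<in>\<Union>(cv ` set \<alpha>). f z = z"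
    have "lift f p = p" if "p \<in> set \<alpha>" for p
      using cv(3)[of p f] f that sub by blast
    then show "fx f" by (simp add: map_idI)
  qed
qed

lemma fx_comp: "fx f \<Longrightarrow> fx g \<Longrightarrow> fx (\<lambda>x. f (g x))"
proof -
  assume "fx f" "fx g"
  then have "map (lift f) (map (lift g) \<alpha>) = \<alpha>" by metis
  then show "fx (\<lambda>x. f (g x))" by (simp add: lift_comp comp_def)
qed

lemma fx_inv:
  assumes "f \<in> G" "fx f"
  obtains g where "g \<in> G" "fx g" "\<And>x. x \<in> car M \<Longrightarrow> g (f x) = x" "\<And>x. x \<in> car M \<Longrightarrow> f (g x) = x"
proof -
  obtain g where g: "g \<in> G" "\<And>x. x \<in> car M \<Longrightarrow> g (f x) = x" "\<And>x. x \<in> car M \<Longrightarrow> f (g x) = x"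
    using Aut_inv[OF assms(1)] by blast
  have "lift g (lift f p) = p" if "p \<in> set \<alpha>" for p
    using lift_id[of p "\<lambda>x. g (f x)"] g(2) that \<alpha> by (auto simp: lift_comp)
  then have "map (lift g) (map (lift f) \<alpha>) = \<alpha>" by (simp add: map_idI)
  then have "fx g" using assms(2) by simp
  then show thesis using that g by blast
qed

lemma Pr_car: "Pr d X \<Longrightarrow> d \<in> lists (car M)"
  by (simp add: Pr_def)

lemma Pr_mono: "Pr d X \<Longrightarrow> Y \<subseteq> X \<Longrightarrow> Pr d Y"
  unfolding Pr_def wtp_eq_def by (meson order_trans)

lemma Pr_exists:
  assumes "X \<subseteq> car M" "|X| <o \<delta>"
  obtains d where "Pr d X"
proof -
  have "set b \<subseteq> car M'" "|set b| <o \<delta>" using b by (auto intro: small_countable countable_finite)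
  then obtain s where s: "s \<in> S.G" "\<And>x. x \<in> X \<Longrightarrow> s x = x" "s ` set b \<subseteq> car M"
    using embed_over[OF assms] by blast
  have "S.eqv X b (map s b)" using s by (intro S.eqvI[of s]) auto
  then have "S.eqv X (map s b) b" using S.eqv_sym b assms(1) M_super(3) by blast
  then have "Pr (map s b) X" using s(3) S.eqv_mono unfolding Pr_def wtp_eq_def by (auto simp: in_lists_conv_set)
  then show thesis by (rule that)
qed

lemma Pr_eqv:
  assumes "Pr d X" "Pr d' X" "finite X" "X \<subseteq> car M"
  shows "eqv X d d'"
proof -
  have "S.eqv X d b" "S.eqv X d' b" using assms by (auto simp: Pr_def S.wtp_finite)
  moreover have "X \<subseteq> car M'" "d' \<in> lists (car M')"
    using assms M_super(3) by (auto simp: Pr_def in_lists_conv_set)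
  ultimately have "S.eqv X d d'" using S.eqv_sym S.eqv_trans by meson
  then show ?thesis
    using eqv_super[of X d d'] assms Pr_car by (simp add: small_countable countable_finite)
qed

lemma eqv_Pr:
  assumes "Pr d X" "eqv X d d'" "finite X" "X \<subseteq> car M"
  shows "Pr d' X"
proof -
  have d': "d' \<in> lists (car M)" using eqv_lists assms(1,2) Pr_car by blast
  have "S.eqv X d d'"
    using eqv_super[of X d d'] assms Pr_car d' by (simp add: small_countable countable_finite)
  moreover have "S.eqv X d b" using assms by (auto simp: Pr_def S.wtp_finite)
  moreover have "X \<subseteq> car M'" "d \<in> lists (car M')"
    using assms M_super(3) by (auto simp: Pr_def in_lists_conv_set)
  ultimately have "S.eqv X d' b" using S.eqv_sym S.eqv_trans by meson
  then show ?thesis using d' assms(3) by (simp add: Pr_def S.wtp_finite)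
qed

lemma Pr_finite: "d \<in> lists (car M) \<Longrightarrow> (\<And>B. finite B \<Longrightarrow> B \<subseteq> X \<Longrightarrow> Pr d B) \<Longrightarrow> Pr d X"
  unfolding Pr_def wtp_eq_def by blast

text \<open>The canonical base property enters here: \<open>fx f\<close> means that \<open>f\<close>
  fixes \<open>p\<close>. As a global type is a family over finite sets, the claim is checked on
  finite parts of the image.\<close>

lemma Pr_map:
  assumes f: "f \<in> G" "fx f" and d: "Pr d X" and X: "X \<subseteq> car M"
  shows "Pr (map f d) (f ` X)"
proof (rule Pr_finite)
  show dM: "map f d \<in> lists (car M)" using f(1) Pr_car[OF d] by simp
  fix B' assume B': "finite B'" "B' \<subseteq> f ` X"
  then obtain B where B: "B \<subseteq> X" "finite B" "B' = f ` B" by (metis finite_subset_image)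
  have BM: "B \<subseteq> car M" using B(1) X by blast
  have "fixes_global_type M (lift f) (global_type_of K M M' b)" using base f by blast
  moreover have "on_reals M (lift f) ` B = B'"
    unfolding B(3) by (rule image_cong[OF refl]) (use on_reals_lift[OF f(1)] BM in blast)
  moreover have "B' \<subseteq> car M" using B(3) BM f(1) by auto
  moreover have "d \<in> global_type_of K M M' b B"
  proof -
    have "S.eqv B d b" using Pr_mono[OF d B(1)] B(2) by (simp add: Pr_def S.wtp_finite)
    then have "S.eqv B b d" using S.eqv_sym Pr_car[OF d] BM M_super(3) by (meson lists_mono order_trans subsetD)
    then show ?thesis using B(2) BM Pr_car[OF d] M_super(3) lists_mono
      by (auto simp: global_type_of_def gtp_def)
  qed
  ultimately have "map (on_reals M (lift f)) d \<in> global_type_of K M M' b B'"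
    using B(2) B'(1) BM Pr_car[OF d] unfolding fixes_global_type_def by blast
  moreover have "map (on_reals M (lift f)) d = map f d"
    using on_reals_lift[OF f(1)] Pr_car[OF d] by (auto simp: in_lists_conv_set)
  ultimately have "S.eqv B' b (map f d)" using B'(1) \<open>B' \<subseteq> car M\<close> by (simp add: global_type_of_def gtp_def)
  then have "S.eqv B' (map f d) b" using S.eqv_sym[OF _ b] \<open>B' \<subseteq> car M\<close> M_super(3) by blast
  then show "Pr (map f d) B'" using dM B'(1) by (simp add: Pr_def S.wtp_finite)
qed

lemma Pr_map_iff:
  assumes f: "f \<in> G" "fx f" and d: "d \<in> lists (car M)" and X: "X \<subseteq> car M"
  shows "Pr (map f d) (f ` X) \<longleftrightarrow> Pr d X"
proof
  assume P: "Pr (map f d) (f ` X)"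
  obtain g where g: "g \<in> G" "fx g" "\<And>x. x \<in> car M \<Longrightarrow> g (f x) = x" "\<And>x. x \<in> car M \<Longrightarrow> f (g x) = x"
    using fx_inv[OF f] by blast
  have "f ` X \<subseteq> car M" using f(1) X by auto
  then have "Pr (map g (map f d)) (g ` f ` X)" by (rule Pr_map[OF g(1,2) P])
  moreover have "map g (map f d) = d" by (rule map_inv_car) (use g(3) d in auto)
  moreover have "g ` f ` X = X" using g(3) X by force
  ultimately show "Pr d X" by simp
qed (use Pr_map[OF f _ X] in blast)

primrec PM :: "'a set \<Rightarrow> 'a list list \<Rightarrow> bool" where
  "PM X [] \<longleftrightarrow> True"
| "PM X (d # ds) \<longleftrightarrow> Pr d X \<and> PM (X \<union> set d) ds"

declare PM.simps [simp del]
lemma PM_Nil [simp]: "PM X []" and PM_Cons: "PM X (d # ds) \<longleftrightarrow> Pr d X \<and> PM (X \<union> set d) ds"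
  by (simp_all add: PM.simps)

end

section \<open>Existence, uniqueness and symmetry of Morley sequences\<close>

context canonical
begin

lemma PM_lists: "PM X ds \<Longrightarrow> d \<in> set ds \<Longrightarrow> d \<in> lists (car M)"
  by (induction ds arbitrary: X) (auto simp: PM_Cons dest: Pr_car)

lemma PM_concat: "PM X ds \<Longrightarrow> concat ds \<in> lists (car M)"
  using PM_lists by (fastforce simp: in_lists_conv_set)

lemma PM_mono: "PM X ds \<Longrightarrow> Y \<subseteq> X \<Longrightarrow> PM Y ds"
proof (induction ds arbitrary: X Y)
  case (Cons d ds)
  have "Y \<union> set d \<subseteq> X \<union> set d" using Cons.prems(2) by blast
  then show ?case using Cons Pr_mono by (auto simp: PM_Cons)
qed simp

lemma PM_exists:
  assumes "X \<subseteq> car M" "|X| <o \<delta>"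
  shows "\<exists>ds. length ds = k \<and> PM X ds"
  using assms
proof (induction k arbitrary: X)
  case (Suc k)
  obtain d where d: "Pr d X" using Pr_exists[OF Suc.prems] by blast
  have "X \<union> set d \<subseteq> car M" using Suc.prems(1) Pr_car[OF d] by auto
  moreover have "|X \<union> set d| <o \<delta>"
    by (rule small_Un[OF Suc.prems(2)]) (simp add: small_countable countable_finite)
  ultimately obtain ds where "length ds = k" "PM (X \<union> set d) ds" using Suc.IH by blast
  then show ?case using d by (intro exI[of _ "d # ds"]) (simp add: PM_Cons)
qed simp

lemma PM_map:
  assumes f: "f \<in> G" "fx f" and "PM X ds" "X \<subseteq> car M"
  shows "PM (f ` X) (map (map f) ds)"
  using assms(3,4)
proof (induction ds arbitrary: X)
  case (Cons d ds)
  have d: "Pr d X" "PM (X \<union> set d) ds" using Cons.prems(1) by (simp_all add: PM_Cons)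
  have "X \<union> set d \<subseteq> car M" using Cons.prems(2) Pr_car[OF d(1)] by auto
  then have "PM (f ` (X \<union> set d)) (map (map f) ds)" using Cons.IH d(2) by blast
  moreover have "Pr (map f d) (f ` X)" using Pr_map[OF f d(1) Cons.prems(2)] .
  ultimately show ?case by (simp add: PM_Cons image_Un)
qed simp

text \<open>Induction along the sequence: an automorphism over \<open>X\<close> moving
  \<open>d\<close> to \<open>d'\<close> fixes \<open>\<alpha>\<close>, because \<open>X\<close>
  determines it, and therefore carries the rest to a Morley sequence over \<open>X\<close> and
  \<open>d'\<close>.\<close>

lemma PM_unique:
  assumes "PM X ds" "PM X ds'" "length ds = length ds'" and "finite X" "Cov X"
  shows "\<exists>f\<in>G. (\<forall>x\<in>X. f x = x) \<and> map (map f) ds = ds'"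
  using assms
proof (induction ds' arbitrary: X ds)
  case Nil
  then show ?case using Aut_id by (intro bexI[of _ "\<lambda>x. x"]) auto
next
  case (Cons d' es)
  then obtain d ds0 where ds: "ds = d # ds0" by (cases ds) auto
  have P: "Pr d X" "PM (X \<union> set d) ds0" "Pr d' X" "PM (X \<union> set d') es"
    using Cons.prems ds by (simp_all add: PM_Cons)
  have X: "X \<subseteq> car M" using Cons.prems(5) by (simp add: Cov_def)
  obtain f where f: "f \<in> G" "\<And>x. x \<in> X \<Longrightarrow> f x = x" "map f d = d'"
    using Pr_eqv[OF P(1,3) Cons.prems(4) X] unfolding eqv_iff by blast
  have fxf: "fx f" using CovD[OF Cons.prems(5) f(1,2)] .
  have XM: "X \<union> set d \<subseteq> car M" "X \<union> set d' \<subseteq> car M" using X Pr_car P(1,3) by auto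
  have "f ` X = X" using f(2) by auto
  then have "f ` (X \<union> set d) = X \<union> set d'" using f(3) by (simp add: image_Un flip: set_map)
  then have PM1: "PM (X \<union> set d') (map (map f) ds0)" using PM_map[OF f(1) fxf P(2) XM(1)] by simp
  have "length (map (map f) ds0) = length es" using Cons.prems(3) ds by simp
  moreover have "Cov (X \<union> set d')" using Cov_mono[OF Cons.prems(5) Un_upper1 XM(2)] .
  ultimately obtain g where g: "g \<in> G" "\<forall>x\<in>X \<union> set d'. g x = x" "map (map g) (map (map f) ds0) = es"
    using Cons.IH[OF PM1 P(4)] Cons.prems(4) by blast
  have "map g (map f d) = d'" using g(2) f(3) by (simp add: map_idI)
  then have "map (map (\<lambda>x. g (f x))) ds = d' # es" using g(3) by (simp add: ds comp_def)
  then show ?case using Aut_comp[OF g(1) f(1)] g(2) f(2) by (intro bexI[of _ "\<lambda>x. g (f x)"]) auto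
qed

lemma concat_map_map: "concat (map (map f) ds) = map f (concat ds)"
  by (simp add: map_concat)

lemma map_map_cong: "map f (concat dss) = map g (concat dss) \<Longrightarrow> map (map f) dss = map (map g) dss"
  by auto

lemma map_fixes: "map f xs = xs \<Longrightarrow> x \<in> set xs \<Longrightarrow> f x = x"
  by (induction xs) auto

lemma Cov_image:
  assumes f: "f \<in> G" "fx f" and X: "Cov X"
  shows "Cov (f ` X)"
  unfolding Cov_def
proof (intro conjI ballI impI)
  have XM: "X \<subseteq> car M" using X by (simp add: Cov_def)
  then show "f ` X \<subseteq> car M" using f(1) by auto
  fix w assume w: "w \<in> G" "\<forall>z\<in>f ` X. w z = z"
  obtain g where g: "g \<in> G" "fx g" "\<And>x. x \<in> car M \<Longrightarrow> g (f x) = x" "\<And>x. x \<in> car M \<Longrightarrow> f (g x) = x"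
    using fx_inv[OF f] by blast
  have "g (w (f z)) = z" if "z \<in> X" for z using w(2) g(3)[of z] that XM by auto
  then have "fx (\<lambda>x. g (w (f x)))"
    using CovD[OF X Aut_comp[OF g(1) Aut_comp[OF w(1) f(1)]]] by blast
  then have "fx (\<lambda>x. f (g (w (f (g x)))))" using fx_comp[OF f(2) fx_comp[OF _ g(2)]] by blast
  moreover have "map (lift (\<lambda>x. f (g (w (f (g x)))))) \<alpha> = map (lift w) \<alpha>"
  proof (rule map_cong[OF refl])
    fix p assume "p \<in> set \<alpha>"
    then show "lift (\<lambda>x. f (g (w (f (g x))))) p = lift w p" by (intro lift_cong) (use \<alpha> g(1,4) w(1) in auto)
  qed
  ultimately show "fx w" by simp
qed

text \<open>If \<open>h\<close> moves \<open>u\<close> to \<open>v\<close> over \<open>c\<close>,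
  then \<open>h\<close> fixes \<open>\<alpha>\<close>, so the image of the sequence is again a
  Morley sequence of \<open>p\<close> over \<open>c\<close> and \<open>v\<close>. By uniqueness it
  can be moved back to the sequence itself while \<open>v\<close> stays fixed.\<close>

lemma PM_nosplit:
  assumes c: "finite c" "Cov c" "c \<subseteq> D" and D: "D \<subseteq> car M" and ds: "PM D ds"
  shows "nosplit (concat ds) D c"
  unfolding nosplit_def
proof (intro ballI impI)
  fix u v assume u: "u \<in> lists D" and v: "v \<in> lists D" and e: "eqv c u v"
  then obtain h where h: "h \<in> G" "\<And>x. x \<in> c \<Longrightarrow> h x = x" "map h u = v" unfolding eqv_iff by blast
  have fxh: "fx h" using CovD[OF c(2) h(1,2)] .
  have uM: "c \<union> set u \<subseteq> car M" and vM: "c \<union> set v \<subseteq> car M" using u v c D by auto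
  have "c \<union> set u \<subseteq> D" "c \<union> set v \<subseteq> D" using u v c by auto
  then have P: "PM (c \<union> set u) ds" "PM (c \<union> set v) ds" using PM_mono[OF ds] by blast+
  have "h ` c = c" using h(2) by auto
  then have "h ` (c \<union> set u) = c \<union> set v" using h(3) by (simp add: image_Un flip: set_map)
  then have "PM (c \<union> set v) (map (map h) ds)" using PM_map[OF h(1) fxh P(1) uM] by simp
  then obtain k where k: "k \<in> G" "\<forall>x\<in>c \<union> set v. k x = x" "map (map k) (map (map h) ds) = ds"
  proof -
    have "finite (c \<union> set v)" "Cov (c \<union> set v)" using c(1) Cov_mono[OF c(2) _ vM] by auto
    then show thesis using PM_unique[OF \<open>PM (c \<union> set v) (map (map h) ds)\<close> P(2)] that by (metis length_map)
  qed
  have "map k (map h (concat ds)) = concat ds" using k(3) by (metis concat_map_map)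
  moreover have "map k (map h u) = v" using h(3) k(2) by (simp add: map_idI)
  ultimately have "map (\<lambda>x. k (h x)) (concat ds @ u) = concat ds @ v" by (simp add: comp_def)
  then show "eqv c (concat ds @ u) (concat ds @ v)"
    using Aut_comp[OF k(1) h(1)] k(2) h(2) by (intro eqvI[of "\<lambda>x. k (h x)"]) auto
qed

lemma PM_symmetry:
  assumes N: "str N" "countable N" and B: "str B" "countable B" "N \<subseteq> B"
    and c: "finite c" "Cov c" "c \<subseteq> N" and ds: "PM B ds" and x: "x \<in> lists B"
  obtains F where "finite F" "c \<subseteq> F" "F \<subseteq> N" "nosplit x (N \<union> set (concat ds)) F"
proof -
  have BM: "B \<subseteq> car M" using str_car B(1) .
  have "nosplit (concat ds) (N \<union> B) c"
    using PM_nosplit[OF c(1,2) _ BM ds] c(3) B(3) by (simp add: Un_absorb1)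
  then have "ns_indep U (concat ds) N B" unfolding ns_indep_iff using c by blast
  then obtain F where F: "finite F" "F \<subseteq> N" "nosplit x (N \<union> set (concat ds)) F"
    using nosplit_symmetry[OF N B PM_concat[OF ds] _ x] unfolding ns_indep_iff by blast
  have "nosplit x (N \<union> set (concat ds)) (F \<union> c)"
    using nosplit_mono[OF F(3), of "F \<union> c"] F c by auto
  then show thesis using that[of "F \<union> c"] F c by auto
qed

text \<open>Let \<open>d0\<close> realize \<open>p\<close> over a model containing \<open>N\<close>
  and \<open>x\<close>. By symmetry \<open>x\<close> does not split over a finite \<open>F\<close>
  on \<open>N\<close> and \<open>d0\<close>, so a tuple of \<open>N\<close> that looks like
  \<open>d0\<close> over \<open>F\<close> also looks like it over \<open>x\<close>.\<close>

lemma Pr_limit: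
  assumes N: "str N" "countable N" and c: "finite c" "Cov c" "c \<subseteq> N" and x: "x \<in> lists (car M)"
  shows "\<exists>F. finite F \<and> F \<subseteq> N \<and> (\<forall>d\<in>lists N. Pr d F \<longrightarrow> Pr d (set x))"
proof -
  have "countable (N \<union> set x)" "N \<union> set x \<subseteq> car M"
    using N x str_car[OF N(1)] by (auto simp: countable_finite)
  then obtain B where B: "str B" "N \<union> set x \<subseteq> B" "countable B" using LS_countable[OF str_M] by metis
  obtain d0 where d0: "Pr d0 B" using Pr_exists[OF str_car[OF B(1)] small_countable[OF B(3)]] by blast
  then have P: "PM B [d0]" by (simp add: PM_Cons)
  have "x \<in> lists B" "N \<subseteq> B" using B(2) by auto
  then obtain F where F: "finite F" "c \<subseteq> F" "F \<subseteq> N" "nosplit x (N \<union> set (concat [d0])) F"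
    using PM_symmetry[OF N B(1,3) _ c P] by metis
  have FM: "F \<subseteq> car M" using F(3) str_car[OF N(1)] by blast
  have "Pr d (set x)" if d: "d \<in> lists N" "Pr d F" for d
  proof -
    have "Pr d0 F" using Pr_mono[OF d0] F(3) B(2) by blast
    then have "eqv F d0 d" using Pr_eqv d(2) F(1) FM by blast
    moreover have "d0 \<in> lists (N \<union> set (concat [d0]))" "d \<in> lists (N \<union> set (concat [d0]))" using d(1) by auto
    ultimately have "eqv F (x @ d0) (x @ d)" using nosplitD[OF F(4)] by blast
    then obtain f where "f \<in> G" "map f x = x" "map f d0 = d" unfolding eqv_iff by auto
    moreover then have "f z = z" if "z \<in> set x" for z using that by (metis map_eq_conv map_ident)
    ultimately have "eqv (set x) d0 d" by (intro eqvI[of f]) auto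
    moreover have "Pr d0 (set x)" using Pr_mono[OF d0] B(2) by blast
    ultimately show ?thesis using eqv_Pr x by auto
  qed
  then show ?thesis using F by blast
qed

text \<open>
  Given a long Morley sequence all of whose members fail to realize \<open>p\<close> at \<open>x\<close>, player I survives by
  moving \<open>x\<close> so that one more member of the sequence lies in \<open>N\<close>.
\<close>

lemma Pr_majority:
  assumes x: "x \<in> lists (car M)"
  obtains n where "\<And>N c ds. str N \<Longrightarrow> countable N \<Longrightarrow> finite c \<Longrightarrow> Cov c \<Longrightarrow> c \<subseteq> N \<Longrightarrow>
    PM N ds \<Longrightarrow> length ds = n \<Longrightarrow> \<exists>d\<in>set ds. Pr d (set x)"
proof -
  obtain n where n: "\<And>N. model K M \<delta> N \<Longrightarrow> countable N \<Longrightarrow> GI_win U n x {} N"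
    using fur_facts(10) x unfolding AIV_def by (metis empty_subsetI finite.emptyI)
  show thesis
  proof (rule that[of "Suc n"], rule ccontr)
    fix N c ds
    assume N: "str N" "countable N" and c: "finite c" "Cov c" "c \<subseteq> N"
      and ds: "PM N ds" "length ds = Suc n" and bad: "\<not> (\<exists>d\<in>set ds. Pr d (set x))"
    have NM: "N \<subseteq> car M" using str_car N(1) .
    \<comment> \<open>After \<open>i\<close> moves there remain \<open>Suc n - i\<close> members,
      forming a Morley sequence over \<open>N\<close>, that all fail at the current tuple. Each move
      consumes one, and \<open>Suc n\<close> members pay for one move more than player II
      allows.\<close>
    define I where "I i y \<longleftrightarrow> y \<in> lists (car M) \<and>
      (\<exists>ds. PM N ds \<and> length ds = Suc n - i \<and> (\<forall>d\<in>set ds. \<not> Pr d (set y)))" for i y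
    show False
    proof (rule game_survival[of n x "{}" N I])
      show "GI_win U n x {} N" using n countable_model N by blast
      show "I 0 x" using x ds bad by (auto simp: I_def)
      fix i y X
      assume i: "i \<le> n" and Iy: "I i y" and X: "finite X" "X \<subseteq> N"
      obtain ds where ds: "PM N ds" "length ds = Suc n - i" "\<forall>d\<in>set ds. \<not> Pr d (set y)" and y: "y \<in> lists (car M)"
        using Iy unfolding I_def by blast
      obtain d0 es where de: "ds = d0 # es" "length es = Suc n - Suc i" using ds(2) i by (cases ds) auto
      obtain F where F: "finite F" "F \<subseteq> N" "\<And>d. d \<in> lists N \<Longrightarrow> Pr d F \<Longrightarrow> Pr d (set y)"
        using Pr_limit[OF N c y] by blast
      define Z where "Z = X \<union> F \<union> c"
      have Z: "finite Z" "Z \<subseteq> N" "Z \<subseteq> car M" using X F c NM by (auto simp: Z_def)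
      have CovZ: "Cov Z" by (rule Cov_mono[OF c(2) _ Z(3)]) (simp add: Z_def)
      obtain d1 where d1: "Pr d1 N" using Pr_exists[OF NM small_countable[OF N(2)]] by blast
      \<comment> \<open>A realization of \<open>p\<close> over \<open>Z\<close> inside
        \<open>N\<close>, to which the first member of the sequence will be moved. As
        \<open>Z\<close> contains \<open>F\<close>, it realizes \<open>p\<close> over
        \<open>y\<close>.\<close>
      obtain d where d: "d \<in> lists N" "eqv Z d1 d" using s_saturated[OF N Z(1,2) Pr_car[OF d1]] by blast
      have dZ: "Pr d Z" using eqv_Pr[OF Pr_mono[OF d1 Z(2)] d(2) Z(1,3)] .
      obtain es' where es': "length es' = length es" "PM N es'"
        using PM_exists[OF NM small_countable[OF N(2)]] by blast
      have "Z \<union> set d \<subseteq> N" using Z(2) d(1) by auto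
      then have "PM Z (d # es')" using dZ PM_mono[OF es'(2)] by (simp add: PM_Cons)
      moreover have "PM Z ds" using PM_mono[OF ds(1) Z(2)] .
      ultimately obtain f where f: "f \<in> G" "\<And>z. z \<in> Z \<Longrightarrow> f z = z" "map (map f) ds = d # es'"
        using PM_unique[of Z ds "d # es'"] de es'(1) Z(1) CovZ by auto
      have fxf: "fx f" using CovD[OF CovZ f(1,2)] .
      define y' where "y' = map f y"
      have y': "y' \<in> lists (car M)" using y f(1) by (simp add: y'_def)
      have bad': "\<not> Pr e (set y')" if e: "e \<in> set (d # es')" for e
      proof -
        have "set (d # es') = map f ` set ds" unfolding f(3)[symmetric] by simp
        then obtain e0 where e0: "e0 \<in> set ds" "e = map f e0" using e by blast
        have "set y \<subseteq> car M" using y by auto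
        then show ?thesis
          using Pr_map_iff[OF f(1) fxf PM_lists[OF ds(1) e0(1)], of "set y"] ds(3) e0 by (simp add: y'_def)
      qed
      have "I (Suc i) y'" unfolding I_def using y' es' de(2) bad' by (intro conjI exI[of _ es']) auto
      moreover have "GI_move U N (y, X) (y', Z \<union> set d)"
      proof -
        have "eqv X y' y"
        proof -
          have "eqv X y y'" using f(1,2) by (intro eqvI[of f]) (auto simp: y'_def Z_def)
          then show ?thesis using eqv_sym y X NM by blast
        qed
        \<comment> \<open>\<open>d\<close> realizes \<open>p\<close> over \<open>y\<close> but not
          over \<open>y'\<close>, being the image of a failing member; an automorphism fixing
          \<open>Z\<close> and \<open>d\<close> fixes \<open>\<alpha>\<close> and would preserve
          this property.\<close>
        moreover have "\<not> eqv (Z \<union> set d) y' y"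
        proof
          assume "eqv (Z \<union> set d) y' y"
          then obtain k where k: "k \<in> G" "\<And>z. z \<in> Z \<union> set d \<Longrightarrow> k z = z" "map k y' = y" unfolding eqv_iff by blast
          have "fx k" using CovD[OF CovZ k(1)] k(2) by blast
          moreover have "map k d = d" using k(2) by (simp add: map_idI)
          moreover have "set y' \<subseteq> car M" using y' by auto
          moreover have "k ` set y' = set y" using k(3) by (metis set_map)
          ultimately have "Pr d (set y) \<longleftrightarrow> Pr d (set y')"
            using Pr_map_iff[OF k(1), of d "set y'"] Pr_car[OF dZ] by simp
          moreover have "Pr d (set y)" using F(3)[OF d(1)] Pr_mono[OF dZ, of F] by (simp add: Z_def le_supI1)
          ultimately show False using bad'[of d] by simp
        qed
        ultimately show ?thesis
          using X(1) Z d(1) y' by (auto simp: GI_move_def wtp_finite Z_def)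
      qed
      ultimately show "\<exists>y' Y. GI_move U N (y, X) (y', Y) \<and> I (Suc i) y'" by blast
    qed simp_all
  qed
qed

section \<open>Lascar types over the canonical base\<close>

lemma bounded_inv:
  assumes E: "E \<in> bounded_equivs Ueq A k" and A: "A \<subseteq> set \<alpha>" and f: "f \<in> G" "fx f"
    and xy: "x \<in> tuples k (Meq \<E>)" "y \<in> tuples k (Meq \<E>)"
  shows "(x, y) \<in> E \<longleftrightarrow> (map (lift f) x, map (lift f) y) \<in> E"
proof -
  have "lift f p = p" if "p \<in> set \<alpha>" for p by (rule map_fixes[OF f(2) that])
  then have "lift f \<in> aut_over Ueq A" using lift_aut[OF f(1)] A by (auto simp: aut_over_def)
  moreover have "\<forall>f\<in>aut_over Ueq A. \<forall>x\<in>tuples k (Meq \<E>). \<forall>y\<in>tuples k (Meq \<E>). (x, y) \<in> E \<longleftrightarrow> (map f x, map f y) \<in> E"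
    using E by (simp add: bounded_equivs_def)
  ultimately show ?thesis using xy by blast
qed

text \<open>
  A Morley sequence over representatives of all classes of a bounded relation is related to a
  representative \<open>r\<close>; this fact about the type over \<open>r\<close> transfers to the image of \<open>r\<close>, by invariance.
\<close>

lemma Lascar_of_type:
  assumes c: "finite c" "Cov c" and ds: "PM c ds" and g: "g \<in> G" "fx g"
  shows "Lt_eq Ueq (set \<alpha>) (re (concat ds)) (re (map g (concat ds)))"
  unfolding Lt_eq_def
proof (intro conjI allI impI)
  show "length (re (concat ds)) = length (re (map g (concat ds)))" by simp
  fix A E assume AE: "finite A \<and> A \<subseteq> set \<alpha> \<and> E \<in> bounded_equivs Ueq A (length (re (concat ds)))"
  define l where "l = concat ds"
  define k where "k = length l"
  have E: "E \<in> bounded_equivs Ueq A k" and A: "A \<subseteq> set \<alpha>" using AE by (simp_all add: k_def l_def)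
  have eqE: "equiv (tuples k (Meq \<E>)) E" and few: "|tuples k (Meq \<E>) // E| <o \<delta>"
    using E by (auto simp: bounded_equivs_def)
  have symE: "(y, x) \<in> E" if "(x, y) \<in> E" for x y using eqE that by (meson equivE symE)
  have transE: "(x, z) \<in> E" if "(x, y) \<in> E" "(y, z) \<in> E" for x y z using eqE that by (meson equivE transE)
  let ?L = "{l \<in> lists (car M). length l = k}"
  have tup: "re l \<in> tuples k (Meq \<E>)" if "l \<in> ?L" for l
    using that by (auto simp: tuples_def)
  have inv: "(re x, re y) \<in> E \<longleftrightarrow> (re (map f x), re (map f y)) \<in> E"
    if "f \<in> G" "fx f" "x \<in> ?L" "y \<in> ?L" for f x y
  proof -
    have "map (lift f) (re x) = re (map f x)" "map (lift f) (re y) = re (map f y)"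
      using that lift_re[OF that(1)] by blast+
    then show ?thesis using bounded_inv[OF E A that(1,2) tup[OF that(3)] tup[OF that(4)]] by metis
  qed
  have cM: "c \<subseteq> car M" using c(2) by (simp add: Cov_def)
  have lM: "l \<in> ?L" using PM_concat[OF ds] by (simp add: l_def k_def)
  have "(\<lambda>l. E `` {re l}) ` ?L \<subseteq> tuples k (Meq \<E>) // E" using tup by (auto intro: quotientI)
  then have "|(\<lambda>l. E `` {re l}) ` ?L| <o \<delta>" using few ordLess_subset by blast
  then obtain R where R: "R \<subseteq> ?L" "|R| <o \<delta>" "\<And>x. x \<in> ?L \<Longrightarrow> \<exists>y\<in>R. E `` {re y} = E `` {re x}"
    by (rule card_reps) blast
  define P where "P = c \<union> (\<Union>r\<in>R. set r)"
  have PM': "P \<subseteq> car M" using cM R(1) by (auto simp: P_def)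
  have Psmall: "|P| <o \<delta>"
    unfolding P_def using c(1) R(2) by (intro small_Un small_UN) (auto intro: small_countable countable_finite)
  obtain ds' where ds': "length ds' = length ds" "PM P ds'" using PM_exists[OF PM' Psmall] by blast
  have cP: "c \<subseteq> P" by (simp add: P_def)
  obtain h where h: "h \<in> G" "\<And>x. x \<in> c \<Longrightarrow> h x = x" "map (map h) ds' = ds"
    using PM_unique[OF PM_mono[OF ds'(2) cP] ds ds'(1) c] by blast
  have fxh: "fx h" using CovD[OF c(2) h(1,2)] .
  define l' where "l' = concat ds'"
  have hl: "map h l' = l" using h(3) by (metis concat_map_map l_def l'_def)
  have l': "l' \<in> ?L" using PM_concat[OF ds'(2)] arg_cong[OF hl, of length] by (simp add: l'_def k_def)
  obtain h' where h': "h' \<in> G" "fx h'" "\<And>x. x \<in> car M \<Longrightarrow> h' (h x) = x" "\<And>x. x \<in> car M \<Longrightarrow> h (h' x) = x"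
    using fx_inv[OF h(1) fxh] by blast
  \<comment> \<open>The conjugate of \<open>g\<close> by \<open>h\<close>: the claim for
    \<open>l\<close> and \<open>g\<close> is the image under \<open>h\<close> of the claim for
    \<open>l'\<close> and \<open>f\<close>.\<close>
  define f where "f x = h' (g (h x))" for x
  have f: "f \<in> G" "fx f" unfolding f_def
    using Aut_comp[OF h'(1) Aut_comp[OF g(1) h(1)]] fx_comp[OF h'(2) fx_comp[OF g(2) fxh]] by simp_all
  have fl: "map f l' \<in> ?L" using l' f(1) by simp
  obtain r where r: "r \<in> R" "(re l', re r) \<in> E"
  proof -
    obtain r where r: "r \<in> R" "E `` {re r} = E `` {re l'}" using R(3)[OF l'] by blast
    have "re r \<in> tuples k (Meq \<E>)" using tup r(1) R(1) by blast
    then show thesis using eq_equiv_class[OF r(2)[symmetric] eqE] r(1) that by blast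
  qed
  have rL: "r \<in> ?L" using r(1) R(1) by blast
  have frL: "map f r \<in> ?L" using rL f(1) by simp
  \<comment> \<open>A Morley sequence over both \<open>P\<close> and its image can be compared with
    \<open>r\<close> and with its image under \<open>f\<close>, which puts these two into one
    class.\<close>
  define Q where "Q = P \<union> f ` P"
  have Q: "Q \<subseteq> car M" "|Q| <o \<delta>"
    using PM' Psmall f(1) by (auto simp: Q_def intro: small_Un ordLess_image)
  obtain ds2 where ds2: "length ds2 = length ds" "PM Q ds2" using PM_exists[OF Q] by blast
  define l2 where "l2 = concat ds2"
  have rP: "c \<union> set r \<subseteq> P" using r(1) by (auto simp: P_def)
  then have rM: "c \<union> set r \<subseteq> car M" using PM' by blast
  have key: "(re l2, re s) \<in> E" if mE: "(re m, re s) \<in> E" and sL: "s \<in> ?L"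
      and ms: "m = concat ms" "PM Z ms" "length ms = length ds"
      and sZ: "Z \<union> set s \<subseteq> Q" "set s \<subseteq> Z" and Z: "finite Z" "Cov Z" for m s ms Z
  proof -
    have "PM Z ds2" using PM_mono[OF ds2(2)] sZ(1) by blast
    then obtain q where q: "q \<in> G" "\<And>x. x \<in> Z \<Longrightarrow> q x = x" "map (map q) ms = ds2"
      using PM_unique[OF ms(2) _ _ Z] ms(3) ds2(1) by metis
    have fxq: "fx q" using CovD[OF Z(2) q(1,2)] .
    have qm: "map q m = l2" using q(3) ms(1) by (metis concat_map_map l2_def)
    have qs: "map q s = s" using q(2) sZ(2) by (auto intro: map_idI)
    have "m \<in> ?L"
    proof -
      have "length (re m) = k" using mE eqE by (auto simp: equiv_def tuples_def)
      then show ?thesis using PM_concat[OF ms(2)] ms(1) by simp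
    qed
    from inv[OF q(1) fxq this sL] show ?thesis using mE unfolding qm qs by blast
  qed
  have "(re l2, re r) \<in> E"
  proof (rule key[OF r(2) rL l'_def _ ds'(1)])
    show "PM (c \<union> set r) ds'" using PM_mono[OF ds'(2) rP] .
    show "Cov (c \<union> set r)" using Cov_mono[OF c(2) _ rM] by simp
    show "c \<union> set r \<union> set r \<subseteq> Q" using rP by (auto simp: Q_def)
  qed (use c(1) in auto)
  moreover have "(re l2, re (map f r)) \<in> E"
  proof (rule key[of "map f l'" "map f r" "map (map f) ds'" "f ` (c \<union> set r)"])
    show "(re (map f l'), re (map f r)) \<in> E" using inv[OF f l' rL] r(2) by blast
    show "map f l' = concat (map (map f) ds')" by (simp add: l'_def map_concat)
    show "PM (f ` (c \<union> set r)) (map (map f) ds')" using PM_map[OF f PM_mono[OF ds'(2) rP] rM] .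
    show "f ` (c \<union> set r) \<union> set (map f r) \<subseteq> Q" using rP by (auto simp: Q_def)
    show "Cov (f ` (c \<union> set r))" using Cov_image[OF f Cov_mono[OF c(2) _ rM]] by simp
  qed (use frL ds'(1) c(1) in auto)
  ultimately have "(re (map f r), re r) \<in> E" using symE transE by blast
  moreover have "(re (map f l'), re (map f r)) \<in> E" using inv[OF f l' rL] r(2) by blast
  ultimately have "(re (map f l'), re l') \<in> E" using transE symE[OF r(2)] by blast
  then have "(re (map h (map f l')), re (map h l')) \<in> E" using inv[OF h(1) fxh fl l'] by blast
  moreover have "map h (map f l') = map g l"
    using h'(4) l' h(1) g(1) hl by (auto simp: f_def in_lists_conv_set)
  ultimately have "(re l, re (map g l)) \<in> E" using hl symE by metis
  then show "(re (concat ds), re (map g (concat ds))) \<in> E" by (simp add: l_def)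
qed

text \<open>
  A type \<open>e\<close> over \<open>N\<close> which extends the type over \<open>\<alpha>\<close> of the realizations of \<open>p\<close> and does not Lascar split
  over \<open>\<alpha>\<close> has, read backwards, the same Morley sequences over \<open>\<alpha>\<close> as \<open>p\<close>, by symmetry.
\<close>

lemma Morley_match:
  assumes N: "str N" "countable N" and c: "finite c" "Cov c" "c \<subseteq> N" and x: "x \<in> lists N"
    and e: "e \<in> lists (car M)"
    and nls: "\<And>u v. u \<in> lists N \<Longrightarrow> v \<in> lists N \<Longrightarrow> Lt_eq Ueq (set \<alpha>) (re u) (re v) \<Longrightarrow>
       \<exists>f\<in>G. fx f \<and> map f e = e \<and> map f u = v"
    and d: "Pr d c" "f0 \<in> G" "fx f0" "map f0 d = e"
  shows "\<exists>es ds f. length es = k \<and> (\<forall>e'\<in>set es. e' \<in> lists N \<and> eqv (c \<union> set x) e e') \<and>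
     PM c ds \<and> length ds = k \<and> f \<in> G \<and> fx f \<and> map (map f) ds = es"
proof (induction k)
  case 0
  have "fx (\<lambda>x. x)" using \<alpha> by (auto intro!: map_idI lift_id)
  then show ?case using Aut_id by (intro exI[of _ "[]"] exI[of _ "\<lambda>x. x"]) auto
next
  case (Suc k)
  then obtain es ds f where IH: "length es = k" "\<forall>e'\<in>set es. e' \<in> lists N \<and> eqv (c \<union> set x) e e'"
    "PM c ds" "length ds = k" "f \<in> G" "fx f" "map (map f) ds = es" by blast
  have NM: "N \<subseteq> car M" using str_car N(1) .
  have cM: "c \<subseteq> car M" using c NM by blast
  have "countable (N \<union> set e)" "N \<union> set e \<subseteq> car M" using N e NM by (auto simp: countable_finite)
  then obtain B where B: "str B" "N \<union> set e \<subseteq> B" "countable B" using LS_countable[OF str_M] by metis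
  have BM: "B \<subseteq> car M" using str_car B(1) .
  \<comment> \<open>A Morley sequence placed after \<open>e\<close>. Symmetry makes \<open>e\<close>
    nonsplitting over a finite \<open>F\<close> on \<open>N\<close> and \<open>ds1\<close>, so
    \<open>ds1\<close> can be exchanged for a copy in \<open>N\<close> with the same type over
    \<open>e\<close>.\<close>
  obtain ds1 where ds1: "length ds1 = k" "PM B ds1" using PM_exists[OF BM small_countable[OF B(3)]] by blast
  have eB: "e \<in> lists B" "N \<subseteq> B" using B(2) by auto
  obtain F where F: "finite F" "c \<subseteq> F" "F \<subseteq> N" "nosplit e (N \<union> set (concat ds1)) F"
    using PM_symmetry[OF N B(1,3) eB(2) c ds1(2) eB(1)] by blast
  have FM: "F \<subseteq> car M" using F(3) NM by blast
  have CovF: "Cov F" using Cov_mono[OF c(2) F(2) FM] .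
  have "concat ds1 \<in> lists (car M)" by (rule PM_concat[OF ds1(2)])
  then obtain l2 where l2: "l2 \<in> lists N" "eqv F (concat ds1) l2" using s_saturated[OF N F(1,3)] by blast
  then obtain q where q: "q \<in> G" "\<And>z. z \<in> F \<Longrightarrow> q z = z" "map q (concat ds1) = l2" unfolding eqv_iff by blast
  define ds2 where "ds2 = map (map q) ds1"
  have l2': "concat ds2 = l2" using q(3) by (simp add: ds2_def map_concat)
  have "q ` F = F" using q(2) by auto
  moreover have "PM F ds1" using PM_mono[OF ds1(2)] F(3) eB(2) by blast
  ultimately have ds2: "PM F ds2" using PM_map[OF q(1) CovD[OF CovF q(1,2)], of F ds1] FM by (simp add: ds2_def)
  obtain t where t: "t \<in> G" "\<And>z. z \<in> c \<Longrightarrow> t z = z" "map (map t) ds = ds2"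
    using PM_unique[OF IH(3) PM_mono[OF ds2 F(2)]] IH(4) ds1(1) c by (auto simp: ds2_def)
  have fxt: "fx t" using CovD[OF c(2) t(1,2)] .
  obtain t' where t': "t' \<in> G" "fx t'" "\<And>z. z \<in> car M \<Longrightarrow> t' (t z) = z" "\<And>z. z \<in> car M \<Longrightarrow> t (t' z) = z"
    using fx_inv[OF t(1) fxt] by blast
  define g where "g z = f (t' z)" for z
  have g: "g \<in> G" "fx g" unfolding g_def using Aut_comp[OF IH(5) t'(1)] fx_comp[OF IH(6) t'(2)] by simp_all
  have gds2: "map (map g) ds2 = es"
  proof -
    have "map (map g) (map (map t) ds) = map (map f) ds"
      using t'(3) PM_lists[OF IH(3)] by (fastforce simp: g_def in_lists_conv_set)
    then show ?thesis using t(3) IH(7) by simp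
  qed
  then have gl2: "map g (concat ds2) = concat es" by (metis concat_map_map)
  \<comment> \<open>The copy \<open>ds2\<close> and the given \<open>es\<close> lie in
    \<open>N\<close> and are conjugate over \<open>\<alpha>\<close>. As \<open>ds2\<close> is a
    Morley sequence this gives equal Lascar types, so \<open>nls\<close> moves one to the other
    while fixing \<open>e\<close>.\<close>
  have "Lt_eq Ueq (set \<alpha>) (re (concat ds2)) (re (map g (concat ds2)))"
    using Lascar_of_type[OF F(1) CovF ds2 g] .
  moreover have "concat es \<in> lists N" using IH(2) by (auto simp: in_lists_conv_set)
  ultimately obtain w where w: "w \<in> G" "fx w" "map w e = e" "map w (concat ds2) = concat es"
    using nls[of "concat ds2" "concat es"] l2(1) unfolding l2' gl2[unfolded l2'] by blast
  have "concat ds1 \<in> lists (N \<union> set (concat ds1))" "l2 \<in> lists (N \<union> set (concat ds1))"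
    using l2(1) by (auto simp: in_lists_conv_set)
  then have "eqv F (e @ concat ds1) (e @ l2)" by (rule nosplitD[OF F(4) _ _ l2(2)])
  then obtain v where v: "v \<in> G" "\<And>z. z \<in> F \<Longrightarrow> v z = z" "map v e = e" "map v (concat ds1) = l2"
    unfolding eqv_iff by auto
  have fxv: "fx v" using CovD[OF CovF v(1,2)] .
  obtain f1 where f1: "f1 \<in> G" "fx f1" "\<And>z. z \<in> car M \<Longrightarrow> f1 (f0 z) = z" "\<And>z. z \<in> car M \<Longrightarrow> f0 (f1 z) = z"
    using fx_inv[OF d(2,3)] by blast
  have f1e: "map f1 e = d" unfolding d(4)[symmetric] by (rule map_inv_car) (use f1(3) Pr_car[OF d(1)] in auto)
  define Y where "Y = f1 ` (c \<union> set e)"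
  have ceM: "c \<union> set e \<subseteq> car M" using cM e by auto
  have Y: "finite Y" "Y \<subseteq> car M" "set d \<subseteq> Y" using c(1) ceM f1(1) f1e by (auto simp: Y_def)
  have PMY: "PM Y (map (map f1) ds1)"
    unfolding Y_def by (rule PM_map[OF f1(1,2) PM_mono[OF ds1(2)] ceM]) (use c(3) B(2) in auto)
  have CovY: "Cov Y" unfolding Y_def using Cov_image[OF f1(1,2) Cov_mono[OF c(2) _ ceM]] by simp
  \<comment> \<open>\<open>f1\<close> need not fix \<open>c\<close>, so the pulled back sequence is
    a Morley sequence over \<open>d\<close> and the image of \<open>c\<close>, but perhaps not over
    \<open>c\<close>. It is exchanged for a Morley sequence over \<open>Z\<close>, which contains
    both bases.\<close>
  define Z where "Z = Y \<union> (c \<union> set d)"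
  have ZM: "Z \<subseteq> car M" using Y cM Pr_car[OF d(1)] by (auto simp: Z_def)
  have "|Z| <o \<delta>" using Y(1) c(1) by (intro small_countable countable_finite) (simp add: Z_def)
  then obtain ds3 where ds3: "length ds3 = k" "PM Z ds3" using PM_exists[OF ZM] by blast
  have PMYds3: "PM Y ds3" using PM_mono[OF ds3(2)] by (simp add: Z_def)
  obtain y where y: "y \<in> G" "\<And>z. z \<in> Y \<Longrightarrow> y z = z" "map (map y) ds3 = map (map f1) ds1"
    using PM_unique[OF PMYds3 PMY _ Y(1) CovY] ds1(1) ds3(1) by auto
  have fxy: "fx y" using CovD[OF CovY y(1,2)] .
  have yd: "map y d = d" using y(2) Y(3) by (auto intro: map_idI)
  \<comment> \<open>\<open>e\<close> need not lie in \<open>N\<close>; a copy over \<open>c\<close>,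
    \<open>x\<close> and the members found so far becomes the new first member.\<close>
  obtain eN where eN: "eN \<in> lists N" "eqv (c \<union> set x \<union> set (concat es)) e eN"
  proof -
    have "finite (c \<union> set x \<union> set (concat es))" using c(1) by simp
    moreover have "c \<union> set x \<union> set (concat es) \<subseteq> N"
      using c(3) x \<open>concat es \<in> lists N\<close> by (auto simp: in_lists_conv_set)
    ultimately show thesis by (rule s_saturated[OF N _ _ e that])
  qed
  obtain s where s: "s \<in> G" "\<And>z. z \<in> c \<union> set x \<union> set (concat es) \<Longrightarrow> s z = z" "map s e = eN"
    using eN(2) unfolding eqv_iff by blast
  have fxs: "fx s" using CovD[OF c(2) s(1)] s(2) by blast
  define r where "r z = s (w (v (f0 (y z))))" for z
  have r: "r \<in> G" "fx r"
    unfolding r_def using Aut_comp[OF s(1) Aut_comp[OF w(1) Aut_comp[OF v(1) Aut_comp[OF d(2) y(1)]]]]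
      fx_comp[OF fxs fx_comp[OF w(2) fx_comp[OF fxv fx_comp[OF d(3) fxy]]]] by simp_all
  have "map r d = map s (map w (map v (map f0 (map y d))))" by (simp add: r_def)
  then have rd: "map r d = eN" unfolding yd d(4) v(3) w(3) s(3) .
  have "map (map f0) (map (map f1) ds1) = ds1"
    using f1(4) PM_lists[OF ds1(2)] by (fastforce simp: in_lists_conv_set intro!: map_idI)
  moreover have "map (map v) ds1 = ds2"
    unfolding ds2_def by (rule map_map_cong) (use v(4) q(3) in metis)
  moreover have "map (map w) ds2 = es"
    unfolding gds2[symmetric] by (rule map_map_cong) (use w(4) gl2 in metis)
  moreover have "map (map s) es = es" using s(2) by (auto intro!: map_idI)
  moreover have "map (map r) ds3 = map (map s) (map (map w) (map (map v) (map (map f0) (map (map y) ds3))))"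
    by (simp add: r_def)
  ultimately have "map (map r) ds3 = es" using y(3) by metis
  moreover have "PM c (d # ds3)"
    using d(1) PM_mono[OF ds3(2), of "c \<union> set d"] by (simp add: PM_Cons Z_def)
  moreover have "eqv (c \<union> set x) e eN" using eqv_mono[OF eN(2)] by blast
  ultimately show ?case
    using r rd eN(1) IH(1,2) ds3(1) by (intro exI[of _ "eN # es"] exI[of _ "d # ds3"] exI[of _ r]) auto
qed

end

section \<open>From absence of Lascar splitting to realizations of \<open>p\<close>\<close>

context canonical
begin

lemma Pr_same:
  assumes "Pr d X" "Pr d' X" "finite X" "Cov X"
  obtains h where "h \<in> G" "fx h" "\<And>z. z \<in> X \<Longrightarrow> h z = z" "map h d = d'"
proof -
  have "eqv X d d'" using Pr_eqv assms by (auto simp: Cov_def)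
  then obtain h where h: "h \<in> G" "\<And>z. z \<in> X \<Longrightarrow> h z = z" "map h d = d'" unfolding eqv_iff by blast
  then show thesis using that CovD[OF assms(4)] by blast
qed

text \<open>The tuples \<open>es\<close> are the image of a Morley sequence over \<open>N\<close>
  under an automorphism \<open>k\<close> fixing \<open>\<alpha>\<close>, hence a Morley sequence
  over the image of \<open>N\<close>. The bound of \<open>Pr_majority\<close> is uniform in the
  model, so it applies there: some member realizes \<open>p\<close> over \<open>x\<close>, and
  \<open>e\<close> has the same type over \<open>x\<close>.\<close>

lemma Pr_of_nonLascar:
  assumes N: "str N" "countable N" and c: "finite c" "Cov c" "c \<subseteq> N" and x: "x \<in> lists N"
    and e: "e \<in> lists (car M)"
    and nls: "\<And>u v. u \<in> lists N \<Longrightarrow> v \<in> lists N \<Longrightarrow> Lt_eq Ueq (set \<alpha>) (re u) (re v) \<Longrightarrow>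
       \<exists>f\<in>G. fx f \<and> map f e = e \<and> map f u = v"
    and d: "Pr d c" "f0 \<in> G" "fx f0" "map f0 d = e"
  shows "Pr e (set x)"
proof (rule ccontr)
  assume bad: "\<not> Pr e (set x)"
  have NM: "N \<subseteq> car M" using str_car N(1) .
  have xM: "x \<in> lists (car M)" using x NM by (auto simp: in_lists_conv_set)
  obtain n where n: "\<And>N c ds. str N \<Longrightarrow> countable N \<Longrightarrow> finite c \<Longrightarrow> Cov c \<Longrightarrow> c \<subseteq> N \<Longrightarrow>
    PM N ds \<Longrightarrow> length ds = n \<Longrightarrow> \<exists>d\<in>set ds. Pr d (set x)"
    using Pr_majority[OF xM] by blast
  obtain es ds f where es: "\<And>e'. e' \<in> set es \<Longrightarrow> eqv (c \<union> set x) e e'"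
    and ds: "PM c ds" "length ds = n" and f: "f \<in> G" "fx f" "map (map f) ds = es"
    using Morley_match[OF N c x e nls d, of n] by blast
  obtain ds1 where ds1: "length ds1 = n" "PM N ds1" using PM_exists[OF NM small_countable[OF N(2)]] by blast
  obtain h where h: "h \<in> G" "\<And>z. z \<in> c \<Longrightarrow> h z = z" "map (map h) ds1 = ds"
    using PM_unique[OF PM_mono[OF ds1(2) c(3)] ds(1) _ c(1,2)] ds1(1) ds(2) by auto
  define k where "k z = f (h z)" for z
  have k: "k \<in> G" "fx k" unfolding k_def
    using Aut_comp[OF f(1) h(1)] fx_comp[OF f(2) CovD[OF c(2) h(1,2)]] by simp_all
  have "map (map k) ds1 = map (map f) (map (map h) ds1)" by (simp add: k_def)
  then have "map (map k) ds1 = es" using f(3) h(3) by simp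
  then have "PM (k ` N) es" using PM_map[OF k ds1(2) NM] by simp
  moreover have "length es = n" using ds(2) f(3) by auto
  moreover have "str (k ` N)" "countable (k ` N)" "finite (k ` c)" "Cov (k ` c)" "k ` c \<subseteq> k ` N"
    using str_image(1)[OF k(1) N(1)] N(2) c(1) Cov_image[OF k c(2)] c(3) by auto
  ultimately obtain e' where e': "e' \<in> set es" "Pr e' (set x)" using n by blast
  have "eqv (set x) e e'" using eqv_mono[OF es[OF e'(1)]] by blast
  moreover have "set x \<subseteq> car M" using xM by auto
  ultimately have "eqv (set x) e' e" using eqv_sym e by blast
  then have "Pr e (set x)" using eqv_Pr[OF e'(2)] \<open>set x \<subseteq> car M\<close> by simp
  then show False using bad by simp
qed

section \<open>Stationarity over the canonical base\<close>

lemma fx_iff: "fx f \<longleftrightarrow> (\<forall>p\<in>set \<alpha>. lift f p = p)"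
  using map_fixes[of "lift f" \<alpha>] by (auto intro: map_idI)

lemma \<alpha>_Meq: "set \<alpha> \<subseteq> Meq \<E>"
  using \<alpha> by auto

lemma gtp_alpha_iff: "x \<in> lists (Meq \<E>) \<Longrightarrow> gtp_eq Ueq (set \<alpha>) x y \<longleftrightarrow> (\<exists>f\<in>G. fx f \<and> map (lift f) x = y)"
  by (simp add: gtp_Ueq_iff[OF \<alpha>_Meq] fx_iff)

lemma wtp_alpha_iff: "x \<in> lists (Meq \<E>) \<Longrightarrow> wtp_eq Ueq (set \<alpha>) x y \<longleftrightarrow> (\<exists>f\<in>G. fx f \<and> map (lift f) x = y)"
proof -
  assume x: "x \<in> lists (Meq \<E>)"
  have "wtp_eq Ueq (set \<alpha>) x y \<longleftrightarrow> gtp_eq Ueq (set \<alpha>) x y"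
    unfolding wtp_eq_def gtp_eq_def aut_over_def by (auto 0 3)
  then show ?thesis using gtp_alpha_iff[OF x] by simp
qed

lemma map_lift_inv: "(\<And>x. x \<in> car M \<Longrightarrow> g (f x) = x) \<Longrightarrow> x \<in> lists (Meq \<E>) \<Longrightarrow> map (lift g) (map (lift f) x) = x"
  using lift_id[of _ "\<lambda>x. g (f x)"] by (auto simp: in_lists_conv_set lift_comp intro!: map_idI)

lemma gtp_Ueq_sym:
  assumes A: "A \<subseteq> Meq \<E>" and x: "x \<in> lists (Meq \<E>)" and e: "gtp_eq Ueq A x y"
  shows "gtp_eq Ueq A y x" "y \<in> lists (Meq \<E>)"
proof -
  obtain f where f: "f \<in> G" "\<And>p. p \<in> A \<Longrightarrow> lift f p = p" "map (lift f) x = y"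
    using e unfolding gtp_Ueq_iff[OF A x] by blast
  obtain g where g: "g \<in> G" "\<And>x. x \<in> car M \<Longrightarrow> g (f x) = x" "\<And>x. x \<in> car M \<Longrightarrow> f (g x) = x"
    using Aut_inv[OF f(1)] by blast
  show y: "y \<in> lists (Meq \<E>)" using f(1,3) x by (auto simp: in_lists_conv_set)
  have "lift g p = p" if "p \<in> A" for p
    using lift_id[of p "\<lambda>x. g (f x)"] g(2) f(2)[OF that] that A by (auto simp: lift_comp[symmetric])
  moreover have "map (lift g) y = x" using map_lift_inv[of g f, OF g(2) x] f(3) by simp
  ultimately show "gtp_eq Ueq A y x" unfolding gtp_Ueq_iff[OF A y] using g(1) by blast
qed

lemma gtp_Ueq_trans:
  assumes A: "A \<subseteq> Meq \<E>" and x: "x \<in> lists (Meq \<E>)" and e: "gtp_eq Ueq A x y" "gtp_eq Ueq A y z"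
  shows "gtp_eq Ueq A x z"
proof -
  obtain f where f: "f \<in> G" "\<And>p. p \<in> A \<Longrightarrow> lift f p = p" "map (lift f) x = y"
    using e(1) unfolding gtp_Ueq_iff[OF A x] by blast
  obtain g where g: "g \<in> G" "\<And>p. p \<in> A \<Longrightarrow> lift g p = p" "map (lift g) y = z"
    using e(2) unfolding gtp_Ueq_iff[OF A gtp_Ueq_sym(2)[OF A x e(1)]] by blast
  have "map (lift (\<lambda>x. g (f x))) x = map (lift g) (map (lift f) x)" by (simp add: lift_comp)
  then have "map (lift (\<lambda>x. g (f x))) x = z" using f(3) g(3) by simp
  moreover have "lift (\<lambda>x. g (f x)) p = p" if "p \<in> A" for p
    using f(2)[OF that] g(2)[OF that] by (simp add: lift_comp[symmetric])
  ultimately show ?thesis unfolding gtp_Ueq_iff[OF A x] using Aut_comp[OF g(1) f(1)] by blast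
qed

text \<open>By s-saturation over a finite set determining \<open>\<alpha>\<close>, tuples of
  imaginaries can be moved over \<open>\<alpha>\<close> to classes of tuples from one countable
  model.\<close>

lemma gtp_alpha_reps:
  obtains T where "countable T" "\<And>x. x \<in> lists (Meq \<E>) \<Longrightarrow> \<exists>y\<in>T. gtp_eq Ueq (set \<alpha>) x y"
proof -
  obtain c where c: "finite c" "Cov c" using Cov_exists by blast
  have "c \<subseteq> car M" "countable c" using c by (auto simp: Cov_def countable_finite)
  then obtain N where N: "str N" "c \<subseteq> N" "countable N" using LS_countable[OF str_M] by metis
  define T where "T = (\<lambda>(E, r). quot E r) ` (\<E> \<times> lists N)"
  have "countable \<E>" using family by (simp add: imaginary_family_def)
  then have T: "countable T" using N(3) by (auto simp: T_def)
  have "\<exists>y\<in>lists T. gtp_eq Ueq (set \<alpha>) x y" if x: "x \<in> lists (Meq \<E>)" for x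
  proof -
    have "\<exists>E r. E \<in> \<E> \<and> r \<in> Field E \<and> p = quot E r" if "p \<in> set x" for p
      using MeqE[of p] x that by (metis in_lists_conv_set)
    then obtain Eo ro where Er: "\<And>p. p \<in> set x \<Longrightarrow> Eo p \<in> \<E> \<and> ro p \<in> Field (Eo p) \<and> p = quot (Eo p) (ro p)"
      by metis
    define l where "l = concat (map ro x)"
    have roM: "ro p \<in> lists (car M)" if "p \<in> set x" for p using Er[OF that] Field_lists by blast
    have "l \<in> lists (car M)" using roM by (auto simp: l_def in_lists_conv_set)
    then obtain l' where l': "l' \<in> lists N" "eqv c l l'" using s_saturated[OF N(1,3) c(1) N(2)] by blast
    then obtain f where f: "f \<in> G" "\<And>z. z \<in> c \<Longrightarrow> f z = z" "map f l = l'" unfolding eqv_iff by blast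
    have "lift f p \<in> T" if p: "p \<in> set x" for p
    proof -
      have "lift f p = quot (Eo p) (map f (ro p))" using lift_quot[OF f(1), of "Eo p" "ro p"] Er[OF p] by simp
      moreover have "f ` set (ro p) \<subseteq> set l'" using p unfolding f(3)[symmetric] l_def by auto
      then have "map f (ro p) \<in> lists N" using l'(1) by (auto simp: in_lists_conv_set)
      ultimately show ?thesis using Er[OF p] unfolding T_def by force
    qed
    then have "map (lift f) x \<in> lists T" by (auto simp: in_lists_conv_set)
    then show ?thesis using gtp_alpha_iff[OF x] f(1) CovD[OF c(2) f(1,2)] by blast
  qed
  then show thesis using that[of "lists T"] T by blast
qed

text \<open>With only countably many classes, equality of types over \<open>\<alpha>\<close> is
  itself one of the relations that equality of Lascar types refines.\<close>

lemma type_bounded: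
  "{(x, y). x \<in> tuples k (Meq \<E>) \<and> y \<in> tuples k (Meq \<E>) \<and> gtp_eq Ueq (set \<alpha>) x y} \<in> bounded_equivs Ueq (set \<alpha>) k"
  (is "?E \<in> _")
proof -
  let ?t = "tuples k (Meq \<E>)"
  have tl: "x \<in> lists (Meq \<E>)" if "x \<in> ?t" for x using that by (simp add: tuples_def)
  have "gtp_eq Ueq (set \<alpha>) x x" if "x \<in> lists (Meq \<E>)" for x
    unfolding gtp_Ueq_iff[OF \<alpha>_Meq that] using that Aut_id lift_id[of _ "\<lambda>x. x"] \<alpha>_Meq
    by (intro bexI[of _ "\<lambda>x. x"]) (auto intro!: map_idI)
  then have eq: "equiv ?t ?E"
    unfolding equiv_def
  proof (intro conjI)
    show "refl_on ?t ?E" using \<open>\<And>x. x \<in> lists (Meq \<E>) \<Longrightarrow> gtp_eq Ueq (set \<alpha>) x x\<close> tl by (simp add: refl_on_def)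
    show "sym ?E" using gtp_Ueq_sym(1)[OF \<alpha>_Meq tl] by (auto intro: symI)
    show "trans ?E"
    proof (rule transI)
      fix x y z assume "(x, y) \<in> ?E" "(y, z) \<in> ?E"
      then show "(x, z) \<in> ?E" using gtp_Ueq_trans[OF \<alpha>_Meq tl, of x y z] by simp
    qed
  qed auto
  have inv: "(x, y) \<in> ?E \<longleftrightarrow> (map f x, map f y) \<in> ?E" if f: "f \<in> aut_over Ueq (set \<alpha>)" and xy: "x \<in> ?t" "y \<in> ?t" for f x y
  proof -
    have aut: "gtp_eq Ueq (set \<alpha>) z (map f z)" for z using f unfolding gtp_eq_def by blast
    note s = gtp_Ueq_sym[OF \<alpha>_Meq] and t = gtp_Ueq_trans[OF \<alpha>_Meq]
    have m: "map f x \<in> ?t" "map f y \<in> ?t" using s(2)[OF tl aut] xy by (auto simp: tuples_def)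
    have "gtp_eq Ueq (set \<alpha>) x y \<longleftrightarrow> gtp_eq Ueq (set \<alpha>) (map f x) (map f y)"
      using s(1)[OF tl aut] t tl xy m aut by meson
    then show ?thesis using xy m by simp
  qed
  obtain T where T: "countable T" "\<And>x. x \<in> lists (Meq \<E>) \<Longrightarrow> \<exists>y\<in>T. gtp_eq Ueq (set \<alpha>) x y"
    using gtp_alpha_reps by blast
  have "?t // ?E \<subseteq> (\<lambda>y. ?E `` {y}) ` T"
  proof
    fix X assume "X \<in> ?t // ?E"
    then obtain x where x: "x \<in> ?t" "X = ?E `` {x}" by (auto elim: quotientE)
    obtain y where y: "y \<in> T" "gtp_eq Ueq (set \<alpha>) x y" using T(2) tl[OF x(1)] by blast
    have "length y = length x" using y(2) by (auto simp: gtp_eq_def)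
    then have "y \<in> ?t" using gtp_Ueq_sym(2)[OF \<alpha>_Meq tl[OF x(1)] y(2)] x(1) by (simp add: tuples_def)
    then have "(x, y) \<in> ?E" using x(1) y(2) by simp
    then have "X = ?E `` {y}" using equiv_class_eq[OF eq] x(2) by blast
    then show "X \<in> (\<lambda>y. ?E `` {y}) ` T" using y(1) by blast
  qed
  then have "|?t // ?E| <o \<delta>" using T(1) by (meson countable_image countable_subset small_countable)
  then show ?thesis using eq inv by (simp add: bounded_equivs_def)
qed

text \<open>Absence of Lascar splitting is only given over some part of \<open>\<alpha>\<close>;
  with \<open>\<alpha>\<close> appended to the tuples, the automorphisms it provides fix all of
  \<open>\<alpha>\<close>. A relation on the longer tuples is pulled back along
  \<open>u \<mapsto> \<alpha> @ u\<close>.\<close>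

lemma Lt_append_alpha:
  assumes x: "x \<in> lists (Meq \<E>)" and y: "y \<in> lists (Meq \<E>)" and Lt: "Lt_eq Ueq (set \<alpha>) x y"
  shows "Lt_eq Ueq (set \<alpha>) (\<alpha> @ x) (\<alpha> @ y)"
  unfolding Lt_eq_def
proof (intro conjI allI impI)
  have len: "length x = length y" using Lt by (simp add: Lt_eq_def)
  then show "length (\<alpha> @ x) = length (\<alpha> @ y)" by simp
  define k where "k = length x"
  fix A E assume "finite A \<and> A \<subseteq> set \<alpha> \<and> E \<in> bounded_equivs Ueq A (length (\<alpha> @ x))"
  then have A: "A \<subseteq> set \<alpha>" and E: "E \<in> bounded_equivs Ueq A (length \<alpha> + k)" by (simp_all add: k_def)
  let ?t = "tuples k (Meq \<E>)" and ?T = "tuples (length \<alpha> + k) (Meq \<E>)"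
  have eqE: "equiv ?T E" and few: "|?T // E| <o \<delta>" using E by (auto simp: bounded_equivs_def)
  have app: "\<alpha> @ z \<in> ?T" if "z \<in> ?t" for z using that \<alpha> by (simp add: tuples_def)
  define E' where "E' = {(u, v). u \<in> ?t \<and> v \<in> ?t \<and> (\<alpha> @ u, \<alpha> @ v) \<in> E}"
  have eqE': "equiv ?t E'"
    using eqE app unfolding E'_def
    by (intro equivI refl_onI symI transI) (auto simp: equiv_def refl_on_def dest: symD transD)
  have "E' \<in> bounded_equivs Ueq (set \<alpha>) k"
  proof -
    have inv: "(u, v) \<in> E' \<longleftrightarrow> (map f u, map f v) \<in> E'"
      if f: "f \<in> aut_over Ueq (set \<alpha>)" and uv: "u \<in> ?t" "v \<in> ?t" for f u v
    proof -
      have f\<alpha>: "map f \<alpha> = \<alpha>" using f by (auto simp: aut_over_def intro: map_idI)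
      have "f \<in> aut_over Ueq A" using f A by (auto simp: aut_over_def)
      then have "(\<alpha> @ u, \<alpha> @ v) \<in> E \<longleftrightarrow> (map f (\<alpha> @ u), map f (\<alpha> @ v)) \<in> E"
        using E app[OF uv(1)] app[OF uv(2)] by (simp add: bounded_equivs_def)
      moreover have "map f u \<in> ?t" "map f v \<in> ?t"
        using f uv by (auto simp: aut_over_def aut_eq_def tuples_iff bij_betw_def)
      ultimately show ?thesis using uv f\<alpha> by (simp add: E'_def)
    qed
    have "|(\<lambda>u. E `` {\<alpha> @ u}) ` ?t| <o \<delta>"
      by (rule ordLess_subset[OF few]) (use app in \<open>auto intro: quotientI\<close>)
    then obtain R where R: "R \<subseteq> ?t" "|R| <o \<delta>" "\<And>u. u \<in> ?t \<Longrightarrow> \<exists>v\<in>R. E `` {\<alpha> @ v} = E `` {\<alpha> @ u}"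
      by (rule card_reps) blast
    have "?t // E' \<subseteq> (\<lambda>v. E' `` {v}) ` R"
    proof
      fix X assume "X \<in> ?t // E'"
      then obtain u where u: "u \<in> ?t" "X = E' `` {u}" by (auto elim: quotientE)
      obtain v where v: "v \<in> R" "E `` {\<alpha> @ v} = E `` {\<alpha> @ u}" using R(3)[OF u(1)] by blast
      have "v \<in> ?t" using v(1) R(1) by blast
      then have "(v, u) \<in> E'" using eq_equiv_class[OF v(2) eqE app[OF u(1)]] u(1) by (simp add: E'_def)
      then have "X = E' `` {v}" using equiv_class_eq[OF eqE'] u(2) by blast
      then show "X \<in> (\<lambda>v. E' `` {v}) ` R" using v(1) by blast
    qed
    then have "|?t // E'| <o \<delta>" using R(2) by (meson ordLess_image ordLess_subset)
    then show ?thesis using eqE' inv by (simp add: bounded_equivs_def)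
  qed
  then have "(x, y) \<in> E'" using Lt unfolding Lt_eq_def k_def by blast
  then show "(\<alpha> @ x, \<alpha> @ y) \<in> E" by (simp add: E'_def)
qed

lemma Lt_conj:
  assumes x: "x \<in> lists (Meq \<E>)" and Lt: "Lt_eq Ueq (set \<alpha>) x y"
  shows "\<exists>f\<in>G. fx f \<and> map (lift f) x = y"
proof -
  have "(x, y) \<in> {(u, v). u \<in> tuples (length x) (Meq \<E>) \<and> v \<in> tuples (length x) (Meq \<E>) \<and> gtp_eq Ueq (set \<alpha>) u v}"
    using Lt type_bounded[of "length x"] unfolding Lt_eq_def by blast
  then show ?thesis using gtp_alpha_iff[OF x] by simp
qed

text \<open>An automorphism \<open>f\<close> fixing \<open>\<alpha>\<close> moves \<open>u\<close>
  to \<open>v\<close>, and \<open>d\<close> to a realization of \<open>p\<close> over the image of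
  the support \<open>X\<close> of \<open>u\<close>. That image and the support \<open>Y\<close> both
  determine \<open>v\<close>, so one returns to \<open>d\<close> in two steps that fix
  \<open>v\<close>, through a realization \<open>d1\<close> of \<open>p\<close> over their
  union.\<close>

lemma Pr_nonsplit:
  assumes c: "finite c" "Cov c" and d: "Pr d (c \<union> \<Union>(cv ` D))" and D: "D \<subseteq> Meq \<E>"
  shows "\<not> Lascar_splits Ueq (re d) D (set \<alpha>)"
proof
  assume "Lascar_splits Ueq (re d) D (set \<alpha>)"
  then obtain u v where uv: "u \<in> lists D" "v \<in> lists D" "Lt_eq Ueq (set \<alpha>) u v"
    "\<not> wtp_eq Ueq (set \<alpha>) (re d @ u) (re d @ v)"
    unfolding Lascar_splits_def by blast
  have uM: "u \<in> lists (Meq \<E>)" "v \<in> lists (Meq \<E>)" using uv D by (auto simp: in_lists_conv_set)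
  obtain f where f: "f \<in> G" "fx f" "map (lift f) u = v" using Lt_conj[OF uM(1) uv(3)] by blast
  have dM: "d \<in> lists (car M)" using Pr_car[OF d] .
  define X where "X = c \<union> \<Union>(cv ` set u)"
  define Y where "Y = c \<union> \<Union>(cv ` set v)"
  have cM: "c \<subseteq> car M" using c(2) by (simp add: Cov_def)
  have X: "finite X" "X \<subseteq> car M" and Y: "finite Y" "Y \<subseteq> car M"
  proof -
    have sub: "set u \<subseteq> Meq \<E>" "set v \<subseteq> Meq \<E>" using uM by auto
    show "X \<subseteq> car M" "Y \<subseteq> car M" unfolding X_def Y_def using cM cv_car[OF sub(1)] cv_car[OF sub(2)] by auto
    show "finite X" "finite Y" unfolding X_def Y_def using c(1) cv(1) sub by auto
  qed
  have cov: "Cov X" "Cov Y" using Cov_mono[OF c(2)] X Y by (auto simp: X_def Y_def)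
  have cvX: "map (lift h) u = u" if h: "h \<in> G" "\<And>z. z \<in> X \<Longrightarrow> h z = z" for h
  proof (rule map_idI)
    fix p assume p: "p \<in> set u"
    then show "lift h p = p" using cv(3)[OF _ h(1), of p] h(2) uM(1) by (auto simp: X_def)
  qed
  have cvY: "map (lift h) v = v" if h: "h \<in> G" "\<And>z. z \<in> Y \<Longrightarrow> h z = z" for h
  proof (rule map_idI)
    fix p assume p: "p \<in> set v"
    then show "lift h p = p" using cv(3)[OF _ h(1), of p] h(2) uM(2) by (auto simp: Y_def)
  qed
  have dX: "Pr d X" and dY: "Pr d Y" using uv(1,2) by (auto intro!: Pr_mono[OF d] simp: X_def Y_def in_lists_conv_set)
  have fX: "f ` X \<subseteq> car M" "finite (f ` X)" "Cov (f ` X)" using X f(1) Cov_image[OF f(1,2) cov(1)] by auto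
  obtain d1 where d1: "Pr d1 (Y \<union> f ` X)"
  proof (rule Pr_exists[of "Y \<union> f ` X"])
    show "Y \<union> f ` X \<subseteq> car M" using Y fX by simp
    show "|Y \<union> f ` X| <o \<delta>" using Y(1) fX(2) by (intro small_countable countable_finite) simp
  qed blast
  obtain h1 where h1: "h1 \<in> G" "fx h1" "\<And>z. z \<in> f ` X \<Longrightarrow> h1 z = z" "map h1 (map f d) = d1"
    by (rule Pr_same[OF Pr_map[OF f(1,2) dX X(2)] Pr_mono[OF d1 Un_upper2] fX(2,3)]) blast
  obtain h2 where h2: "h2 \<in> G" "fx h2" "\<And>z. z \<in> Y \<Longrightarrow> h2 z = z" "map h2 d1 = d"
    by (rule Pr_same[OF Pr_mono[OF d1 Un_upper1] dY Y(1) cov(2)]) blast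
  obtain g where g: "g \<in> G" "fx g" "\<And>x. x \<in> car M \<Longrightarrow> g (f x) = x" "\<And>x. x \<in> car M \<Longrightarrow> f (g x) = x"
    using fx_inv[OF f(1,2)] by blast
  have h1v: "map (lift h1) v = v"
  proof -
    have "g (h1 (f z)) = z" if "z \<in> X" for z using h1(3)[of "f z"] g(3)[of z] that X(2) by auto
    then have "map (lift (\<lambda>x. g (h1 (f x)))) u = u" by (intro cvX Aut_comp[OF g(1) Aut_comp[OF h1(1) f(1)]])
    then have "map (lift f) (map (lift (\<lambda>x. g (h1 (f x)))) u) = v" using f(3) by simp
    moreover have "map (lift f) (map (lift (\<lambda>x. g (h1 (f x)))) u) = map (lift (\<lambda>x. h1 (f x))) u"
      using uM(1) g(4) h1(1) f(1) by (auto simp: lift_comp in_lists_conv_set intro!: lift_cong)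
    moreover have "map (lift (\<lambda>x. h1 (f x))) u = map (lift h1) (map (lift f) u)" by (simp add: lift_comp)
    ultimately show ?thesis using f(3) by metis
  qed
  define k where "k z = h2 (h1 (f z))" for z
  have k: "k \<in> G" "fx k" unfolding k_def
    using Aut_comp[OF h2(1) Aut_comp[OF h1(1) f(1)]] fx_comp[OF h2(2) fx_comp[OF h1(2) f(2)]] by simp_all
  have "map k d = map h2 (map h1 (map f d))" by (simp add: k_def)
  then have kd: "map k d = d" unfolding h1(4) h2(4) .
  have "map (lift k) u = map (lift h2) (map (lift h1) (map (lift f) u))" by (simp add: k_def[abs_def] lift_comp)
  then have ku: "map (lift k) u = v" using f(3) h1v cvY[OF h2(1,3)] by simp
  have "map (lift k) (re d @ u) = re d @ v" using lift_re[OF k(1) dM] kd ku by simp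
  then show False using uv(4) wtp_alpha_iff[of "re d @ u"] dM uM(1) k by auto
qed

text \<open>Independence extends the type to a set \<open>D\<close> that contains all reals of a
  model \<open>S0\<close> around \<open>X\<close>. The tuple obtained is conjugate to
  \<open>a\<close> over \<open>\<alpha>\<close>, hence real, and it does not Lascar split, so
  \<open>Pr_of_nonLascar\<close> applies in each countable model inside \<open>S0\<close>.\<close>

lemma free_extension_Pr:
  assumes c: "finite c" "Cov c" and d: "Pr d c" "f0 \<in> G" "fx f0" "map f0 d = a"
    and C: "set \<alpha> \<subseteq> C" "C \<subseteq> Meq \<E>" "|C| <o \<delta>" and X: "X \<subseteq> car M" "|X| <o \<delta>"
    and free: "free_extension Ueq (re a) (set \<alpha>) e' C"
  obtains e where "Pr e X" "wtp_eq Ueq C (re e) e'"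
proof -
  have dM: "d \<in> lists (car M)" using Pr_car[OF d(1)] .
  have cM: "c \<subseteq> car M" using c(2) by (simp add: Cov_def)
  have XM: "X \<union> c \<subseteq> car M" using X(1) cM by blast
  moreover have "|X \<union> c| <o \<delta>" using X(2) c(1) by (intro small_Un) (simp_all add: small_countable countable_finite)
  ultimately obtain S0 where S0: "str S0" "X \<union> c \<subseteq> S0" "S0 \<subseteq> car M" "|S0| <o \<delta>" using LS_small[OF str_M] by blast
  define D where "D = C \<union> real_elt M ` S0"
  have D: "set \<alpha> \<union> C \<subseteq> D" "D \<subseteq> Meq \<E>" "|D| <o \<delta>"
    using C S0 by (auto simp: D_def intro: small_Un ordLess_image)
  have e': "wtp_eq Ueq (set \<alpha>) (re a) e'" "indep Ueq e' (set \<alpha>) C"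
    using free by (simp_all add: free_extension_def)
  have aM: "a \<in> lists (car M)" using map_car[OF d(2) dM] d(4) by simp
  then have ad: "re a \<in> lists (Meq \<E>)" by simp
  obtain A1 b2 where A1: "A1 \<subseteq> set \<alpha>" and b2: "b2 \<in> lists (Meq \<E>)" "wtp_eq Ueq (set \<alpha> \<union> C) b2 e'"
      "\<not> Lascar_splits Ueq b2 D A1"
    using e'(2) D unfolding indep_def by (metis Ueq_simps(1,3))
  have "gtp_eq Ueq (set \<alpha>) b2 e'" "gtp_eq Ueq (set \<alpha>) (re a) e'"
    using b2(2) e'(1) by (auto simp: wtp_eq_def)
  then have "gtp_eq Ueq (set \<alpha>) (re a) b2"
    using gtp_Ueq_sym(1)[OF \<alpha>_Meq b2(1)] gtp_Ueq_trans[OF \<alpha>_Meq ad] by blast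
  then obtain f where f: "f \<in> G" "fx f" "map (lift f) (re a) = b2" unfolding gtp_alpha_iff[OF ad] by blast
  define f1 where "f1 z = f (f0 z)" for z
  have f1: "f1 \<in> G" "fx f1" unfolding f1_def using Aut_comp[OF f(1) d(2)] fx_comp[OF f(2) d(3)] by simp_all
  define e where "e = map f1 d"
  have eM: "e \<in> lists (car M)" using f1(1) dM by (simp add: e_def)
  have "map f a = e" unfolding d(4)[symmetric] by (simp add: e_def f1_def)
  then have re_e: "re e = b2" using lift_re[OF f(1) aM] f(3) by metis
  have "Pr e S0"
  proof (rule Pr_finite[OF eM])
    fix B assume B: "finite B" "B \<subseteq> S0"
    obtain x where x: "set x = B" using B(1) finite_list by blast
    have "countable (B \<union> c)" "B \<union> c \<subseteq> S0" using B c(1) S0(2) by (auto simp: countable_finite)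
    then obtain N where N: "str N" "B \<union> c \<subseteq> N" "N \<subseteq> S0" "countable N" using LS_countable[OF S0(1)] by metis
    have nls: "\<exists>f\<in>G. fx f \<and> map f e = e \<and> map f u = v"
      if uv: "u \<in> lists N" "v \<in> lists N" and Lt: "Lt_eq Ueq (set \<alpha>) (re u) (re v)" for u v
    proof -
      have uvM: "u \<in> lists (car M)" "v \<in> lists (car M)" using uv N(3) S0(3) by (auto simp: in_lists_conv_set)
      have "Lt_eq Ueq (set \<alpha>) (\<alpha> @ re u) (\<alpha> @ re v)" using Lt_append_alpha[OF _ _ Lt] uvM by simp
      then have "Lt_eq Ueq A1 (\<alpha> @ re u) (\<alpha> @ re v)" using A1 unfolding Lt_eq_def by (meson order_trans)
      moreover have "\<alpha> @ re u \<in> lists D" "\<alpha> @ re v \<in> lists D"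
        using uv N(3) C(1) by (auto simp: D_def in_lists_conv_set)
      ultimately have "wtp_eq Ueq A1 (b2 @ \<alpha> @ re u) (b2 @ \<alpha> @ re v)"
        using b2(3) unfolding Lascar_splits_def by blast
      then have "gtp_eq Ueq {} (b2 @ \<alpha> @ re u) (b2 @ \<alpha> @ re v)" by (auto simp: wtp_eq_def)
      then obtain g where g: "g \<in> G" "map (lift g) (b2 @ \<alpha> @ re u) = b2 @ \<alpha> @ re v"
        using gtp_Ueq_iff[of "{}" "b2 @ \<alpha> @ re u"] b2(1) \<alpha> uvM by auto
      then have g2: "map (lift g) (re e) = re e" "fx g" "map (lift g) (re u) = re v" by (simp_all add: re_e)
      then have "re (map g e) = re e" "re (map g u) = re v" using lift_re[OF g(1)] eM uvM by metis+
      then have "map g e = e" "map g u = v" using re_inj map_car[OF g(1)] eM uvM by blast+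
      then show ?thesis using g(1) g2(2) by blast
    qed
    have "c \<subseteq> N" "x \<in> lists N" using N(2) x by auto
    then have "Pr e (set x)" using Pr_of_nonLascar[OF N(1,4) c _ _ eM nls d(1) f1 e_def[symmetric]] by blast
    then show "Pr e B" by (simp only: x)
  qed
  moreover have "wtp_eq Ueq C (re e) e'" using b2(2) unfolding re_e wtp_eq_def by (meson le_supI2)
  ultimately show thesis using that Pr_mono S0(2) by (meson le_supE)
qed

lemma gtp_of_Pr:
  assumes d: "Pr d X" "Pr d' X" and B: "finite B" "B \<subseteq> Meq \<E>" "\<Union>(cv ` B) \<subseteq> X"
  shows "gtp_eq Ueq B (re d) (re d')"
proof -
  have dM: "d \<in> lists (car M)" using Pr_car[OF d(1)] .
  have "finite (\<Union>(cv ` B))" using B cv(1) by blast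
  then have "eqv (\<Union>(cv ` B)) d d'" using Pr_eqv[OF Pr_mono[OF d(1) B(3)] Pr_mono[OF d(2) B(3)]] cv_car[OF B(2)] by blast
  then obtain h where h: "h \<in> G" "\<And>z. z \<in> \<Union>(cv ` B) \<Longrightarrow> h z = z" "map h d = d'" unfolding eqv_iff by blast
  have "lift h p = p" if "p \<in> B" for p using cv(3)[of p h] h(1,2) that B(2) by blast
  moreover have "map (lift h) (re d) = re d'" using lift_re[OF h(1) dM] h(3) by simp
  ultimately show ?thesis unfolding gtp_Ueq_iff[OF B(2) re_Meq[OF dM]] using h(1) by blast
qed

theorem stationary_canonical:
  assumes c: "finite c" "Cov c" and d: "Pr d c" "f0 \<in> G" "fx f0" "map f0 d = a"
  shows "stationary Ueq (re a) (set \<alpha>)"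
  unfolding stationary_def
proof (intro allI impI)
  fix C assume "set \<alpha> \<subseteq> C \<and> C \<subseteq> pts Ueq \<and> |C| <o bd Ueq"
  then have C: "set \<alpha> \<subseteq> C" "C \<subseteq> Meq \<E>" "|C| <o \<delta>" by simp_all
  have dM: "d \<in> lists (car M)" using Pr_car[OF d(1)] .
  have aM: "a \<in> lists (car M)" using map_car[OF d(2) dM] d(4) by simp
  have cM: "c \<subseteq> car M" using c(2) by (simp add: Cov_def)
  have X: "c \<union> \<Union>(cv ` D) \<subseteq> car M" "|c \<union> \<Union>(cv ` D)| <o \<delta>" if "D \<subseteq> Meq \<E>" "|D| <o \<delta>" for D
    using cM cv_car[OF that(1)] small_Un[OF _ cv_small[OF that]] c(1) by (auto simp: small_countable countable_finite)
  show "(\<exists>d'. free_extension Ueq (re a) (set \<alpha>) d' C) \<and>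
    (\<forall>d' d''. free_extension Ueq (re a) (set \<alpha>) d' C \<and> free_extension Ueq (re a) (set \<alpha>) d'' C \<longrightarrow>
      wtp_eq Ueq C d' d'')"
  proof (intro conjI allI impI)
    \<comment> \<open>Existence: a realization of \<open>p\<close> over a real support of
      \<open>C\<close>. Its independence is witnessed, for each larger \<open>D\<close>, by a
      realization over a real support of \<open>D\<close>.\<close>
    obtain d' where d': "Pr d' (c \<union> \<Union>(cv ` C))" using Pr_exists[OF X[OF C(2,3)]] by blast
    have d'M: "d' \<in> lists (car M)" using Pr_car[OF d'] .
    obtain h where h: "h \<in> G" "fx h" "\<And>z. z \<in> c \<Longrightarrow> h z = z" "map h d = d'"
      by (rule Pr_same[OF d(1) Pr_mono[OF d' Un_upper1] c]) blast
    obtain g where g: "g \<in> G" "fx g" "\<And>x. x \<in> car M \<Longrightarrow> g (f0 x) = x" "\<And>x. x \<in> car M \<Longrightarrow> f0 (g x) = x"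
      using fx_inv[OF d(2,3)] by blast
    have gM: "(\<lambda>x. h (g x)) \<in> G" "fx (\<lambda>x. h (g x))"
      using Aut_comp[OF h(1) g(1)] fx_comp[OF h(2) g(2)] by simp_all
    have "map g (map f0 d) = d" by (rule map_inv_car) (use g(3) dM in auto)
    then have "map h (map g a) = d'" unfolding d(4) h(4)[symmetric] by (rule arg_cong)
    then have "map (\<lambda>x. h (g x)) a = d'" by (simp add: comp_def)
    then have "map (lift (\<lambda>x. h (g x))) (re a) = re d'" using lift_re[OF gM(1) aM] by (simp only:)
    then have "wtp_eq Ueq (set \<alpha>) (re a) (re d')"
      unfolding wtp_alpha_iff[OF re_Meq[OF aM]] using gM by blast
    moreover have "indep Ueq (re d') (set \<alpha>) C"
      unfolding indep_def
    proof (intro exI[of _ "set \<alpha>"] conjI allI impI)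
      fix D assume "set \<alpha> \<union> C \<subseteq> D \<and> D \<subseteq> pts Ueq \<and> |D| <o bd Ueq"
      then have D: "C \<subseteq> D" "D \<subseteq> Meq \<E>" "|D| <o \<delta>" by simp_all
      obtain d2 where d2: "Pr d2 (c \<union> \<Union>(cv ` D))" using Pr_exists[OF X[OF D(2,3)]] by blast
      have "wtp_eq Ueq (set \<alpha> \<union> C) (re d2) (re d')"
        unfolding wtp_eq_def
      proof (intro allI impI)
        fix B assume "finite B \<and> B \<subseteq> set \<alpha> \<union> C"
        then have B: "finite B" "B \<subseteq> C" using C(1) by auto
        have "\<Union>(cv ` B) \<subseteq> \<Union>(cv ` C)" "\<Union>(cv ` B) \<subseteq> \<Union>(cv ` D)" using B(2) D(1) by blast+
        then have "Pr d2 (\<Union>(cv ` B))" "Pr d' (\<Union>(cv ` B))" using Pr_mono[OF d2] Pr_mono[OF d'] by (simp_all add: le_supI2)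
        then show "gtp_eq Ueq B (re d2) (re d')" using gtp_of_Pr B C(2) by blast
      qed
      then show "\<exists>b\<in>lists (pts Ueq). wtp_eq Ueq (set \<alpha> \<union> C) b (re d') \<and> \<not> Lascar_splits Ueq b D (set \<alpha>)"
        using Pr_nonsplit[OF c d2 D(2)] Pr_car[OF d2] by (intro bexI[of _ "re d2"]) auto
    qed simp_all
    ultimately show "\<exists>d'. free_extension Ueq (re a) (set \<alpha>) d' C"
      using d'M by (intro exI[of _ "re d'"]) (simp add: free_extension_def)
  next
    fix e1 e2 assume fr: "free_extension Ueq (re a) (set \<alpha>) e1 C \<and> free_extension Ueq (re a) (set \<alpha>) e2 C"
    \<comment> \<open>Uniqueness: both extensions have over \<open>C\<close> the types of
      realizations of \<open>p\<close> over one and the same real support.\<close>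
    obtain d1 where d1: "Pr d1 (c \<union> \<Union>(cv ` C))" "wtp_eq Ueq C (re d1) e1"
      by (rule free_extension_Pr[OF c d C X[OF C(2,3)] conjunct1[OF fr]]) blast
    obtain d2 where d2: "Pr d2 (c \<union> \<Union>(cv ` C))" "wtp_eq Ueq C (re d2) e2"
      by (rule free_extension_Pr[OF c d C X[OF C(2,3)] conjunct2[OF fr]]) blast
    show "wtp_eq Ueq C e1 e2"
      unfolding wtp_eq_def
    proof (intro allI impI)
      fix B assume B: "finite B \<and> B \<subseteq> C"
      have BM: "B \<subseteq> Meq \<E>" using B C(2) by blast
      have "\<Union>(cv ` B) \<subseteq> c \<union> \<Union>(cv ` C)" using B by blast
      then have e: "gtp_eq Ueq B (re d1) (re d2)" using gtp_of_Pr[OF d1(1) d2(1) _ BM] B by blast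
      have M: "re d1 \<in> lists (Meq \<E>)" "re d2 \<in> lists (Meq \<E>)" using Pr_car d1(1) d2(1) by simp_all
      have "gtp_eq Ueq B (re d1) e1" "gtp_eq Ueq B (re d2) e2" using d1(2) d2(2) B by (simp_all add: wtp_eq_def)
      then show "gtp_eq Ueq B e1 e2"
        using e M gtp_Ueq_sym[OF BM] gtp_Ueq_trans[OF BM] by meson
    qed
  qed
qed

end

section \<open>Descending to the canonical base\<close>

locale invariant_base = canonical +
  fixes A0 :: "'a set"
  assumes A0: "finite A0" "A0 \<subseteq> car M"
    and nls: "\<And>x y. x \<in> lists (car M) \<Longrightarrow> y \<in> lists (car M) \<Longrightarrow> Lt_eq S.U A0 x y \<Longrightarrow> S.eqv A0 (b @ x) (b @ y)"
begin

lemma A0_super: "A0 \<subseteq> car M'" and A0_small: "|A0| <o \<delta>"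
  using A0 M_super(3) by (auto intro: small_countable countable_finite)

text \<open>A tuple of \<open>M'\<close> is moved into \<open>M\<close> over \<open>A0\<close> and
  from there into a countable s-saturated model, so there are only countably many types over
  \<open>A0\<close> in all of \<open>M'\<close>.\<close>

lemma type_reps:
  obtains N where "countable N" "N \<subseteq> car M" "\<And>l. l \<in> lists (car M') \<Longrightarrow> \<exists>l'\<in>lists N. S.eqv A0 l l'"
proof -
  obtain N where N: "str N" "A0 \<subseteq> N" "countable N"
    using LS_countable[OF str_M A0(2) countable_finite[OF A0(1)]] by metis
  have NM: "N \<subseteq> car M" using str_car N(1) .
  have "\<exists>l'\<in>lists N. S.eqv A0 l l'" if l: "l \<in> lists (car M')" for l
  proof -
    have "set l \<subseteq> car M'" "|set l| <o \<delta>" using l by (auto intro: small_countable countable_finite)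
    then obtain s where s: "s \<in> S.G" "\<And>x. x \<in> A0 \<Longrightarrow> s x = x" "s ` set l \<subseteq> car M"
      using embed_over[OF A0(2) A0_small] by blast
    have sl: "map s l \<in> lists (car M)" using s(3) by (auto simp: in_lists_conv_set)
    obtain l' where l': "l' \<in> lists N" "eqv A0 (map s l) l'" using s_saturated[OF N(1,3) A0(1) N(2) sl] by blast
    have "l' \<in> lists (car M)" using l'(1) NM by (auto simp: in_lists_conv_set)
    then have "S.eqv A0 (map s l) l'" using eqv_super[OF A0(2) A0_small sl] l'(2) by blast
    moreover have "S.eqv A0 l (map s l)" using s by (intro S.eqvI[of s]) auto
    ultimately show ?thesis using S.eqv_trans l'(1) by blast
  qed
  then show thesis using that N(3) NM by blast
qed

text \<open>Bounded in \<open>M'\<close> only means fewer than \<open>|M'|\<close> classes; the Hanf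
  number lowers this to fewer than \<open>\<delta>\<close>. The representatives of types over
  \<open>A0\<close> provide the countable set it asks for.\<close>

lemma super_equiv_few:
  assumes E: "E \<in> bounded_equivs S.U A0 n"
  shows "|tuples n (car M') // E| <o \<delta>"
proof -
  obtain N where N: "countable N" "N \<subseteq> car M" "\<And>l. l \<in> lists (car M') \<Longrightarrow> \<exists>l'\<in>lists N. S.eqv A0 l l'"
    using type_reps by blast
  show ?thesis
  proof (rule S.hanf_number[of \<delta> "lists N" n E A0])
    show "inaccessible \<delta>" by (rule fur_facts)
    show "car M' \<noteq> {}" using fur_facts(8)[OF fur_facts(2)] M_super(3) by auto
    show "countable (lists N)" using N(1) by simp
    show "\<exists>l'\<in>lists N. \<exists>g\<in>S.G. map g l = l'" if "l \<in> lists (car M')" for l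
      using N(3)[OF that] unfolding S.eqv_iff by blast
    show "equiv (tuples n (car M')) E" "|tuples n (car M') // E| <o |car M'|"
      using E by (simp_all add: bounded_equivs_def)
    show "(x, y) \<in> E \<longleftrightarrow> (map f x, map f y) \<in> E"
      if "f \<in> S.G" "\<And>z. z \<in> A0 \<Longrightarrow> f z = z" "x \<in> tuples n (car M')" "y \<in> tuples n (car M')" for f x y
      using E that by (simp add: bounded_equivs_def aut_over_def)
  qed (use A0(1) A0_super in auto)
qed

text \<open>An invariant relation is a union of types over \<open>A0\<close> of pairs, so it is
  coded by a set of lists from a countable set.\<close>

lemma super_equivs_few: "|bounded_equivs S.U A0 n| <o \<delta>"
proof -
  obtain N where N: "countable N" "N \<subseteq> car M" "\<And>l. l \<in> lists (car M') \<Longrightarrow> \<exists>l'\<in>lists N. S.eqv A0 l l'"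
    using type_reps by blast
  define \<Theta> where "\<Theta> E = {l \<in> lists N. \<exists>x y. length x = n \<and> (x, y) \<in> E \<and> S.eqv A0 (x @ y) l}" for E
  have sub: "E \<subseteq> E'" if E: "E \<in> bounded_equivs S.U A0 n" and E': "E' \<in> bounded_equivs S.U A0 n" and eq: "\<Theta> E = \<Theta> E'" for E E'
  proof (rule subrelI)
    fix x y assume xy: "(x, y) \<in> E"
    have t: "x \<in> tuples n (car M')" "y \<in> tuples n (car M')"
      if "(x, y) \<in> E" "E \<in> bounded_equivs S.U A0 n" for x y E
      using that by (auto simp: bounded_equivs_def equiv_def)
    have "x @ y \<in> lists (car M')" using t[OF xy E] by (simp add: tuples_def)
    then obtain l where l: "l \<in> lists N" "S.eqv A0 (x @ y) l" using N(3) by blast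
    then have "l \<in> \<Theta> E" using xy t[OF xy E] by (auto simp: \<Theta>_def tuples_def)
    then have "l \<in> \<Theta> E'" by (simp only: eq)
    then obtain x' y' where x': "length x' = n" "(x', y') \<in> E'" "S.eqv A0 (x' @ y') l" unfolding \<Theta>_def by blast
    have "S.eqv A0 l (x @ y)" using S.eqv_sym[OF l(2) _ A0_super] \<open>x @ y \<in> lists (car M')\<close> by blast
    then have "S.eqv A0 (x' @ y') (x @ y)" using S.eqv_trans x'(3) by blast
    then obtain f where f: "f \<in> S.G" "\<And>z. z \<in> A0 \<Longrightarrow> f z = z" "map f (x' @ y') = x @ y" unfolding S.eqv_iff by blast
    have "length x = n" using t(1)[OF xy E] by (simp add: tuples_def)
    then have "map f x' = x" "map f y' = y" using f(3) x'(1) by simp_all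
    moreover have "(x', y') \<in> E' \<longleftrightarrow> (map f x', map f y') \<in> E'"
      using E' f(1,2) t[OF x'(2) E'] by (simp add: bounded_equivs_def aut_over_def)
    ultimately show "(x, y) \<in> E'" using x'(2) by simp
  qed
  have "inj_on \<Theta> (bounded_equivs S.U A0 n)"
    using sub by (intro inj_onI subset_antisym) metis+
  moreover have "\<Theta> ` bounded_equivs S.U A0 n \<subseteq> Pow (lists N)" by (auto simp: \<Theta>_def)
  moreover have "|Pow (lists N)| <o \<delta>" using N(1) by (intro small_Pow small_countable) simp
  ultimately show ?thesis by (meson card_of_ordLeq ordLeq_ordLess_trans)
qed

lemma Lt_super_iff:
  "Lt_eq S.U A0 x y \<longleftrightarrow> length x = length y \<and> (\<forall>E\<in>bounded_equivs S.U A0 (length x). (x, y) \<in> E)"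
proof -
  have "bounded_equivs S.U A n \<subseteq> bounded_equivs S.U A0 n" if "A \<subseteq> A0" for A n
    using that unfolding bounded_equivs_def aut_over_def by (auto 0 4)
  then show ?thesis unfolding Lt_eq_def using A0(1) by blast
qed

text \<open>A Lascar type is the family of its classes under all bounded relations. Relations and
  classes both number fewer than \<open>\<delta>\<close>, and by inaccessibility so do such
  families.\<close>

lemma Lt_reps:
  obtains R where "R \<subseteq> lists (car M)" "|R| <o \<delta>" "\<And>x. x \<in> lists (car M) \<Longrightarrow> \<exists>r\<in>R. Lt_eq S.U A0 x r"
proof -
  have "\<exists>R. R \<subseteq> tuples n (car M) \<and> |R| <o \<delta> \<and> (\<forall>x\<in>tuples n (car M). \<exists>r\<in>R. Lt_eq S.U A0 x r)" for n
  proof -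
    let ?B = "bounded_equivs S.U A0 n"
    define \<Phi> where "\<Phi> x = (\<lambda>E. (E, E `` {x})) ` ?B" for x
    have tM: "tuples n (car M) \<subseteq> tuples n (car M')" unfolding tuples_def using lists_mono[OF M_super(3)] by blast
    have "\<Phi> ` tuples n (car M) \<subseteq> Pow (SIGMA E:?B. tuples n (car M') // E)"
      using tM by (auto simp: \<Phi>_def intro!: quotientI)
    moreover have "|Pow (SIGMA E:?B. tuples n (car M') // E)| <o \<delta>"
      by (intro small_Pow small_Sigma super_equivs_few super_equiv_few)
    ultimately have "|\<Phi> ` tuples n (car M)| <o \<delta>" using ordLess_subset by blast
    then obtain R where R: "R \<subseteq> tuples n (car M)" "|R| <o \<delta>" "\<And>x. x \<in> tuples n (car M) \<Longrightarrow> \<exists>y\<in>R. \<Phi> y = \<Phi> x"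
      by (rule card_reps) blast
    have key: "Lt_eq S.U A0 x r" if "x \<in> tuples n (car M)" "r \<in> tuples n (car M)" "\<Phi> r = \<Phi> x" for x r
    proof -
      have "(x, r) \<in> E" if E: "E \<in> ?B" for E
      proof -
        have "(E, E `` {r}) \<in> \<Phi> x" using E that unfolding \<open>\<Phi> r = \<Phi> x\<close>[symmetric] by (auto simp: \<Phi>_def)
        then have "E `` {x} = E `` {r}" by (auto simp: \<Phi>_def)
        moreover have "equiv (tuples n (car M')) E" using E by (simp add: bounded_equivs_def)
        ultimately show ?thesis using eq_equiv_class tM \<open>r \<in> tuples n (car M)\<close> by fast
      qed
      then show ?thesis using that(1,2) by (simp add: Lt_super_iff tuples_def)
    qed
    show ?thesis
    proof (intro exI[of _ R] conjI ballI)
      fix x assume x: "x \<in> tuples n (car M)"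
      obtain r where r: "r \<in> R" "\<Phi> r = \<Phi> x" using R(3)[OF x] by blast
      then show "\<exists>r\<in>R. Lt_eq S.U A0 x r" using key[OF x _ r(2)] R(1) by blast
    qed (use R in auto)
  qed
  then obtain R where R: "\<And>n. R n \<subseteq> tuples n (car M)" "\<And>n. |R n| <o \<delta>"
    "\<And>n x. x \<in> tuples n (car M) \<Longrightarrow> \<exists>r\<in>R n. Lt_eq S.U A0 x r" by metis
  show thesis
  proof (rule that[of "\<Union>n. R n"])
    show "(\<Union>n. R n) \<subseteq> lists (car M)" using R(1) by (auto simp: tuples_def)
    show "|\<Union>n. R n| <o \<delta>" using R(2) by (intro small_UN) (simp_all add: small_countable)
    show "\<exists>r\<in>\<Union>n. R n. Lt_eq S.U A0 x r" if "x \<in> lists (car M)" for x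
      using R(3)[of x "length x"] that by (auto simp: tuples_def)
  qed
qed

section \<open>The conjugates of \<open>\<alpha>\<close> over \<open>A0\<close>\<close>

definition fixA0 :: "('a \<Rightarrow> 'a) set" where
  "fixA0 = {f \<in> G. \<forall>z\<in>A0. f z = z}"

lemma fixA0_id: "(\<lambda>x. x) \<in> fixA0" and fixA0_comp: "f \<in> fixA0 \<Longrightarrow> g \<in> fixA0 \<Longrightarrow> (\<lambda>x. f (g x)) \<in> fixA0"
  using Aut_id Aut_comp by (simp_all add: fixA0_def)

lemma fixA0_inv:
  assumes "f \<in> fixA0"
  obtains g where "g \<in> fixA0" "\<And>x. x \<in> car M \<Longrightarrow> g (f x) = x" "\<And>x. x \<in> car M \<Longrightarrow> f (g x) = x"
proof -
  have f: "f \<in> G" "\<And>z. z \<in> A0 \<Longrightarrow> f z = z" using assms by (simp_all add: fixA0_def)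
  obtain g where g: "g \<in> G" "\<And>x. x \<in> car M \<Longrightarrow> g (f x) = x" "\<And>x. x \<in> car M \<Longrightarrow> f (g x) = x"
    using Aut_inv[OF f(1)] by blast
  have "g z = z" if "z \<in> A0" for z using g(2)[of z] f(2)[OF that] that A0(2) by auto
  then have "g \<in> fixA0" using g(1) by (simp add: fixA0_def)
  then show thesis using that g(2,3) by blast
qed

lemma Lt_map:
  assumes f: "f \<in> fixA0" and xy: "x \<in> lists (car M)" "y \<in> lists (car M)" and Lt: "Lt_eq S.U A0 x y"
  shows "Lt_eq S.U A0 (map f x) (map f y)"
  unfolding Lt_super_iff
proof (intro conjI ballI)
  show "length (map f x) = length (map f y)" using Lt by (simp add: Lt_eq_def)
  fix E assume E: "E \<in> bounded_equivs S.U A0 (length (map f x))"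
  obtain g where g: "g \<in> S.G" "\<And>x. x \<in> car M \<Longrightarrow> g x = f x" using Aut_extend[of f] f unfolding fixA0_def by blast
  have gxy: "map g x = map f x" "map g y = map f y" using g(2) xy by (auto simp: in_lists_conv_set)
  have "\<forall>z\<in>A0. g z = z" using g(2) f A0(2) by (auto simp: fixA0_def)
  moreover have "(x, y) \<in> E" using Lt E by (simp add: Lt_super_iff)
  moreover then have "x \<in> tuples (length x) (car M')" "y \<in> tuples (length x) (car M')"
    using E by (auto simp: bounded_equivs_def equiv_def)
  ultimately have "(map g x, map g y) \<in> E" using E g(1) by (simp add: bounded_equivs_def aut_over_def)
  then show "(map f x, map f y) \<in> E" by (simp only: gxy)
qed

text \<open>If \<open>d\<close> realizes \<open>p\<close> over the entries of \<open>x\<close>, then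
  \<open>d @ x\<close> has the type of \<open>b @ x\<close>; applying \<open>h\<close> and the
  hypothesis at \<open>x\<close> shows that the image of \<open>d\<close> realizes \<open>p\<close>
  over the image of \<open>x\<close>. So \<open>h\<close> fixes \<open>p\<close>, and hence
  \<open>\<alpha>\<close>.\<close>

lemma fx_of_types:
  assumes h: "h \<in> G" and types: "\<And>x. x \<in> lists (car M) \<Longrightarrow> S.eqv {} (b @ x) (b @ map h x)"
  shows "fx h"
proof -
  obtain h' where h': "h' \<in> S.G" "\<And>x. x \<in> car M \<Longrightarrow> h' x = h x" using Aut_extend[OF h] by blast
  have "fixes_global_type M (lift h) (global_type_of K M M' b)"
    unfolding fixes_global_type_def
  proof (intro allI impI ballI)
    fix A B d
    assume AB: "finite A \<and> A \<subseteq> car M \<and> finite B \<and> B \<subseteq> car M \<and> on_reals M (lift h) ` B = A"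
      and d: "d \<in> lists (car M)" "d \<in> global_type_of K M M' b B"
    have "finite B" using AB by (simp only:)
    then obtain x where x: "set x = B" using finite_list by blast
    have xM: "x \<in> lists (car M)" using x AB by auto
    have "on_reals M (lift h) ` B = h ` B"
      by (rule image_cong[OF refl]) (use on_reals_lift[OF h] AB in blast)
    then have hB: "A = set (map h x)" using AB x by simp
    have hd: "map (on_reals M (lift h)) d = map h d" using on_reals_lift[OF h] d(1) by (auto simp: in_lists_conv_set)
    have "S.eqv B b d" using d(2) AB by (simp add: global_type_of_def gtp_def)
    then have bd: "S.eqv {} (b @ x) (d @ x)" using S.eqv_unfix(1)[of "{}" x] x by simp
    have "map h' (d @ x) = map h d @ map h x" using h'(2) d(1) xM by (auto simp: in_lists_conv_set)
    then have "S.eqv {} (d @ x) (map h d @ map h x)" using h'(1) by (intro S.eqvI) auto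
    moreover have "b @ x \<in> lists (car M')" using b xM M_super(3) by (auto simp: in_lists_conv_set)
    then have "S.eqv {} (b @ map h x) (b @ x)" using S.eqv_sym[OF types[OF xM]] by blast
    ultimately have "S.eqv {} (b @ map h x) (map h d @ map h x)" using bd S.eqv_trans by blast
    moreover have "length b = length (map h d)" using S.eqv_length[OF bd] by simp
    ultimately have "S.eqv A b (map h d)" using S.eqv_fix[of "{}" b "map h x" "map h d"] hB by simp
    moreover have "map h d \<in> lists (car M')" using map_car[OF h d(1)] M_super(3) lists_mono by blast
    ultimately show "map (on_reals M (lift h)) d \<in> global_type_of K M M' b A"
      using AB unfolding hd by (simp add: global_type_of_def gtp_def)
  qed
  then show ?thesis using base[OF h] by blast
qed

definition \<Omega> :: "'a imag list set" where
  "\<Omega> = (\<lambda>f. map (lift f) \<alpha>) ` fixA0"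

lemma \<Omega>_Meq: "\<omega> \<in> \<Omega> \<Longrightarrow> \<omega> \<in> lists (Meq \<E>)"
  using \<alpha> by (auto simp: \<Omega>_def fixA0_def in_lists_conv_set)

lemma alpha_\<Omega>: "\<alpha> \<in> \<Omega>"
  unfolding \<Omega>_def using \<alpha> lift_id[of _ "\<lambda>x. x"] fixA0_id by (intro image_eqI[of _ _ "\<lambda>x. x"]) (auto intro!: map_idI[symmetric])

lemma \<Omega>_map: "\<omega> \<in> \<Omega> \<Longrightarrow> f \<in> fixA0 \<Longrightarrow> map (lift f) \<omega> \<in> \<Omega>"
  using fixA0_comp by (force simp: \<Omega>_def lift_comp comp_def)

lemma \<Omega>_small: "|\<Omega>| <o \<delta>"
proof -
  obtain N where N: "countable N" "N \<subseteq> car M" "\<And>l. l \<in> lists (car M') \<Longrightarrow> \<exists>l'\<in>lists N. S.eqv A0 l l'"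
    using type_reps by blast
  obtain R where R: "R \<subseteq> lists (car M)" "|R| <o \<delta>" "\<And>x. x \<in> lists (car M) \<Longrightarrow> \<exists>r\<in>R. Lt_eq S.U A0 x r"
    using Lt_reps by blast
  define \<Psi> where "\<Psi> f = {(r, l). r \<in> R \<and> l \<in> lists N \<and> S.eqv A0 (b @ map f r) l}" for f
  have bM: "b @ x \<in> lists (car M')" if "x \<in> lists (car M)" for x
    using b that M_super(3) by (auto simp: in_lists_conv_set)
  have \<Psi>: "S.eqv A0 (b @ map f x) (b @ map f' x)"
    if f: "f \<in> fixA0" and f': "f' \<in> fixA0" and eq: "\<Psi> f = \<Psi> f'" and x: "x \<in> lists (car M)" for f f' x
  proof -
    obtain r where r: "r \<in> R" "Lt_eq S.U A0 x r" using R(3)[OF x] by blast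
    have rM: "r \<in> lists (car M)" using r(1) R(1) by blast
    have fM: "map g z \<in> lists (car M)" if "g \<in> fixA0" "z \<in> lists (car M)" for g z
      using that unfolding fixA0_def by (simp only: mem_Collect_eq map_car)
    obtain l where l: "l \<in> lists N" "S.eqv A0 (b @ map f r) l" using N(3)[OF bM[OF fM[OF f rM]]] by blast
    then have "(r, l) \<in> \<Psi> f" using r(1) by (simp add: \<Psi>_def)
    then have l': "S.eqv A0 (b @ map f' r) l" unfolding eq by (simp add: \<Psi>_def)
    have 1: "S.eqv A0 (b @ map f x) (b @ map f r)"
      using nls[OF fM[OF f x] fM[OF f rM] Lt_map[OF f x rM r(2)]] .
    have 2: "S.eqv A0 (b @ map f' x) (b @ map f' r)"
      using nls[OF fM[OF f' x] fM[OF f' rM] Lt_map[OF f' x rM r(2)]] .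
    have "S.eqv A0 l (b @ map f' x)"
      using S.eqv_sym[OF S.eqv_trans[OF 2 l'] bM[OF fM[OF f' x]] A0_super] .
    then show ?thesis using S.eqv_trans[OF S.eqv_trans[OF 1 l(2)]] by blast
  qed
  have "\<exists>f. f \<in> fixA0 \<and> map (lift f) \<omega> = \<alpha>" if \<omega>: "\<omega> \<in> \<Omega>" for \<omega>
  proof -
    obtain f where f: "f \<in> fixA0" "\<omega> = map (lift f) \<alpha>" using \<omega> by (auto simp: \<Omega>_def)
    obtain g where g: "g \<in> fixA0" "\<And>x. x \<in> car M \<Longrightarrow> g (f x) = x" "\<And>x. x \<in> car M \<Longrightarrow> f (g x) = x"
      using fixA0_inv[OF f(1)] by blast
    have "map (lift g) \<omega> = \<alpha>" unfolding f(2) by (rule map_lift_inv[of g f, OF g(2) \<alpha>])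
    then show ?thesis using g(1) by blast
  qed
  \<comment> \<open>The direction matters: \<open>F \<omega>\<close> leads from
    \<open>\<omega>\<close> to \<open>\<alpha>\<close>. Equal codes of \<open>\<omega>\<close> and
    \<open>\<omega>'\<close> make \<open>F \<omega>'\<close> composed with the inverse of
    \<open>F \<omega>\<close> fix \<open>\<alpha>\<close>, and for this direction that yields
    \<open>\<omega> = \<omega>'\<close>.\<close>
  then obtain F where F: "\<And>\<omega>. \<omega> \<in> \<Omega> \<Longrightarrow> F \<omega> \<in> fixA0 \<and> map (lift (F \<omega>)) \<omega> = \<alpha>" by metis
  have "inj_on (\<lambda>\<omega>. \<Psi> (F \<omega>)) \<Omega>"
  proof (rule inj_onI)
    fix \<omega> \<omega>' assume \<omega>: "\<omega> \<in> \<Omega>" "\<omega>' \<in> \<Omega>" and eq: "\<Psi> (F \<omega>) = \<Psi> (F \<omega>')"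
    define f f' where "f = F \<omega>" and "f' = F \<omega>'"
    have f: "f \<in> fixA0" "map (lift f) \<omega> = \<alpha>" "f' \<in> fixA0" "map (lift f') \<omega>' = \<alpha>"
      using F \<omega> by (simp_all add: f_def f'_def)
    have fG: "f \<in> G" "f' \<in> G" using f by (simp_all add: fixA0_def)
    obtain g where g: "g \<in> fixA0" "\<And>x. x \<in> car M \<Longrightarrow> g (f x) = x" "\<And>x. x \<in> car M \<Longrightarrow> f (g x) = x"
      using fixA0_inv[OF f(1)] by blast
    have gG: "g \<in> G" using g(1) by (simp add: fixA0_def)
    have "fx (\<lambda>x. f' (g x))"
    proof (rule fx_of_types[OF Aut_comp[OF fG(2) gG]])
      fix x assume x: "x \<in> lists (car M)"
      have "S.eqv A0 (b @ map f (map g x)) (b @ map f' (map g x))"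
        using \<Psi>[OF f(1,3) eq[folded f_def f'_def] map_car[OF gG x]] .
      moreover have "map f (map g x) = x" using map_inv_car[of f g, OF g(3) x] .
      moreover have "map f' (map g x) = map (\<lambda>x. f' (g x)) x" by simp
      ultimately have "S.eqv A0 (b @ x) (b @ map (\<lambda>x. f' (g x)) x)" by (simp only:)
      then show "S.eqv {} (b @ x) (b @ map (\<lambda>x. f' (g x)) x)" using S.eqv_mono by blast
    qed
    then have "map (lift f') (map (lift g) \<alpha>) = \<alpha>" by (simp add: lift_comp comp_def)
    moreover have "map (lift g) \<alpha> = \<omega>" using map_lift_inv[of g f, OF g(2) \<Omega>_Meq[OF \<omega>(1)]] f(2) by simp
    ultimately have 1: "map (lift f') \<omega> = map (lift f') \<omega>'" using f(4) by simp
    obtain g' where g': "g' \<in> fixA0" "\<And>x. x \<in> car M \<Longrightarrow> g' (f' x) = x" "\<And>x. x \<in> car M \<Longrightarrow> f' (g' x) = x"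
      using fixA0_inv[OF f(3)] by blast
    show "\<omega> = \<omega>'"
      using map_lift_inv[of g' f', OF g'(2) \<Omega>_Meq[OF \<omega>(1)]] map_lift_inv[of g' f', OF g'(2) \<Omega>_Meq[OF \<omega>(2)]] 1
      by metis
  qed
  moreover have "(\<lambda>\<omega>. \<Psi> (F \<omega>)) ` \<Omega> \<subseteq> Pow (R \<times> lists N)" by (auto simp: \<Psi>_def)
  moreover have "|Pow (R \<times> lists N)| <o \<delta>" using R(2) N(1) by (intro small_Pow small_Sigma) (auto intro: small_countable)
  ultimately show ?thesis by (meson card_of_ordLeq ordLeq_ordLess_trans)
qed

text \<open>The automorphism may depend on \<open>\<omega>\<close>: each single conjugate then
  contributes a relation with countably many classes. Taking all conjugates, and not only
  \<open>\<alpha>\<close>, makes the relation invariant under \<open>fixA0\<close>.\<close>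

definition conj_eq :: "'a list \<Rightarrow> 'a list \<Rightarrow> bool" where
  "conj_eq x y \<longleftrightarrow> (\<forall>\<omega>\<in>\<Omega>. \<exists>h\<in>G. map (lift h) \<omega> = \<omega> \<and> map h x = y)"

lemma conj_eq_refl: "conj_eq x x"
  unfolding conj_eq_def
proof
  fix \<omega> assume "\<omega> \<in> \<Omega>"
  then have "map (lift (\<lambda>x. x)) \<omega> = \<omega>" using \<Omega>_Meq lift_id[of _ "\<lambda>x. x"] by (auto intro!: map_idI)
  then show "\<exists>h\<in>G. map (lift h) \<omega> = \<omega> \<and> map h x = x" using Aut_id by (intro bexI[of _ "\<lambda>x. x"]) simp_all
qed

lemma conj_eq_sym:
  assumes "conj_eq x y" "x \<in> lists (car M)"
  shows "conj_eq y x"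
  unfolding conj_eq_def
proof
  fix \<omega> assume \<omega>: "\<omega> \<in> \<Omega>"
  then obtain h where h: "h \<in> G" "map (lift h) \<omega> = \<omega>" "map h x = y" using assms(1) unfolding conj_eq_def by blast
  obtain g where g: "g \<in> G" "\<And>x. x \<in> car M \<Longrightarrow> g (h x) = x" "\<And>x. x \<in> car M \<Longrightarrow> h (g x) = x"
    using Aut_inv[OF h(1)] by blast
  have "map (lift g) \<omega> = \<omega>" using map_lift_inv[of g h, OF g(2) \<Omega>_Meq[OF \<omega>]] unfolding h(2) by simp
  moreover have "map g y = x" using map_inv_car[of g h, OF g(2) assms(2)] unfolding h(3) by simp
  ultimately show "\<exists>h\<in>G. map (lift h) \<omega> = \<omega> \<and> map h y = x" using g(1) by blast
qed

lemma conj_eq_trans: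
  assumes "conj_eq x y" "conj_eq y z"
  shows "conj_eq x z"
  unfolding conj_eq_def
proof
  fix \<omega> assume \<omega>: "\<omega> \<in> \<Omega>"
  obtain h where h: "h \<in> G" "map (lift h) \<omega> = \<omega>" "map h x = y" using assms(1) \<omega> unfolding conj_eq_def by blast
  obtain g where g: "g \<in> G" "map (lift g) \<omega> = \<omega>" "map g y = z" using assms(2) \<omega> unfolding conj_eq_def by blast
  have "map (lift g) (map (lift h) \<omega>) = \<omega>" "map g (map h x) = z" unfolding h(2,3) by (rule g(2), rule g(3))
  then show "\<exists>h\<in>G. map (lift h) \<omega> = \<omega> \<and> map h x = z"
    using Aut_comp[OF g(1) h(1)] by (intro bexI[of _ "\<lambda>x. g (h x)"]) (simp_all add: lift_comp comp_def)
qed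

lemma conj_eq_map:
  assumes f: "f \<in> fixA0" and xy: "x \<in> lists (car M)" "conj_eq x y"
  shows "conj_eq (map f x) (map f y)"
  unfolding conj_eq_def
proof
  fix \<omega> assume \<omega>: "\<omega> \<in> \<Omega>"
  obtain g where g: "g \<in> fixA0" "\<And>x. x \<in> car M \<Longrightarrow> g (f x) = x" "\<And>x. x \<in> car M \<Longrightarrow> f (g x) = x"
    using fixA0_inv[OF f] by blast
  obtain h where h: "h \<in> G" "map (lift h) (map (lift g) \<omega>) = map (lift g) \<omega>" "map h x = y"
    using xy(2) \<Omega>_map[OF \<omega> g(1)] unfolding conj_eq_def by blast
  have "(\<lambda>x. f (h (g x))) \<in> G" using f g(1) h(1) Aut_comp[of f "\<lambda>x. h (g x)"] Aut_comp[of h g] by (simp add: fixA0_def)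
  moreover have "map (lift f) (map (lift g) \<omega>) = \<omega>" by (rule map_lift_inv[of f g, OF g(3) \<Omega>_Meq[OF \<omega>]])
  then have "map (lift f) (map (lift h) (map (lift g) \<omega>)) = \<omega>" unfolding h(2) .
  then have "map (lift (\<lambda>x. f (h (g x)))) \<omega> = \<omega>" by (simp add: lift_comp comp_def)
  moreover have "map f (map h (map g (map f x))) = map f y"
    by (simp only: map_inv_car[of g f, OF g(2) xy(1)] h(3))
  then have "map (\<lambda>x. f (h (g x))) (map f x) = map f y" by (simp add: comp_def)
  ultimately show "\<exists>h\<in>G. map (lift h) \<omega> = \<omega> \<and> map h (map f x) = map f y" by blast
qed

text \<open>For each \<open>\<omega>\<close> a countable s-saturated model represents all types over
  \<open>\<omega>\<close>. A class is coded by its types over all the conjugates, and fewer than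
  \<open>\<delta>\<close> conjugates leave fewer than \<open>\<delta>\<close> codes.\<close>

lemma conj_eq_reps:
  obtains R where "R \<subseteq> tuples n (car M)" "|R| <o \<delta>" "\<And>x. x \<in> tuples n (car M) \<Longrightarrow> \<exists>r\<in>R. conj_eq x r"
proof -
  have "\<exists>N. countable N \<and> (\<forall>x\<in>lists (car M). \<exists>h\<in>G. map (lift h) \<omega> = \<omega> \<and> map h x \<in> lists N)" if \<omega>: "\<omega> \<in> \<Omega>" for \<omega>
  proof -
    have sub: "set \<omega> \<subseteq> Meq \<E>" using \<Omega>_Meq[OF \<omega>] by auto
    define c where "c = \<Union>(cv ` set \<omega>)"
    have c: "finite c" "c \<subseteq> car M" using cv(1) sub cv_car[OF sub] by (auto simp: c_def)
    obtain N where N: "str N" "c \<subseteq> N" "countable N" using LS_countable[OF str_M c(2) countable_finite[OF c(1)]] by metis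
    have "\<exists>h\<in>G. map (lift h) \<omega> = \<omega> \<and> map h x \<in> lists N" if x: "x \<in> lists (car M)" for x
    proof -
      obtain l where l: "l \<in> lists N" "eqv c x l" using s_saturated[OF N(1,3) c(1) N(2) x] by blast
      then obtain h where h: "h \<in> G" "\<And>z. z \<in> c \<Longrightarrow> h z = z" "map h x = l" unfolding eqv_iff by blast
      have "lift h p = p" if "p \<in> set \<omega>" for p using cv(3)[OF _ h(1), of p] h(2) sub that by (auto simp: c_def)
      then have "map (lift h) \<omega> = \<omega>" by (auto intro: map_idI)
      then show ?thesis using h(1,3) l(1) by blast
    qed
    then show ?thesis using N(3) by blast
  qed
  then obtain N where N: "\<And>\<omega>. \<omega> \<in> \<Omega> \<Longrightarrow> countable (N \<omega>)"
    "\<And>\<omega> x. \<omega> \<in> \<Omega> \<Longrightarrow> x \<in> lists (car M) \<Longrightarrow> \<exists>h\<in>G. map (lift h) \<omega> = \<omega> \<and> map h x \<in> lists (N \<omega>)" by metis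
  define \<Phi> where "\<Phi> x = {(\<omega>, l). \<omega> \<in> \<Omega> \<and> l \<in> lists (N \<omega>) \<and> (\<exists>h\<in>G. map (lift h) \<omega> = \<omega> \<and> map h x = l)}" for x
  have "\<Phi> ` tuples n (car M) \<subseteq> Pow (SIGMA \<omega>:\<Omega>. lists (N \<omega>))" by (auto simp: \<Phi>_def)
  moreover have "|Pow (SIGMA \<omega>:\<Omega>. lists (N \<omega>))| <o \<delta>"
  proof (rule small_Pow[OF small_Sigma[OF \<Omega>_small]])
    show "|lists (N \<omega>)| <o \<delta>" if "\<omega> \<in> \<Omega>" for \<omega>
      using N(1)[OF that] by (intro small_countable countable_lists)
  qed
  ultimately have "|\<Phi> ` tuples n (car M)| <o \<delta>" by (rule ordLess_subset[rotated])
  then obtain R where R: "R \<subseteq> tuples n (car M)" "|R| <o \<delta>" "\<And>x. x \<in> tuples n (car M) \<Longrightarrow> \<exists>y\<in>R. \<Phi> y = \<Phi> x"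
    by (rule card_reps) blast
  have \<Phi>_iff: "(\<omega>, l) \<in> \<Phi> x \<longleftrightarrow> \<omega> \<in> \<Omega> \<and> l \<in> lists (N \<omega>) \<and> (\<exists>h\<in>G. map (lift h) \<omega> = \<omega> \<and> map h x = l)" for \<omega> l x
    by (simp add: \<Phi>_def)
  have key: "conj_eq x r" if x: "x \<in> lists (car M)" and r: "r \<in> lists (car M)" and eq: "\<Phi> r = \<Phi> x" for x r
    unfolding conj_eq_def
  proof
    fix \<omega> assume \<omega>: "\<omega> \<in> \<Omega>"
    obtain h where h: "h \<in> G" "map (lift h) \<omega> = \<omega>" "map h x \<in> lists (N \<omega>)" using N(2)[OF \<omega> x] by blast
    then have "(\<omega>, map h x) \<in> \<Phi> x" unfolding \<Phi>_iff using \<omega> by blast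
    then obtain k where k: "k \<in> G" "map (lift k) \<omega> = \<omega>" "map k r = map h x"
      unfolding eq[symmetric] \<Phi>_iff by blast
    obtain g where g: "g \<in> G" "\<And>x. x \<in> car M \<Longrightarrow> g (k x) = x" "\<And>x. x \<in> car M \<Longrightarrow> k (g x) = x"
      using Aut_inv[OF k(1)] by blast
    have "map (lift g) \<omega> = \<omega>" using map_lift_inv[of g k, OF g(2) \<Omega>_Meq[OF \<omega>]] unfolding k(2) by simp
    then have "map (lift g) (map (lift h) \<omega>) = \<omega>" unfolding h(2) .
    moreover have "map g (map h x) = r" using map_inv_car[of g k, OF g(2) r] unfolding k(3) by simp
    ultimately show "\<exists>h\<in>G. map (lift h) \<omega> = \<omega> \<and> map h x = r"
      using Aut_comp[OF g(1) h(1)] by (intro bexI[of _ "\<lambda>x. g (h x)"]) (simp_all add: lift_comp comp_def)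
  qed
  show thesis
  proof (rule that[OF R(1,2)])
    fix x assume x: "x \<in> tuples n (car M)"
    obtain r where r: "r \<in> R" "\<Phi> r = \<Phi> x" using R(3)[OF x] by blast
    have "x \<in> lists (car M)" "r \<in> lists (car M)" using x r(1) R(1) by (auto simp: tuples_def)
    then show "\<exists>r\<in>R. conj_eq x r" using key r by blast
  qed
qed

text \<open>The Lascar types of \<open>a\<close> and \<open>b\<close> are computed in
  \<open>M'\<close>, so the relation is carried there, by moving pairs into \<open>M\<close> over
  \<open>A0\<close>.\<close>

definition conj_super :: "nat \<Rightarrow> 'a list rel" where
  "conj_super n = {(x, y). x \<in> tuples n (car M') \<and> y \<in> tuples n (car M') \<and>
     (\<exists>s\<in>S.G. (\<forall>z\<in>A0. s z = z) \<and> map s x \<in> lists (car M) \<and> map s y \<in> lists (car M) \<and> conj_eq (map s x) (map s y))}"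

text \<open>Two ways of moving a pair into \<open>M\<close> over \<open>A0\<close> differ, on
  finitely many points, by an automorphism of \<open>M\<close> over \<open>A0\<close>, and
  \<open>conj_eq\<close> is invariant under these.\<close>

lemma conj_super_any:
  assumes xy: "(x, y) \<in> conj_super n" and t: "t \<in> S.G" "\<And>z. z \<in> A0 \<Longrightarrow> t z = z"
    and tM: "map t x \<in> lists (car M)" "map t y \<in> lists (car M)"
  shows "conj_eq (map t x) (map t y)"
proof -
  have xM: "x \<in> lists (car M')" "y \<in> lists (car M')" using xy by (simp_all add: conj_super_def tuples_def)
  obtain s where s: "s \<in> S.G" "\<And>z. z \<in> A0 \<Longrightarrow> s z = z" "map s x \<in> lists (car M)" "map s y \<in> lists (car M)"
      "conj_eq (map s x) (map s y)" using xy unfolding conj_super_def by blast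
  obtain s' where s': "s' \<in> S.G" "\<And>x. x \<in> car M' \<Longrightarrow> s' (s x) = x" "\<And>x. x \<in> car M' \<Longrightarrow> s (s' x) = x"
    using S.Aut_inv[OF s(1)] by blast
  define X where "X = A0 \<union> set (map s x) \<union> set (map s y)"
  have X: "X \<subseteq> car M" "|X| <o \<delta>"
    using A0 s(3,4) by (auto simp: X_def intro!: small_countable countable_finite)
  have s'A0: "s' z = z" if "z \<in> A0" for z using s'(2)[of z] s(2)[OF that] that A0_super by auto
  have s'x: "map s' (map s x) = x" "map s' (map s y) = y"
    using S.map_inv_car[of s' s, OF s'(2)] xM by blast+
  have "t ` s' ` X = A0 \<union> set (map t x) \<union> set (map t y)"
  proof -
    have "s' ` X = A0 \<union> set x \<union> set y"
      unfolding X_def image_Un set_map[symmetric, of s'] s'x using s'A0 by auto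
    moreover have "t ` A0 = A0" using t(2) by auto
    ultimately show ?thesis by (simp add: image_Un)
  qed
  then have "(\<lambda>z. t (s' z)) ` X \<subseteq> car M" using tM A0(2) by (auto simp: image_image)
  then obtain h where h: "h \<in> G" "\<And>z. z \<in> X \<Longrightarrow> h z = t (s' z)"
    using Aut_descend[OF S.Aut_comp[OF t(1) s'(1)] X] by blast
  have "h \<in> fixA0" using h s'A0 t(2) by (simp add: fixA0_def X_def)
  then have "conj_eq (map h (map s x)) (map h (map s y))" by (rule conj_eq_map[OF _ s(3,5)])
  moreover have "map h (map s x) = map t (map s' (map s x))" "map h (map s y) = map t (map s' (map s y))"
    using h(2) by (auto simp: X_def)
  ultimately show ?thesis by (simp only: s'x)
qed

lemma embed_A0:
  assumes "Z \<subseteq> car M'" "finite Z" "X \<subseteq> car M" "|X| <o \<delta>"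
  obtains s where "s \<in> S.G" "\<And>z. z \<in> A0 \<Longrightarrow> s z = z" "\<And>z. z \<in> X \<Longrightarrow> s z = z" "s ` Z \<subseteq> car M"
proof -
  have "A0 \<union> X \<subseteq> car M" "|A0 \<union> X| <o \<delta>" "|Z| <o \<delta>"
    using A0 A0_small assms by (auto intro: small_Un small_countable countable_finite)
  then show thesis using embed_over[of "A0 \<union> X" Z] assms(1) that by (metis UnCI)
qed

lemma conj_super_bounded: "conj_super n \<in> bounded_equivs S.U A0 n"
proof -
  let ?t = "tuples n (car M')" and ?E = "conj_super n"
  have in_lists: "map s x \<in> lists (car M)" if "s ` Z \<subseteq> car M" "set x \<subseteq> Z" for s x Z
    using that by (auto simp: in_lists_conv_set)
  have eq: "equiv ?t ?E"
    unfolding equiv_def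
  proof (intro conjI)
    show "?E \<subseteq> ?t \<times> ?t" by (auto simp: conj_super_def)
    show "refl_on ?t ?E"
      unfolding refl_on_def
    proof (intro ballI)
      fix x assume x: "x \<in> ?t"
      obtain s where s: "s \<in> S.G" "\<And>z. z \<in> A0 \<Longrightarrow> s z = z" "\<And>z. z \<in> {} \<Longrightarrow> s z = z" "s ` set x \<subseteq> car M"
        by (rule embed_A0[of "set x" "{}"]) (use x in \<open>auto simp: tuples_iff small_countable\<close>)
      then show "(x, x) \<in> ?E" using x in_lists[OF s(4)] conj_eq_refl unfolding conj_super_def by blast
    qed
    show "sym ?E" by (rule symI) (auto simp: conj_super_def intro: conj_eq_sym)
    show "trans ?E"
    proof (rule transI)
      fix x y z assume xy: "(x, y) \<in> ?E" and yz: "(y, z) \<in> ?E"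
      have t: "x \<in> ?t" "y \<in> ?t" "z \<in> ?t" using xy yz by (auto simp: conj_super_def)
      obtain s where s: "s \<in> S.G" "\<And>z. z \<in> A0 \<Longrightarrow> s z = z" "\<And>z. z \<in> {} \<Longrightarrow> s z = z" "s ` (set x \<union> set y \<union> set z) \<subseteq> car M"
        by (rule embed_A0[of "set x \<union> set y \<union> set z" "{}"]) (use t in \<open>auto simp: tuples_iff small_countable\<close>)
      have l: "map s x \<in> lists (car M)" "map s y \<in> lists (car M)" "map s z \<in> lists (car M)"
        using s(4) by (simp_all add: lists_eq_set image_Un)
      have "conj_eq (map s x) (map s z)"
        using conj_eq_trans[OF conj_super_any[OF xy s(1,2) l(1,2)] conj_super_any[OF yz s(1,2) l(2,3)]] .
      then show "(x, z) \<in> ?E" using t s(1,2) l unfolding conj_super_def by blast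
    qed
  qed
  have map1: "(map f x, map f y) \<in> ?E"
    if f: "f \<in> S.G" "\<And>z. z \<in> A0 \<Longrightarrow> f z = z" and xy: "(x, y) \<in> ?E" for f x y
  proof -
    have t: "x \<in> ?t" "y \<in> ?t" using xy by (auto simp: conj_super_def)
    then have ft: "map f x \<in> ?t" "map f y \<in> ?t" using f(1) by (auto simp: tuples_iff)
    obtain s where s: "s \<in> S.G" "\<And>z. z \<in> A0 \<Longrightarrow> s z = z" "\<And>z. z \<in> {} \<Longrightarrow> s z = z" "s ` (set (map f x) \<union> set (map f y)) \<subseteq> car M"
      by (rule embed_A0[of "set (map f x) \<union> set (map f y)" "{}"]) (use ft in \<open>auto simp: tuples_iff small_countable\<close>)
    have l: "map s (map f x) \<in> lists (car M)" "map s (map f y) \<in> lists (car M)"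
      by (rule in_lists[OF s(4) Un_upper1], rule in_lists[OF s(4) Un_upper2])
    have "conj_eq (map (\<lambda>z. s (f z)) x) (map (\<lambda>z. s (f z)) y)"
      using conj_super_any[OF xy S.Aut_comp[OF s(1) f(1)]] s(2) f(2) l by (simp add: comp_def)
    then have "conj_eq (map s (map f x)) (map s (map f y))" by (simp add: comp_def)
    then show ?thesis using ft s(1,2) l unfolding conj_super_def by blast
  qed
  have inv: "(x, y) \<in> ?E \<longleftrightarrow> (map f x, map f y) \<in> ?E"
    if f: "f \<in> S.G" "\<And>z. z \<in> A0 \<Longrightarrow> f z = z" and xy: "x \<in> ?t" "y \<in> ?t" for f x y
  proof -
    obtain g where g: "g \<in> S.G" "\<And>x. x \<in> car M' \<Longrightarrow> g (f x) = x" "\<And>x. x \<in> car M' \<Longrightarrow> f (g x) = x"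
      using S.Aut_inv[OF f(1)] by blast
    have "g z = z" if "z \<in> A0" for z using g(2)[of z] f(2)[OF that] that A0_super by auto
    moreover have "map g (map f x) = x" "map g (map f y) = y"
      using S.map_inv_car[of g f, OF g(2)] xy by (simp_all add: tuples_def del: map_map)
    ultimately show ?thesis using map1[OF f] map1[OF g(1), of "map f x" "map f y"] by metis
  qed
  obtain R where R: "R \<subseteq> tuples n (car M)" "|R| <o \<delta>" "\<And>x. x \<in> tuples n (car M) \<Longrightarrow> \<exists>r\<in>R. conj_eq x r"
    using conj_eq_reps[of n] by blast
  have RM: "\<Union>(set ` R) \<subseteq> car M" using R(1) by (fastforce simp: tuples_iff)
  have Rs: "|\<Union>(set ` R)| <o \<delta>" using R(2) by (intro small_UN) (auto intro: small_countable countable_finite)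
  have "?t // ?E \<subseteq> (\<lambda>r. ?E `` {r}) ` R"
  proof
    fix X assume "X \<in> ?t // ?E"
    then obtain x where x: "x \<in> ?t" "X = ?E `` {x}" by (auto elim: quotientE)
    \<comment> \<open>\<open>x\<close> is moved into \<open>M\<close> while all representatives stay
      fixed, so the representative \<open>r\<close> of the image is its own image and is related to
      \<open>x\<close> itself.\<close>
    obtain s where s: "s \<in> S.G" "\<And>z. z \<in> A0 \<Longrightarrow> s z = z" "\<And>z. z \<in> \<Union>(set ` R) \<Longrightarrow> s z = z" "s ` set x \<subseteq> car M"
      by (rule embed_A0[of "set x" "\<Union>(set ` R)"]) (use x RM Rs in \<open>auto simp: tuples_iff\<close>)
    have sx: "map s x \<in> tuples n (car M)" using s(4) x(1) by (auto simp: tuples_iff)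
    obtain r where r: "r \<in> R" "conj_eq (map s x) r" using R(3)[OF sx] by blast
    have sr: "map s r = r" using s(3) r(1) by (auto intro: map_idI)
    have rM: "r \<in> tuples n (car M)" using r(1) R(1) by blast
    then have rt: "r \<in> ?t" using lists_mono[OF M_super(3)] by (auto simp: tuples_def)
    have "map s x \<in> lists (car M)" "map s r \<in> lists (car M)" "conj_eq (map s x) (map s r)"
      using sx rM r(2) unfolding sr by (simp_all add: tuples_def)
    then have "(x, r) \<in> ?E" using s(1,2) x(1) rt unfolding conj_super_def by blast
    then have "X = ?E `` {r}" using equiv_class_eq[OF eq] x(2) by blast
    then show "X \<in> (\<lambda>r. ?E `` {r}) ` R" using r(1) by blast
  qed
  then have "|?t // ?E| <o \<delta>" using R(2) by (meson ordLess_image ordLess_subset)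
  then have "|?t // ?E| <o |car M'|" by (rule small_super)
  then show ?thesis using eq inv by (simp add: bounded_equivs_def aut_over_def)
qed

text \<open>\<open>b\<close> is moved into \<open>M\<close> over \<open>A0\<close>, \<open>c\<close>
  and \<open>a\<close>, and its image realizes \<open>p\<close> over \<open>c\<close>. Since
  \<open>conj_super\<close> is one of the relations tested by Lascar types, the image is conjugate
  to \<open>a\<close> over every member of \<open>\<Omega>\<close>, in particular over
  \<open>\<alpha>\<close>.\<close>

theorem Lt_realizes:
  assumes a: "a \<in> lists (car M)" and Lt: "Lt_eq S.U A0 b a" and c: "finite c" "c \<subseteq> car M"
  obtains d f where "Pr d c" "f \<in> G" "fx f" "map f d = a"
proof -
  have "(b, a) \<in> conj_super (length b)" using Lt conj_super_bounded unfolding Lt_super_iff by blast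
  moreover obtain s where s: "s \<in> S.G" "\<And>z. z \<in> A0 \<Longrightarrow> s z = z" "\<And>z. z \<in> c \<union> set a \<Longrightarrow> s z = z" "s ` set b \<subseteq> car M"
    by (rule embed_A0[of "set b" "c \<union> set a"]) (use a b c in \<open>auto intro: small_countable countable_finite\<close>)
  moreover have sa: "map s a = a" using s(3) by (auto intro: map_idI)
  moreover have sb: "map s b \<in> lists (car M)" using s(4) by (auto simp: in_lists_conv_set)
  ultimately have "conj_eq (map s b) a" using conj_super_any[of b a "length b" s] a by simp
  then obtain f where f: "f \<in> G" "fx f" "map f (map s b) = a" using alpha_\<Omega> unfolding conj_eq_def by blast
  have "S.eqv c b (map s b)" using s by (intro S.eqvI[of s]) auto
  then have "S.eqv c (map s b) b" using S.eqv_sym[OF _ b] c(2) M_super(3) by blast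
  then have "Pr (map s b) c" using sb c(1) by (simp add: Pr_def S.wtp_finite)
  then show thesis using that f by blast
qed

end

theorem lemma2p83:
  fixes K :: "('a, 'r, 'f) aec_data"
    and M M' :: "('a, 'r, 'f) fo_struct"
    and \<delta> :: "'a rel"
    and \<E> :: "'a list rel set"
    and a :: "'a list"
    and A :: "'a set"
    and \<alpha> :: "'a imag list"
  assumes "FUR_class K M \<delta>"
    and "supermonster K M M'"
    and "imaginary_family K M \<delta> \<E>"
    and "closed_under_base_relations K M M' \<E>"
    and "a \<in> lists (car M)"
    and "A \<subseteq> car M" and "|A| <o \<delta>"
    and "canonical_base K M M' \<E> \<alpha> a A"
  shows "stationary (ambient_eq K M \<delta> \<E>) (map (real_elt M) a) (set \<alpha>)"
proof -
  interpret fur_imag K M M' \<delta> \<E>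
    by (intro fur_imag.intro fur.intro fur_imag_axioms.intro assms(1-3))
  obtain b where bA: "b \<in> lists (car M')" "Lt_eq S.U A b a" "indep S.U b A (car M)"
    "canonical_base_of_type K M M' \<E> \<alpha> (global_type_of K M M' b)"
    using assms(8) unfolding canonical_base_def by blast
  interpret canonical K M M' \<delta> \<E> b \<alpha>
  proof
    show "b \<in> lists (car M')" "\<alpha> \<in> lists (Meq \<E>)" using bA by (simp_all add: canonical_base_of_type_def)
    show "fixes_global_type M (lift f) (global_type_of K M M' b) \<longleftrightarrow> map (lift f) \<alpha> = \<alpha>" if "f \<in> G" for f
      using bA(4) lift_aut[OF that] by (simp add: canonical_base_of_type_def)
  qed
  obtain A0 where wit: "finite A0" "A0 \<subseteq> A"
      "\<And>D. A \<union> car M \<subseteq> D \<Longrightarrow> D \<subseteq> car M' \<Longrightarrow> |D| <o |car M'| \<Longrightarrow>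
        \<exists>b2\<in>lists (car M'). wtp_eq S.U (A \<union> car M) b2 b \<and> \<not> Lascar_splits S.U b2 D A0"
    using bA(3) unfolding indep_def by (auto simp: ambient_of_simps)
  \<comment> \<open>\<open>car M\<close> is an admissible choice of \<open>D\<close>, since bounded
    in \<open>M'\<close> means of size below \<open>|M'|\<close>. The tuple \<open>b2\<close> has
    the type of \<open>b\<close> over \<open>M\<close>, so absence of Lascar splitting over
    \<open>A0\<close> passes to \<open>b\<close>.\<close>
  obtain b2 where b2: "b2 \<in> lists (car M')" "wtp_eq S.U (A \<union> car M) b2 b" "\<not> Lascar_splits S.U b2 (car M) A0"
    using wit(3)[of "car M"] assms(6) M_super(3) super_facts(3) by blast
  have A0M: "A0 \<subseteq> car M" using wit(2) assms(6) by blast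
  interpret invariant_base K M M' \<delta> \<E> b \<alpha> A0
  proof
    show "finite A0" "A0 \<subseteq> car M" by (rule wit, rule A0M)
    fix x y assume x: "x \<in> lists (car M)" and y: "y \<in> lists (car M)" and Lt: "Lt_eq S.U A0 x y"
    have same: "S.eqv A0 (b2 @ z) (b @ z)" if "z \<in> lists (car M)" for z
    proof (rule S.eqv_unfix(1))
      show "S.eqv (A0 \<union> set z) b2 b" using wit(1) A0M that by (intro S.wtpD[OF b2(2)]) auto
    qed
    have "wtp_eq S.U A0 (b2 @ x) (b2 @ y)" using b2(3) x y Lt unfolding Lascar_splits_def by blast
    then have 1: "S.eqv A0 (b2 @ x) (b2 @ y)" using S.wtp_finite[OF wit(1)] by blast
    have "b2 @ x \<in> lists (car M')" using b2(1) x M_super(3) by (auto simp: in_lists_conv_set)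
    then have "S.eqv A0 (b @ x) (b2 @ x)" using S.eqv_sym[OF same[OF x]] A0M M_super(3) by blast
    then show "S.eqv A0 (b @ x) (b @ y)" using S.eqv_trans[OF S.eqv_trans[OF _ 1] same[OF y]] by blast
  qed
  obtain c where c: "finite c" "Cov c" using Cov_exists by blast
  have "Lt_eq S.U A0 b a" using bA(2) wit(2) unfolding Lt_eq_def by (meson order_trans)
  then obtain d f where d: "Pr d c" "f \<in> G" "fx f" "map f d = a"
    using Lt_realizes[OF assms(5) _ c(1)] c(2) unfolding Cov_def by blast
  show ?thesis by (rule stationary_canonical[OF c d])
qed

end
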